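(* For every $\alpha>0$ there is a constant $C_\alpha>0$ depending only on $\alpha$ such that the following holds. Let $n\ge1$ be an integer, and let $X\in\mathrm{Proj}_{\mathbb{F}}(1,2n)$ and $\delta>0$ be fixed. If $m$ is a positive integer with $m\ge C_\alpha\delta^{-2}n\log(n)$ and $\mathcal{P}=\{P_j\}_{j=1}^m$ is an independent sequence of uniformly distributed projections in $\mathrm{Proj}_{\mathbb{F}}(n,2n)$, then with probability at least $1-n^{-\alpha}$ $$\|\hat X-X\|<\delta,$$ where $\hat X$ is the solution to the Principal Eigenspace Program (PEP) with input $\Phi_{\mathcal{P}}(X)$.
   Context: $\mathbb{F}$ is either $\mathbb{R}$ or $\mathbb{C}$. $\mathrm{Proj}_{\mathbb{F}}(k,d)$ is the set of rank-$k$ orthogonal projections on $\mathbb{F}^d$; its uniform distribution is the unique probability measure invariant under conjugation by all orthogonal ($\mathbb{F}=\mathbb{R}$) or unitary ($\mathbb{F}=\mathbb{C}$) $d\times d$ matrices. $\|\cdot\|$ on matrices is the operator norm. For $P\in\mathrm{Proj}_{\mathbb{F}}(n,2n)$ and $X\in\mathrm{Proj}_{\mathbb{F}}(1,2n)$, $\phi_P(X)=1$ if $\mathrm{tr}(PX)\ge\frac12$ and $\phi_P(X)=0$ otherwise. For $\mathcal{P}=\{P_j\}_{j=1}^m$, the binary measurement map is $\Phi_{\mathcal{P}}(X)=(\phi_{P_j}(X))_{j=1}^m\in\{0,1\}^m$. (PEP) with input $b\in\{0,1\}^m$: put $Q_b=\frac1m\sum_{j=1}^m R_j$, where $R_j=P_j$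 if $b_j=1$ and $R_j=I-P_j$ if $b_j=0$, and maximize $\mathrm{tr}(Q_bY)$ over positive semidefinite $Y\in\mathbb{F}^{2n\times 2n}$ with $\mathrm{tr}(Y)\le1$. The solution is taken to be a rank-one orthogonal projection onto a line in the eigenspace of the largest eigenvalue of $Q_b$; when that eigenvalue is simple (which happens with probability 1 in this random model) it is the unique solution, namely the orthogonal projection onto that eigenspace. *)

theory Defs
  imports
    "HOL-Probability.Probability"
    "Jordan_Normal_Form.Schur_Decomposition"
    "Jordan_Normal_Form.DL_Rank"
begin

unbundle no vec_syntax

(* All notions are polymorphic in the scalar field; they are meant for real and complex only.
   On real, conjugate is the identity, so mat_adjoint is the transpose and "unitary" means
   orthogonal.  On complex, x \<le> y means Re x \<le> Re y and Im x = Im y; below it is only used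
   to compare quantities that are real by Hermitian symmetry. *)

definition mat_trace :: "'a::comm_monoid_add mat \<Rightarrow> 'a" where
  "mat_trace A = (\<Sum>i<dim_row A. A $$ (i, i))"

definition vec_l2_norm :: "'a::real_normed_field vec \<Rightarrow> real" where
  "vec_l2_norm v = L2_set (\<lambda>i. norm (vec_index v i)) {..<dim_vec v}"

definition op_norm :: "'a::real_normed_field mat \<Rightarrow> real" where
  "op_norm A =
     Sup ((\<lambda>v. vec_l2_norm (A *\<^sub>v v)) ` {v \<in> carrier_vec (dim_col A). vec_l2_norm v \<le> 1})"

definition unitary_mats :: "nat \<Rightarrow> 'a::conjugatable_field mat set" where
  "unitary_mats d =
     {U \<in> carrier_mat d d. U * mat_adjoint U = 1\<^sub>m d \<and> mat_adjoint U * U = 1\<^sub>m d}"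

definition psd_mats :: "nat \<Rightarrow> 'a::conjugatable_ordered_field mat set" where
  "psd_mats d =
     {A \<in> carrier_mat d d. mat_adjoint A = A \<and> (\<forall>v \<in> carrier_vec d. 0 \<le> (A *\<^sub>v v) \<bullet>c v)}"

definition Proj :: "nat \<Rightarrow> nat \<Rightarrow> 'a::conjugatable_field mat set" where
  "Proj k d =
     {P \<in> carrier_mat d d. P * P = P \<and> mat_adjoint P = P \<and> vec_space.rank d P = k}"

(* The Borel sigma-algebra on Proj k d, as a subspace of the space of d x d matrices:
   the one generated by the matrix entries. *)
definition proj_borel ::
    "nat \<Rightarrow> nat \<Rightarrow> 'a::{conjugatable_field, real_normed_field} mat measure" where
  "proj_borel k d =
     vimage_algebra (Proj k d) (\<lambda>P. \<lambda>ij\<in>{..<d} \<times> {..<d}. P $$ ij)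
       (Pi\<^sub>M ({..<d} \<times> {..<d}) (\<lambda>_. borel))"

definition uniform_on_Proj ::
    "nat \<Rightarrow> nat \<Rightarrow> 'a::{conjugatable_field, real_normed_field} mat measure \<Rightarrow> bool" where
  "uniform_on_Proj k d \<mu> \<longleftrightarrow>
     prob_space \<mu> \<and> sets \<mu> = sets (proj_borel k d) \<and>
     (\<forall>U \<in> unitary_mats d. distr \<mu> \<mu> (\<lambda>P. U * P * mat_adjoint U) = \<mu>)"

definition phi ::
    "'a::conjugatable_ordered_field mat \<Rightarrow> 'a mat \<Rightarrow> nat" where
  "phi P X = (if 1 / 2 \<le> mat_trace (P * X) then 1 else 0)"

(* Only the entries j < m of a family of projections or of a bit string are relevant. *)
definition Phi ::
    "(nat \<Rightarrow> 'a::conjugatable_ordered_field mat) \<Rightarrow> 'a mat \<Rightarrow> nat \<Rightarrow> nat" where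
  "Phi Ps X = (\<lambda>j. phi (Ps j) X)"

definition pep_matrix ::
    "nat \<Rightarrow> nat \<Rightarrow> (nat \<Rightarrow> 'a::field mat) \<Rightarrow> (nat \<Rightarrow> nat) \<Rightarrow> 'a mat" where
  "pep_matrix d m Ps b =
     mat d d (\<lambda>ij. 1 / of_nat m * (\<Sum>j<m. (if b j = 1 then Ps j else 1\<^sub>m d - Ps j) $$ ij))"

definition pep_feasible :: "nat \<Rightarrow> 'a::conjugatable_ordered_field mat set" where
  "pep_feasible d = {Y \<in> psd_mats d. mat_trace Y \<le> 1}"

(* Y is a maximizer that is a rank-one projection onto a line in the eigenspace of the
   largest eigenvalue.  It is unique exactly when that eigenvalue is simple, so this is a
   predicate and not a function. *)
definition pep_solution ::
    "nat \<Rightarrow> nat \<Rightarrow> (nat \<Rightarrow> 'a::conjugatable_ordered_field mat) \<Rightarrow> (nat \<Rightarrow> nat) \<Rightarrow> 'a mat \<Rightarrow> bool"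
  where
  "pep_solution d m Ps b Y \<longleftrightarrow>
     (let Q = pep_matrix d m Ps b in
        Y \<in> pep_feasible d \<and>
        (\<forall>Z \<in> pep_feasible d. mat_trace (Q * Z) \<le> mat_trace (Q * Y)) \<and>
        Y \<in> Proj 1 d \<and>
        (\<exists>l. eigenvalue Q l \<and> (\<forall>k. eigenvalue Q k \<longrightarrow> k \<le> l) \<and>
             (\<forall>v \<in> carrier_vec d. Q *\<^sub>v (Y *\<^sub>v v) = l \<cdot>\<^sub>v (Y *\<^sub>v v))))"

end

theory Submission
  imports Defs
begin

text \<open>
  Let \<open>d = 2 n\<close> and \<open>X = outer x\<close> for a unit vector \<open>x\<close>. Replace each projection \<open>P\<close> by the reflection
  \<open>T = 2 P - 1\<close>. The bit recorded for \<open>X\<close> is the sign of the quadratic form of \<open>T\<close> at \<open>x\<close>, and the matrix of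
  the program is, up to an affine transformation, the average of the reflections multiplied by these signs.
  The mean of this average commutes with all symmetries that fix the line of \<open>x\<close>, so it is diagonal: it has
  the eigenvalue \<open>a\<close>, the expected absolute value of the form of \<open>T\<close> at \<open>x\<close>, on the line and a constant
  \<open>b \<le> 0\<close> on its orthogonal complement. Hence \<open>X\<close> solves the program for the mean, and the spectral gap
  \<open>a - b\<close> is at least of order \<open>1 / sqrt d\<close> (\<open>mean_form_gap\<close>). It remains to show that the average is close
  to its mean.

  All analytic information about the uniform distribution comes from its invariance. A rotation of a
  coordinate plane leaves expectations unchanged; differentiating at angle zero gives a recursion for the
  moments of the form at a unit vector (\<open>rotation_identity\<close>, \<open>unit_moment_Suc_le\<close>). It follows that the form at every fixed unit vector is subgaussian with variance of
  order \<open>1 / d\<close> (\<open>exp_square_moment\<close>), and multiplication by a sign does not affect this. A lower bound on the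
  second moment, which holds because \<open>T\<close> is an isometry, then bounds \<open>a\<close> from below
  (\<open>expectation_abs_rquad_ge\<close>).

  At a fixed vector, the average of \<open>m\<close> signed reflections therefore deviates from its mean by \<open>\<tau>\<close> with
  probability at most \<open>2 exp (- m d \<tau>\<^sup>2 / 80)\<close> (\<open>chernoff_one_sided\<close>). The gap allows a deviation \<open>\<tau>\<close> of order
  \<open>\<delta> / sqrt d\<close>, so with \<open>m\<close> of order \<open>n log n / \<delta>\<^sup>2\<close> this probability is \<open>exp (- C n log n)\<close> for a large constant
  \<open>C\<close>. That is small enough for a union bound over a grid of \<open>exp (O (n log n))\<close> points, and control on the
  grid gives control in operator norm (\<open>finite_net\<close>, \<open>bilin_net_bound\<close>). The variance \<open>1 / d\<close> at a fixed vector is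
  what lets the tail bound outweigh the size of the grid. A perturbation bound of Davis and Kahan's type turns
  the estimate into \<open>\<delta>\<close>-closeness of the top eigenvector to \<open>x\<close>
  (\<open>top_vector_perturbation\<close>).

  Two facts connect this with the statement. The solutions of the program are exactly the projections onto the
  lines of unit vectors that maximize the averaged form (\<open>pep_solution_iff\<close>), and the event that all of them
  are close to \<open>X\<close> is measurable by compactness of the sphere (\<open>recovered_measurable\<close>).
\<close>

section \<open>Real and complex scalars\<close>

text \<open>The only structure that separates \<^typ>\<open>real\<close> from \<^typ>\<open>complex\<close> here is the conjugation, and
  \<open>a * conjugate a = |a|\<^sup>2\<close> pins it down: polarizing this identity expresses the real part of
  \<open>a * conjugate b\<close> by the Euclidean inner product, and the order on the scalars that are their own
  conjugates is the usual one. Working in this class proves the real and the complex case at once.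
  The dimension bound enters the construction of a net and a second moment estimate.\<close>

class real_or_complex = conjugatable_ordered_field + real_normed_field + euclidean_space +
  assumes mult_conjugate_scaleR: "a * conjugate a = (norm a)\<^sup>2 *\<^sub>R 1"
    and card_Basis_le_2: "card (Basis :: 'a set) \<le> 2"

instance real :: real_or_complex
proof
  show "a * conjugate a = (norm a)\<^sup>2 *\<^sub>R 1" for a :: real
    by (simp add: power2_eq_square)
  show "card (Basis :: real set) \<le> 2"
    by simp
qed

instance complex :: real_or_complex
proof
  show "a * conjugate a = (norm a)\<^sup>2 *\<^sub>R 1" for a :: complex
    using complex_norm_square[of a] by (simp add: scaleR_conv_of_real)
  show "card (Basis :: complex set) \<le> 2"
    by simp
qed

lemma mult_conjugate: "a * conjugate a = of_real ((norm (a :: 'a::real_or_complex))\<^sup>2)"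
  by (simp add: mult_conjugate_scaleR of_real_def)

lemma conjugate_of_real [simp]: "conjugate (of_real r :: 'a::real_or_complex) = of_real r"
proof (cases "r = 0")
  case False
  have "of_real r * conjugate (of_real r :: 'a) = of_real r * of_real r"
    by (simp add: mult_conjugate power2_eq_square)
  then show ?thesis using False by simp
qed simp

lemma conjugate_one [simp]: "conjugate (1 :: 'a::real_or_complex) = 1"
  using conjugate_of_real[of 1] by simp

lemma conjugate_diff: "conjugate (a - b :: 'a::real_or_complex) = conjugate a - conjugate b"
  using conjugate_dist_add[of a "- b"] by (simp add: conjugate_neg)

lemma conjugate_sum: "conjugate (\<Sum>i\<in>I. f i :: 'a::real_or_complex) = (\<Sum>i\<in>I. conjugate (f i))"
  by (cases "finite I") (simp_all add: sum_conjugate)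

lemma norm_conjugate [simp]: "norm (conjugate a :: 'a::real_or_complex) = norm a"
proof (cases "a = 0")
  case False
  have "norm (a * conjugate a) = norm a * norm a"
    by (simp add: mult_conjugate power2_eq_square norm_mult)
  then show ?thesis using False by (simp add: norm_mult)
qed simp

lemma mult_conjugate_symm:
  "x * conjugate y + y * conjugate x = of_real (2 * inner x (y :: 'a::real_or_complex))"
proof -
  have "x * conjugate y + y * conjugate x
      = (x + y) * conjugate (x + y) - x * conjugate x - y * conjugate y"
    by (simp add: conjugate_dist_add algebra_simps)
  also have "\<dots> = of_real ((norm (x + y))\<^sup>2 - (norm x)\<^sup>2 - (norm y)\<^sup>2)"
    by (simp only: mult_conjugate of_real_diff)
  also have "(norm (x + y))\<^sup>2 - (norm x)\<^sup>2 - (norm y)\<^sup>2 = 2 * inner x y"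
    by (simp add: power2_norm_eq_inner inner_add inner_commute)
  finally show ?thesis .
qed

lemma inner_eq_re: "inner x (y :: 'a::real_or_complex) = inner (x * conjugate y) 1"
  using mult_conjugate_symm[of x y] mult_conjugate_symm[of "x * conjugate y" 1]
  by (simp add: conjugate_dist_mul mult.commute)

lemma inner_mult_left: "inner (c * x) (y :: 'a::real_or_complex) = inner x (conjugate c * y)"
  by (subst (1 2) inner_eq_re) (simp add: conjugate_dist_mul ac_simps)

lemma selfconj_eq_of_real: "conjugate z = z \<Longrightarrow> (z :: 'a::real_or_complex) = of_real (inner z 1)"
  using mult_conjugate_symm[of z 1] by simp

lemma inner_of_real_1 [simp]: "inner (of_real r :: 'a::real_or_complex) 1 = r"
  using selfconj_eq_of_real[of "of_real r :: 'a"] by simp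

lemma inner_1_1 [simp]: "inner (1 :: 'a::real_or_complex) 1 = 1"
  using inner_of_real_1[of 1] by simp

lemma of_real_le_iff_roc [simp]: "(of_real a :: 'a::real_or_complex) \<le> of_real b \<longleftrightarrow> a \<le> b"
proof -
  have imp: "(of_real x :: 'a) \<le> of_real y" if "x \<le> y" for x y
  proof -
    have "0 \<le> (of_real (sqrt (y - x)) :: 'a) * conjugate (of_real (sqrt (y - x)))"
      by (rule conjugate_square_positive)
    also have "\<dots> = of_real (y - x)"
      using that by (simp flip: of_real_mult)
    finally have "of_real x + 0 \<le> of_real x + (of_real (y - x) :: 'a)"
      by (rule add_left_mono)
    then show ?thesis by simp
  qed
  show ?thesis
    using imp[of a b] imp[of b a] by (metis linear of_real_eq_iff order_antisym)
qed

lemma of_real_ge0_roc [simp]: "0 \<le> (of_real b :: 'a::real_or_complex) \<longleftrightarrow> 0 \<le> b"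
  using of_real_le_iff_roc[of 0 b] by simp

lemma of_real_le1_roc [simp]: "(of_real b :: 'a::real_or_complex) \<le> 1 \<longleftrightarrow> b \<le> 1"
  using of_real_le_iff_roc[of b 1] by simp

lemma ex_phase: "\<exists>c. norm c = 1 \<and> c * z = of_real (norm (z :: 'a::real_or_complex))"
proof (cases "z = 0")
  case False
  have "(conjugate z / of_real (norm z)) * z = of_real (norm z)"
    using False mult_conjugate[of z] by (simp add: field_simps power2_eq_square)
  moreover have "norm (conjugate z / of_real (norm z)) = 1"
    using False by (simp add: norm_divide)
  ultimately show ?thesis by blast
qed (auto intro: exI[of _ 1])


section \<open>The real inner product on vectors\<close>

text \<open>Every quantity in the argument (traces, quadratic forms, squared norms) is real, so the real part of
  the Hermitian product is used throughout. It is bilinear over the reals, which makes symmetric and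
  Hermitian matrices look the same.\<close>

definition rip :: "'a::real_or_complex vec \<Rightarrow> 'a vec \<Rightarrow> real" where
  "rip v w = inner (v \<bullet>c w) 1"

lemma rip_eq_sum:
  assumes "v \<in> carrier_vec d" "w \<in> carrier_vec d"
  shows "rip v w = (\<Sum>i<d. inner (v $ i) (w $ i))"
  using assms unfolding rip_def scalar_prod_def
  by (auto simp: inner_sum_left atLeast0LessThan inner_eq_re[symmetric] intro!: sum.cong)

lemma cscalar_prod_sum:
  assumes "v \<in> carrier_vec d" "w \<in> carrier_vec d"
  shows "v \<bullet>c w = (\<Sum>i<d. v $ i * conjugate (w $ i))"
  using assms by (auto simp: scalar_prod_def atLeast0LessThan intro!: sum.cong)

lemma rip_commute:
  "v \<in> carrier_vec d \<Longrightarrow> w \<in> carrier_vec d \<Longrightarrow> rip v w = rip w v"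
  by (simp add: rip_eq_sum[of _ d] inner_commute)

lemma rip_add_left:
  "u \<in> carrier_vec d \<Longrightarrow> v \<in> carrier_vec d \<Longrightarrow> w \<in> carrier_vec d \<Longrightarrow> rip (u + v) w = rip u w + rip v w"
  by (simp add: rip_eq_sum[of _ d] inner_add_left sum.distrib)

lemma rip_add_right:
  "u \<in> carrier_vec d \<Longrightarrow> v \<in> carrier_vec d \<Longrightarrow> w \<in> carrier_vec d \<Longrightarrow> rip w (u + v) = rip w u + rip w v"
  by (simp add: rip_eq_sum[of _ d] inner_add_right sum.distrib)

lemma rip_diff_left:
  "u \<in> carrier_vec d \<Longrightarrow> v \<in> carrier_vec d \<Longrightarrow> w \<in> carrier_vec d \<Longrightarrow> rip (u - v) w = rip u w - rip v w"
  by (simp add: rip_eq_sum[of _ d] inner_diff_left sum_subtractf)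

lemma rip_diff_right:
  "u \<in> carrier_vec d \<Longrightarrow> v \<in> carrier_vec d \<Longrightarrow> w \<in> carrier_vec d \<Longrightarrow> rip w (u - v) = rip w u - rip w v"
  by (simp add: rip_eq_sum[of _ d] inner_diff_right sum_subtractf)

lemma rip_of_real_left:
  "v \<in> carrier_vec d \<Longrightarrow> w \<in> carrier_vec d \<Longrightarrow> rip (of_real r \<cdot>\<^sub>v v) w = r * rip v w"
  by (simp add: rip_eq_sum[of _ d] sum_distrib_left flip: scaleR_conv_of_real)

lemma rip_of_real_right:
  "v \<in> carrier_vec d \<Longrightarrow> w \<in> carrier_vec d \<Longrightarrow> rip v (of_real r \<cdot>\<^sub>v w) = r * rip v w"
  by (simp add: rip_eq_sum[of _ d] sum_distrib_left flip: scaleR_conv_of_real)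

lemma rip_self: "v \<in> carrier_vec d \<Longrightarrow> rip v v = (\<Sum>i<d. (norm (v $ i))\<^sup>2)"
  by (simp add: rip_eq_sum[of _ d] power2_norm_eq_inner)

lemma rip_self_nonneg [simp]: "0 \<le> rip v v"
  using rip_self[of v "dim_vec v"] by (simp add: sum_nonneg)

lemma vec_l2_norm_sq: "(vec_l2_norm v)\<^sup>2 = rip v v"
  using rip_self[of v "dim_vec v"] by (simp add: vec_l2_norm_def L2_set_def sum_nonneg)

lemma cscalar_prod_self: "v \<bullet>c v = of_real (rip v v)"
  by (simp add: cscalar_prod_sum[of v "dim_vec v" v] rip_self[of v "dim_vec v"] mult_conjugate)

lemma rip_self_eq_0: "v \<in> carrier_vec d \<Longrightarrow> rip v v = 0 \<longleftrightarrow> v = 0\<^sub>v d"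
  by (auto simp: rip_self sum_nonneg_eq_0_iff intro!: eq_vecI)

lemma inner_mult_mult: "inner (c * a) (c * b) = (norm c)\<^sup>2 * inner a (b :: 'a::real_or_complex)"
proof -
  have "inner (c * a) (c * b) = inner a ((c * conjugate c) * b)"
    by (subst inner_mult_left) (simp add: mult_ac)
  also have "\<dots> = inner a ((norm c)\<^sup>2 *\<^sub>R b)"
    by (simp only: mult_conjugate scaleR_conv_of_real)
  finally show ?thesis by simp
qed

lemma rip_smult_smult:
  "v \<in> carrier_vec d \<Longrightarrow> w \<in> carrier_vec d \<Longrightarrow> rip (c \<cdot>\<^sub>v v) (c \<cdot>\<^sub>v w) = (norm c)\<^sup>2 * rip v w"
  by (simp add: rip_eq_sum[of _ d] sum_distrib_left inner_mult_mult)

lemma norm_cscalar_prod_le: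
  fixes v w :: "'a::real_or_complex vec"
  assumes "v \<in> carrier_vec d" "w \<in> carrier_vec d"
  shows "(norm (v \<bullet>c w))\<^sup>2 \<le> rip v v * rip w w"
proof -
  have "norm (v \<bullet>c w) \<le> (\<Sum>i<d. norm (v $ i * conjugate (w $ i)))"
    using norm_sum by (simp add: cscalar_prod_sum[OF assms])
  also have "\<dots> = (\<Sum>i<d. \<bar>norm (v $ i)\<bar> * \<bar>norm (w $ i)\<bar>)"
    by (simp add: norm_mult)
  also have "\<dots> \<le> L2_set (\<lambda>i. norm (v $ i)) {..<d} * L2_set (\<lambda>i. norm (w $ i)) {..<d}"
    by (rule L2_set_mult_ineq)
  also have "\<dots> = vec_l2_norm v * vec_l2_norm w"
    using assms by (simp add: vec_l2_norm_def)
  finally have "(norm (v \<bullet>c w))\<^sup>2 \<le> (vec_l2_norm v * vec_l2_norm w)\<^sup>2"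
    by (intro power_mono) auto
  then show ?thesis
    by (simp only: power_mult_distrib vec_l2_norm_sq)
qed

lemma conjugate_cscalar_prod:
  fixes v w :: "'a::real_or_complex vec"
  assumes "v \<in> carrier_vec d" "w \<in> carrier_vec d"
  shows "conjugate (v \<bullet>c w) = w \<bullet>c v"
  using assms by (simp add: cscalar_prod_sum[of _ d] conjugate_sum conjugate_dist_mul mult.commute)

lemma mat_adjoint_index [simp]:
  "i < dim_col A \<Longrightarrow> j < dim_row A \<Longrightarrow> mat_adjoint A $$ (i, j) = conjugate (A $$ (j, i))"
  by (simp add: mat_adjoint_def mat_of_rows_index)

lemma mat_adjoint_dim [simp]: "dim_row (mat_adjoint A) = dim_col A" "dim_col (mat_adjoint A) = dim_row A"
  by (simp_all add: mat_adjoint_def)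

lemma mult_mat_vec_sum:
  "A \<in> carrier_mat n d \<Longrightarrow> v \<in> carrier_vec d \<Longrightarrow> i < n \<Longrightarrow> (A *\<^sub>v v) $ i = (\<Sum>j<d. A $$ (i, j) * v $ j)"
  by (auto simp: scalar_prod_def atLeast0LessThan intro!: sum.cong)

lemma cscalar_prod_adjoint:
  fixes A :: "'a::real_or_complex mat"
  assumes "A \<in> carrier_mat n d" "v \<in> carrier_vec d" "w \<in> carrier_vec n"
  shows "(A *\<^sub>v v) \<bullet>c w = v \<bullet>c (mat_adjoint A *\<^sub>v w)"
proof -
  have adj: "mat_adjoint A \<in> carrier_mat d n"
    using assms by auto
  have "(A *\<^sub>v v) \<bullet>c w = (\<Sum>i<n. \<Sum>j<d. A $$ (i, j) * v $ j * conjugate (w $ i))"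
    using assms by (simp add: cscalar_prod_sum[of _ n] mult_mat_vec_sum[of A n d] sum_distrib_right del: index_mult_mat_vec)
  also have "\<dots> = (\<Sum>j<d. \<Sum>i<n. A $$ (i, j) * v $ j * conjugate (w $ i))"
    by (rule sum.swap)
  also have "\<dots> = v \<bullet>c (mat_adjoint A *\<^sub>v w)"
    using assms adj
    by (simp add: cscalar_prod_sum[of _ d] mult_mat_vec_sum[of "mat_adjoint A" d n] sum_distrib_left
        conjugate_sum conjugate_dist_mul ac_simps del: index_mult_mat_vec)
  finally show ?thesis .
qed

lemma rip_adjoint:
  fixes A :: "'a::real_or_complex mat"
  assumes "A \<in> carrier_mat n d" "v \<in> carrier_vec d" "w \<in> carrier_vec n"
  shows "rip (A *\<^sub>v v) w = rip v (mat_adjoint A *\<^sub>v w)"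
  using cscalar_prod_adjoint[OF assms] by (simp add: rip_def)

lemma rip_unit_vec [simp]: "i < d \<Longrightarrow> j < d \<Longrightarrow> rip (unit_vec d i) (unit_vec d j :: 'a::real_or_complex vec) = of_bool (i = j)"
  by (auto simp: rip_eq_sum[of _ d] unit_vec_def if_distrib[of "inner _"] cong: if_cong)

lemma mat_eqI_action:
  fixes A B :: "'a::field mat"
  assumes "A \<in> carrier_mat n d" "B \<in> carrier_mat n d" "\<And>v. v \<in> carrier_vec d \<Longrightarrow> A *\<^sub>v v = B *\<^sub>v v"
  shows "A = B"
proof (rule eq_matI)
  fix i j assume ij: "i < dim_row B" "j < dim_col B"
  have "A *\<^sub>v unit_vec d j = B *\<^sub>v unit_vec d j" by (rule assms(3)) simp
  then have "(A *\<^sub>v unit_vec d j) $ i = (B *\<^sub>v unit_vec d j) $ i" by simp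
  then show "A $$ (i, j) = B $$ (i, j)"
    using assms(1,2) ij by (simp add: mult_mat_vec_def)
qed (use assms in auto)

section \<open>Orthogonal projections\<close>

definition orth_proj :: "nat \<Rightarrow> 'a::real_or_complex mat \<Rightarrow> bool" where
  "orth_proj d P \<longleftrightarrow> P \<in> carrier_mat d d \<and> P * P = P \<and> mat_adjoint P = P"

definition outer :: "'a::real_or_complex vec \<Rightarrow> 'a mat" where
  "outer v = mat (dim_vec v) (dim_vec v) (\<lambda>(i, j). v $ i * conjugate (v $ j))"

lemma outer_carrier [simp]: "v \<in> carrier_vec d \<Longrightarrow> outer v \<in> carrier_mat d d"
  by (auto simp: outer_def)

lemma outer_dim [simp]: "dim_row (outer v) = dim_vec v" "dim_col (outer v) = dim_vec v"
  by (simp_all add: outer_def)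

lemma outer_index [simp]:
  "v \<in> carrier_vec d \<Longrightarrow> i < d \<Longrightarrow> j < d \<Longrightarrow> outer v $$ (i, j) = v $ i * conjugate (v $ j)"
  by (auto simp: outer_def)

lemma outer_mult_vec:
  assumes "v \<in> carrier_vec d" "w \<in> carrier_vec d"
  shows "outer v *\<^sub>v w = (w \<bullet>c v) \<cdot>\<^sub>v v"
proof (rule eq_vecI)
  fix i assume "i < dim_vec ((w \<bullet>c v) \<cdot>\<^sub>v v)"
  then have i: "i < d" using assms by simp
  have "(outer v *\<^sub>v w) $ i = (\<Sum>j<d. v $ i * conjugate (v $ j) * w $ j)"
    using assms i by (subst mult_mat_vec_sum[of _ d d]) auto
  also have "\<dots> = (w \<bullet>c v) * v $ i"
    using assms by (simp add: cscalar_prod_sum[of _ d] sum_distrib_left sum_distrib_right ac_simps)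
  finally show "(outer v *\<^sub>v w) $ i = ((w \<bullet>c v) \<cdot>\<^sub>v v) $ i"
    using assms i by simp
qed (use assms in \<open>auto simp: outer_def\<close>)

lemma mat_adjoint_outer [simp]: "mat_adjoint (outer v) = outer v"
  by (rule eq_matI) (auto simp: outer_def conjugate_dist_mul)

lemma mat_trace_outer: "v \<in> carrier_vec d \<Longrightarrow> mat_trace (outer v) = of_real (rip v v)"
  by (simp add: mat_trace_def rip_self mult_conjugate outer_def)

lemma mat_trace_diff:
  "A \<in> carrier_mat d d \<Longrightarrow> B \<in> carrier_mat d d \<Longrightarrow> mat_trace (A - B) = mat_trace A - (mat_trace B :: 'a::ab_group_add)"
  by (simp add: mat_trace_def sum_subtractf)

lemma mat_trace_add:
  "A \<in> carrier_mat d d \<Longrightarrow> B \<in> carrier_mat d d \<Longrightarrow> mat_trace (A + B) = mat_trace A + (mat_trace B :: 'a::ab_group_add)"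
  by (simp add: mat_trace_def sum.distrib)

lemma mat_adjoint_diff:
  "A \<in> carrier_mat n d \<Longrightarrow> B \<in> carrier_mat n d \<Longrightarrow> mat_adjoint (A - B :: 'a::real_or_complex mat) = mat_adjoint A - mat_adjoint B"
  by (rule eq_matI) (auto simp: conjugate_diff)

lemma mat_adjoint_one [simp]: "mat_adjoint (1\<^sub>m d :: 'a::real_or_complex mat) = 1\<^sub>m d"
  by (rule eq_matI) auto

lemma mat_adjoint_carrier [simp]: "A \<in> carrier_mat n d \<Longrightarrow> mat_adjoint A \<in> carrier_mat d n"
  by auto

lemma orth_proj_complement:
  assumes "orth_proj d P" shows "orth_proj d (1\<^sub>m d - P)"
proof -
  have P: "P \<in> carrier_mat d d" "P * P = P" "mat_adjoint P = P"
    using assms by (auto simp: orth_proj_def)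
  have C: "1\<^sub>m d - P \<in> carrier_mat d d" using P by (simp add: minus_carrier_mat)
  have "P * (1\<^sub>m d - P) = 0\<^sub>m d d"
    using P mult_minus_distrib_mat[of P d d "1\<^sub>m d" d P] by (simp add: minus_r_inv_mat)
  then have "(1\<^sub>m d - P) * (1\<^sub>m d - P) = (1\<^sub>m d - P) - 0\<^sub>m d d"
    using P C by (simp add: minus_mult_distrib_mat[of _ d d])
  also have "\<dots> = 1\<^sub>m d - P" using P by (intro eq_matI) auto
  finally show ?thesis
    using P C by (simp add: orth_proj_def mat_adjoint_diff[of _ d d])
qed

lemma orth_proj_outer:
  assumes "u \<in> carrier_vec d" "rip u u = 1"
  shows "orth_proj d (outer u)"
proof -
  have "outer u * outer u = outer u"
  proof (rule mat_eqI_action[where n = d and d = d])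
    fix v :: "'a vec" assume v: "v \<in> carrier_vec d"
    have "outer u * outer u *\<^sub>v v = outer u *\<^sub>v (outer u *\<^sub>v v)"
      using assms v by (simp add: assoc_mult_mat_vec[of _ d d _ d])
    also have "\<dots> = outer u *\<^sub>v v"
      using assms v by (simp add: outer_mult_vec[of _ d] cscalar_prod_self)
    finally show "outer u * outer u *\<^sub>v v = outer u *\<^sub>v v" .
  qed (use assms in auto)
  then show ?thesis using assms by (auto simp: orth_proj_def)
qed

text \<open>The diagonal of \<open>P = P * adjoint P\<close> consists of squared row norms, so the trace is the squared
  Frobenius norm. In particular a projection of trace zero vanishes.\<close>

lemma orth_proj_trace:
  assumes "orth_proj d P"
  shows "mat_trace P = of_real (\<Sum>i<d. \<Sum>j<d. (norm (P $$ (i, j)))\<^sup>2)"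
proof -
  have P: "P \<in> carrier_mat d d" "P * P = P" "mat_adjoint P = P"
    using assms by (auto simp: orth_proj_def)
  have "P $$ (i, i) = (\<Sum>j<d. of_real ((norm (P $$ (i, j)))\<^sup>2))" if i: "i < d" for i
  proof -
    have "P $$ (i, i) = (P * P) $$ (i, i)" using P by simp
    also have "\<dots> = (\<Sum>j<d. P $$ (i, j) * P $$ (j, i))"
      using P(1) i by (auto simp: scalar_prod_def atLeast0LessThan intro!: sum.cong)
    also have "\<dots> = (\<Sum>j<d. P $$ (i, j) * conjugate (P $$ (i, j)))"
    proof (intro sum.cong refl)
      fix j assume "j \<in> {..<d}"
      then have "mat_adjoint P $$ (j, i) = conjugate (P $$ (i, j))"
        using P(1) i by (subst mat_adjoint_index) auto
      then show "P $$ (i, j) * P $$ (j, i) = P $$ (i, j) * conjugate (P $$ (i, j))"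
        by (simp add: P(3))
    qed
    finally show ?thesis by (simp add: mult_conjugate)
  qed
  then show ?thesis using P(1) by (simp add: mat_trace_def)
qed

lemma orth_proj_trace_0:
  assumes "orth_proj d P" "mat_trace P = 0"
  shows "P = 0\<^sub>m d d"
proof -
  have "(\<Sum>i<d. \<Sum>j<d. (norm (P $$ (i, j)))\<^sup>2) = 0"
    using orth_proj_trace[OF assms(1)] assms(2) by (metis of_real_eq_0_iff)
  then have "\<forall>i<d. \<forall>j<d. P $$ (i, j) = 0"
    by (auto simp: sum_nonneg_eq_0_iff sum_nonneg)
  then show ?thesis using assms(1) by (intro eq_matI) (auto simp: orth_proj_def)
qed

text \<open>A nonzero column of \<open>P\<close> is fixed by \<open>P\<close>; normalizing it gives a unit vector that can be split off
  without leaving the orthogonal projections. The trace drops by exactly one.\<close>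

lemma orth_proj_deflate:
  assumes "orth_proj d P" "P \<noteq> 0\<^sub>m d d"
  obtains u where "u \<in> carrier_vec d" "rip u u = 1" "orth_proj d (P - outer u)"
    "mat_trace (P - outer u) = mat_trace P - 1"
proof -
  have P: "P \<in> carrier_mat d d" "P * P = P" "mat_adjoint P = P"
    using assms by (auto simp: orth_proj_def)
  obtain i j where ij: "i < d" "j < d" "P $$ (i, j) \<noteq> 0"
    using assms(2) P(1) by (metis eq_matI carrier_matD index_zero_mat)
  define y where "y = P *\<^sub>v unit_vec d j"
  have y: "y \<in> carrier_vec d" using P by (auto simp: y_def)
  have "y $ i = P $$ (i, j)"
    using P ij by (simp add: y_def)
  then have y0: "y \<noteq> 0\<^sub>v d" using ij by auto
  have Py: "P *\<^sub>v y = y"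
    using P unfolding y_def by (simp flip: assoc_mult_mat_vec[of _ d d _ d])
  define r where "r = 1 / sqrt (rip y y)"
  define u where "u = of_real r \<cdot>\<^sub>v y"
  have u: "u \<in> carrier_vec d" using y by (simp add: u_def)
  have "rip y y > 0" using rip_self_eq_0[OF y] y0 rip_self_nonneg[of y] by linarith
  then have u1: "rip u u = 1"
    using y unfolding u_def
    by (simp add: rip_of_real_left[of _ d] rip_of_real_right[of _ d] r_def del: of_real_divide)
  have Pu: "P *\<^sub>v u = u"
    using P y by (simp add: u_def mult_mat_vec[of _ d d] Py)
  have uu: "u \<bullet>c u = 1" using u1 by (simp add: cscalar_prod_self)
  have C: "P - outer u \<in> carrier_mat d d" using P u by (simp add: minus_carrier_mat)
  have "(P - outer u) * (P - outer u) = P - outer u"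
  proof (rule mat_eqI_action[where n = d and d = d])
    fix v :: "'a vec" assume v: "v \<in> carrier_vec d"
    have act: "(P - outer u) *\<^sub>v w = P *\<^sub>v w - (w \<bullet>c u) \<cdot>\<^sub>v u" if "w \<in> carrier_vec d" for w
      using that P u by (simp add: minus_mult_distrib_mat_vec[of _ d d] outer_mult_vec[of _ d])
    let ?w = "P *\<^sub>v v - (v \<bullet>c u) \<cdot>\<^sub>v u"
    have w: "?w \<in> carrier_vec d" using P u v by auto
    have "(P *\<^sub>v v) \<bullet>c u = v \<bullet>c u"
      using cscalar_prod_adjoint[OF P(1) v u] by (simp add: P Pu)
    then have "?w \<bullet>c u = 0"
      using P u v uu by (simp add: minus_scalar_prod_distrib[of _ d])
    moreover have "P *\<^sub>v ?w = ?w"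
      using P u v Pu by (simp add: mult_minus_distrib_mat_vec[of _ d d] mult_mat_vec[of _ d d]
          flip: assoc_mult_mat_vec[of _ d d _ d])
    ultimately have "(P - outer u) *\<^sub>v ?w = ?w"
      using act[OF w] w u by auto
    then show "(P - outer u) * (P - outer u) *\<^sub>v v = (P - outer u) *\<^sub>v v"
      using act[OF v] C v by (simp add: assoc_mult_mat_vec[of _ d d _ d])
  qed (use C in auto)
  then have "orth_proj d (P - outer u)"
    using P u C by (auto simp: orth_proj_def mat_adjoint_diff[of _ d d])
  moreover have "mat_trace (P - outer u) = mat_trace P - 1"
    using P u u1 by (simp add: mat_trace_diff[of _ d] mat_trace_outer)
  ultimately show ?thesis using that u u1 by blast
qed

lemma rank_outer_le:
  fixes u :: "'a::real_or_complex vec"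
  assumes "u \<in> carrier_vec d"
  shows "vec_space.rank d (outer u) \<le> 1"
  using assms
  by (intro vec_space.rank_le_1_product_entries[of _ d d "\<lambda>i. u $ i" "\<lambda>j. conjugate (u $ j)"])
    (auto simp: outer_def)

lemma orth_proj_trace_ge_rank:
  fixes P :: "'a::real_or_complex mat"
  assumes "orth_proj d P"
  shows "\<exists>r. mat_trace P = of_nat r \<and> vec_space.rank d P \<le> r"
proof -
  have "\<exists>r. mat_trace P = of_nat r \<and> vec_space.rank d P \<le> r"
    if "orth_proj d P" "(\<Sum>i<d. \<Sum>j<d. (norm (P $$ (i, j)))\<^sup>2) \<le> real N" for N and P :: "'a mat"
    using that
  proof (induction N arbitrary: P)
    case 0
    have "(\<Sum>i<d. \<Sum>j<d. (norm (P $$ (i, j)))\<^sup>2) = 0"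
      using 0(2) by (intro antisym sum_nonneg) auto
    then have t: "mat_trace P = 0"
      using orth_proj_trace[OF 0(1)] by simp
    then have "P = 0\<^sub>m d d"
      using orth_proj_trace_0 0 by blast
    then show ?case using t by (auto intro!: exI[of _ 0] simp: vec_space.rank_0I)
  next
    case (Suc N)
    show ?case
    proof (cases "P = 0\<^sub>m d d")
      case True
      then show ?thesis by (auto intro!: exI[of _ 0] simp: vec_space.rank_0I mat_trace_def)
    next
      case False
      then obtain u where u: "u \<in> carrier_vec d" "rip u u = 1" "orth_proj d (P - outer u)"
        "mat_trace (P - outer u) = mat_trace P - 1"
        using orth_proj_deflate[OF Suc.prems(1)] by blast
      let ?f = "\<lambda>P. \<Sum>i<d. \<Sum>j<d. (norm (P $$ (i, j)))\<^sup>2"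
      have "(of_real (?f (P - outer u)) :: 'a) = of_real (?f P - 1)"
        using u(4) by (simp only: orth_proj_trace[OF u(3)] orth_proj_trace[OF Suc.prems(1)] of_real_diff of_real_1)
      then have "?f (P - outer u) = ?f P - 1" by (simp only: of_real_eq_iff)
      then have "?f (P - outer u) \<le> real N" using Suc.prems(2) by simp
      from Suc.IH[OF u(3) this] obtain r where r: "mat_trace (P - outer u) = of_nat r"
        "vec_space.rank d (P - outer u) \<le> r" by blast
      have P: "P \<in> carrier_mat d d" using Suc.prems by (simp add: orth_proj_def)
      have "P = (P - outer u) + outer u" using P u by (intro eq_matI) auto
      then have "vec_space.rank d P \<le> vec_space.rank d (P - outer u) + vec_space.rank d (outer u)"
        using P u vec_space.rank_subadditive[of "P - outer u" d d "outer u"]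
        by (simp add: minus_carrier_mat)
      also have "\<dots> \<le> r + 1" using r rank_outer_le[OF u(1)] by linarith
      finally show ?thesis using r u(4) by (intro exI[of _ "r + 1"]) (auto simp: algebra_simps)
    qed
  qed
  then show ?thesis using assms real_arch_simple by blast
qed

text \<open>Deflation bounds the rank of \<open>P\<close> by its trace, and likewise for \<open>1 - P\<close>. The traces add up to \<open>d\<close>,
  the ranks to at least \<open>d\<close> by subadditivity, so both bounds are equalities.\<close>

lemma orth_proj_trace_eq_rank:
  fixes P :: "'a::real_or_complex mat"
  assumes "orth_proj d P"
  shows "mat_trace P = of_nat (vec_space.rank d P)"
proof -
  have P: "P \<in> carrier_mat d d" using assms by (simp add: orth_proj_def)
  obtain r where r: "mat_trace P = of_nat r" "vec_space.rank d P \<le> r"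
    using orth_proj_trace_ge_rank[OF assms] by blast
  obtain s where s: "mat_trace (1\<^sub>m d - P) = of_nat s" "vec_space.rank d (1\<^sub>m d - P) \<le> s"
    using orth_proj_trace_ge_rank[OF orth_proj_complement[OF assms]] by blast
  have "mat_trace (1\<^sub>m d :: 'a mat) = of_nat d" by (simp add: mat_trace_def)
  then have "(of_nat s :: 'a) + of_nat r = of_nat d"
    using s(1) r(1) P by (simp add: mat_trace_diff[of _ d] diff_eq_eq)
  then have rs: "s + r = d"
    by (metis of_nat_add of_nat_eq_iff)
  have "vec_space.rank d (1\<^sub>m d :: 'a mat) = d"
    using vec_space.det_rank_iff[of "1\<^sub>m d :: 'a mat" d] by simp
  moreover have "1\<^sub>m d = (1\<^sub>m d - P) + P" using P by (intro eq_matI) auto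
  ultimately have "d \<le> vec_space.rank d (1\<^sub>m d - P) + vec_space.rank d P"
    using P vec_space.rank_subadditive[of "1\<^sub>m d - P" d d P]
    by (simp add: minus_carrier_mat)
  then have "vec_space.rank d P = r" using rs r(2) s(2) by linarith
  then show ?thesis using r by simp
qed

lemma Proj_iff:
  "P \<in> Proj k d \<longleftrightarrow> orth_proj d P \<and> mat_trace (P :: 'a::real_or_complex mat) = of_nat k"
  unfolding Proj_def using orth_proj_trace_eq_rank[of d P]
  by (auto simp: orth_proj_def)

lemma Proj_1_iff:
  "Y \<in> Proj 1 d \<longleftrightarrow> (\<exists>u \<in> carrier_vec d. rip u u = 1 \<and> (Y :: 'a::real_or_complex mat) = outer u)"
proof
  assume "Y \<in> Proj 1 d"
  then have Y: "orth_proj d Y" "mat_trace Y = 1" by (auto simp: Proj_iff)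
  then have "Y \<noteq> 0\<^sub>m d d" by (auto simp: mat_trace_def)
  then obtain u where u: "u \<in> carrier_vec d" "rip u u = 1" "orth_proj d (Y - outer u)"
    "mat_trace (Y - outer u) = mat_trace Y - 1"
    using orth_proj_deflate[OF Y(1)] by blast
  then have "Y - outer u = 0\<^sub>m d d" using orth_proj_trace_0 Y by auto
  moreover have "Y = (Y - outer u) + outer u" using Y u by (intro eq_matI) (auto simp: orth_proj_def)
  ultimately have "Y = outer u" using u by simp
  then show "\<exists>u \<in> carrier_vec d. rip u u = 1 \<and> Y = outer u" using u by blast
qed (auto simp: Proj_iff orth_proj_outer mat_trace_outer)

section \<open>The reflection form of a projection\<close>

text \<open>This is the real bilinear form of the reflection \<open>T = 2 P - 1\<close>. Measuring \<open>x\<close> with \<open>P\<close> asks on which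
  side of zero the quadratic form of \<open>T\<close> takes at \<open>x\<close>. For rank \<open>n\<close> in dimension \<open>2 n\<close> the trace of \<open>T\<close>
  vanishes, so this form has average zero over every orthonormal basis.\<close>

definition rform :: "'a::real_or_complex mat \<Rightarrow> 'a vec \<Rightarrow> 'a vec \<Rightarrow> real" where
  "rform P v w = 2 * rip (P *\<^sub>v v) w - rip v w"

abbreviation rquad :: "'a::real_or_complex mat \<Rightarrow> 'a vec \<Rightarrow> real" where
  "rquad P v \<equiv> rform P v v"

text \<open>Averages and expectations of the forms \<^term>\<open>rform P\<close> are no longer given by a projection, but they
  keep these properties, on which the later estimates rest. The third clause expresses
  invariance under scalar phases; real bilinearity alone does not give it in the complex case.\<close>

definition bilin_on :: "nat \<Rightarrow> ('a::real_or_complex vec \<Rightarrow> 'a vec \<Rightarrow> real) \<Rightarrow> bool" where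
  "bilin_on d B \<longleftrightarrow>
     (\<forall>u\<in>carrier_vec d. \<forall>v\<in>carrier_vec d. B u v = B v u) \<and>
     (\<forall>u\<in>carrier_vec d. \<forall>v\<in>carrier_vec d. \<forall>w\<in>carrier_vec d. B (u + v) w = B u w + B v w) \<and>
     (\<forall>u\<in>carrier_vec d. \<forall>v\<in>carrier_vec d. \<forall>c. B (c \<cdot>\<^sub>v u) (c \<cdot>\<^sub>v v) = (norm c)\<^sup>2 * B u v) \<and>
     (\<forall>u\<in>carrier_vec d. \<forall>v\<in>carrier_vec d. \<forall>r. B (of_real r \<cdot>\<^sub>v u) v = r * B u v)"

lemma bilin_onD:
  assumes "bilin_on d B" "u \<in> carrier_vec d" "v \<in> carrier_vec d"
  shows bilin_commute: "B u v = B v u"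
    and bilin_add_left: "w \<in> carrier_vec d \<Longrightarrow> B (u + v) w = B u w + B v w"
    and bilin_add_right: "w \<in> carrier_vec d \<Longrightarrow> B w (u + v) = B w u + B w v"
    and bilin_smult: "B (c \<cdot>\<^sub>v u) (c \<cdot>\<^sub>v v) = (norm c)\<^sup>2 * B u v"
    and bilin_real_left: "B (of_real r \<cdot>\<^sub>v u) v = r * B u v"
    and bilin_real_right: "B u (of_real r \<cdot>\<^sub>v v) = r * B u v"
proof -
  note * = assms[unfolded bilin_on_def]
  show "B u v = B v u" "B (c \<cdot>\<^sub>v u) (c \<cdot>\<^sub>v v) = (norm c)\<^sup>2 * B u v"
    "B (of_real r \<cdot>\<^sub>v u) v = r * B u v"
    using * by blast+
  show "B (u + v) w = B u w + B v w" if "w \<in> carrier_vec d"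
    using * that by blast
  show "B w (u + v) = B w u + B w v" if w: "w \<in> carrier_vec d"
  proof -
    have "B w (u + v) = B (u + v) w"
      using * w by (metis add_carrier_vec)
    also have "\<dots> = B u w + B v w" using * w by blast
    also have "\<dots> = B w u + B w v" using * w by metis
    finally show ?thesis .
  qed
  have "B u (of_real r \<cdot>\<^sub>v v) = B (of_real r \<cdot>\<^sub>v v) u"
    using * by (metis smult_carrier_vec)
  also have "\<dots> = r * B v u" using * by blast
  also have "\<dots> = r * B u v" using * by metis
  finally show "B u (of_real r \<cdot>\<^sub>v v) = r * B u v" .
qed

lemma diff_vec_eq: "u \<in> carrier_vec d \<Longrightarrow> v \<in> carrier_vec d \<Longrightarrow> u - v = u + of_real (-1) \<cdot>\<^sub>v (v :: 'a::real_or_complex vec)"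
  by (intro eq_vecI) auto

lemma bilin_diff_left:
  "bilin_on d B \<Longrightarrow> u \<in> carrier_vec d \<Longrightarrow> v \<in> carrier_vec d \<Longrightarrow> w \<in> carrier_vec d \<Longrightarrow> B (u - v) w = B u w - B v w"
  by (simp only: diff_vec_eq bilin_add_left smult_carrier_vec bilin_real_left)

lemma bilin_diff_right:
  "bilin_on d B \<Longrightarrow> u \<in> carrier_vec d \<Longrightarrow> v \<in> carrier_vec d \<Longrightarrow> w \<in> carrier_vec d \<Longrightarrow> B w (u - v) = B w u - B w v"
  by (simp only: diff_vec_eq bilin_add_right smult_carrier_vec bilin_real_right)

lemma bilin_polarization:
  assumes "bilin_on d B" "u \<in> carrier_vec d" "v \<in> carrier_vec d"
  shows "B u v = (B (u + v) (u + v) - B (u - v) (u - v)) / 4"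
  using assms bilin_commute[OF assms]
  by (simp add: bilin_add_left[of d B] bilin_add_right[of d B] bilin_diff_left[of d B] bilin_diff_right[of d B])

lemma bilin_parallelogram:
  assumes "bilin_on d B" "u \<in> carrier_vec d" "v \<in> carrier_vec d"
  shows "B (u + v) (u + v) + B (u - v) (u - v) = 2 * B u u + 2 * B v v"
  using assms bilin_commute[OF assms]
  by (simp add: bilin_add_left[of d B] bilin_add_right[of d B] bilin_diff_left[of d B] bilin_diff_right[of d B])

lemma bilin_on_rip: "bilin_on d rip"
  unfolding bilin_on_def
  by (intro conjI ballI allI)
    (rule rip_commute rip_add_left rip_of_real_left rip_smult_smult; assumption)+

text \<open>A symmetric form is bounded by its quadratic form: normalize both arguments, polarize, and apply
  the parallelogram law.\<close>

lemma bilin_bound: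
  assumes B: "bilin_on d B" and K: "\<And>z. z \<in> carrier_vec d \<Longrightarrow> \<bar>B z z\<bar> \<le> K * rip z z"
    and uv: "u \<in> carrier_vec d" "v \<in> carrier_vec d"
  shows "\<bar>B u v\<bar> \<le> K * (vec_l2_norm u * vec_l2_norm v)"
proof -
  have unit: "\<bar>B a b\<bar> \<le> K" if ab: "a \<in> carrier_vec d" "b \<in> carrier_vec d" "rip a a = 1" "rip b b = 1" for a b
  proof -
    have "\<bar>B a b\<bar> \<le> (\<bar>B (a + b) (a + b)\<bar> + \<bar>B (a - b) (a - b)\<bar>) / 4"
      unfolding bilin_polarization[OF B ab(1,2)] by simp
    also have "\<dots> \<le> (K * rip (a + b) (a + b) + K * rip (a - b) (a - b)) / 4"
      using ab by (intro divide_right_mono add_mono K) auto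
    also have "\<dots> = K * ((rip (a + b) (a + b) + rip (a - b) (a - b)) / 4)"
      by (simp add: field_simps)
    also have "\<dots> = K"
      using ab by (simp add: bilin_parallelogram[OF bilin_on_rip])
    finally show ?thesis .
  qed
  have zero: "B (0\<^sub>v d) b = 0" if "b \<in> carrier_vec d" for b
  proof -
    have "of_real 0 \<cdot>\<^sub>v b = 0\<^sub>v d" using that by (intro eq_vecI) auto
    then show ?thesis using bilin_real_left[OF B that that, of 0] by simp
  qed
  show ?thesis
  proof (cases "u = 0\<^sub>v d \<or> v = 0\<^sub>v d")
    case True
    moreover have "vec_l2_norm (0\<^sub>v d :: 'a vec) = 0" by (simp add: vec_l2_norm_def L2_set_def)
    ultimately show ?thesis using zero[OF uv(1)] zero[OF uv(2)] bilin_commute[OF B uv] by auto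
  next
    case False
    have n: "vec_l2_norm z > 0" "(vec_l2_norm z)\<^sup>2 = rip z z" if "z \<in> carrier_vec d" "z \<noteq> 0\<^sub>v d" for z :: "'a vec"
      using vec_l2_norm_sq[of z] rip_self_eq_0[OF that(1)] that(2)
      by (auto simp: vec_l2_norm_def L2_set_nonneg less_le)
    let ?a = "of_real (1 / vec_l2_norm u) \<cdot>\<^sub>v u" and ?b = "of_real (1 / vec_l2_norm v) \<cdot>\<^sub>v v"
    have "\<bar>B ?a ?b\<bar> \<le> K"
    proof (rule unit)
      show "rip ?a ?a = 1" "rip ?b ?b = 1"
        using uv n[of u] n[of v] False
        by (simp_all add: bilin_real_left[OF bilin_on_rip] bilin_real_right[OF bilin_on_rip]
            power2_eq_square flip: n(2) del: of_real_divide)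
    qed (use uv in auto)
    also have "B ?a ?b = B u v / (vec_l2_norm u * vec_l2_norm v)"
      using uv by (simp add: bilin_real_left[OF B] bilin_real_right[OF B] del: of_real_divide)
    finally show ?thesis using n[of u] n[of v] uv False by (simp add: abs_mult field_simps)
  qed
qed

lemma rform_bilin:
  assumes "orth_proj d P" shows "bilin_on d (rform P)"
proof -
  have P: "P \<in> carrier_mat d d" "mat_adjoint P = P" using assms by (auto simp: orth_proj_def)
  have "rip (P *\<^sub>v u) v = rip (P *\<^sub>v v) u" if "u \<in> carrier_vec d" "v \<in> carrier_vec d" for u v
    using rip_adjoint[OF P(1) that] rip_commute[of u d "P *\<^sub>v v"] that P by simp
  note sym = this
  show ?thesis
    unfolding bilin_on_def
  proof (intro conjI ballI allI)
    fix u v w :: "'a vec" and c :: 'a and r :: real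
    assume uv: "u \<in> carrier_vec d" "v \<in> carrier_vec d"
    show "rform P u v = rform P v u"
      by (simp add: rform_def sym[OF uv] rip_commute[OF uv])
    show "rform P (c \<cdot>\<^sub>v u) (c \<cdot>\<^sub>v v) = (norm c)\<^sup>2 * rform P u v"
      using uv P by (simp add: rform_def mult_mat_vec[of _ d d] rip_smult_smult[of _ d] algebra_simps)
    show "rform P (of_real r \<cdot>\<^sub>v u) v = r * rform P u v"
      using uv P by (simp add: rform_def mult_mat_vec[of _ d d] rip_of_real_left[of _ d] algebra_simps)
    show "rform P (u + v) w = rform P u w + rform P v w" if "w \<in> carrier_vec d"
      using uv P that by (simp add: rform_def mult_add_distrib_mat_vec[of _ d d] rip_add_left[of _ d] algebra_simps)
  qed
qed


lemma refl_isometry: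
  assumes "orth_proj d P" "v \<in> carrier_vec d"
  shows "rip (of_real 2 \<cdot>\<^sub>v (P *\<^sub>v v) - v) (of_real 2 \<cdot>\<^sub>v (P *\<^sub>v v) - v) = rip v v"
proof -
  have P: "P \<in> carrier_mat d d" "mat_adjoint P = P" "P * P = P" using assms by (auto simp: orth_proj_def)
  have "rip (P *\<^sub>v v) (P *\<^sub>v v) = rip v (P *\<^sub>v v)"
    using assms P rip_adjoint[OF P(1), of v "P *\<^sub>v v"] by (simp flip: assoc_mult_mat_vec[of _ d d _ d])
  then show ?thesis
    using assms P rip_commute[of v d "P *\<^sub>v v"]
    by (simp add: rip_diff_left[of _ d] rip_diff_right[of _ d] rip_of_real_left[of _ d] rip_of_real_right[of _ d]
        del: of_real_numeral)
qed

lemma rform_eq_rip: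
  assumes "orth_proj d P" "v \<in> carrier_vec d" "w \<in> carrier_vec d"
  shows "rform P v w = rip (of_real 2 \<cdot>\<^sub>v (P *\<^sub>v v) - v) w"
proof -
  have "P *\<^sub>v v \<in> carrier_vec d" using assms by (auto simp: orth_proj_def)
  then show ?thesis
    using assms(2,3) by (simp add: rform_def rip_diff_left[of _ d] rip_of_real_left[of _ d] del: of_real_numeral)
qed

lemma abs_rip_le: "v \<in> carrier_vec d \<Longrightarrow> w \<in> carrier_vec d \<Longrightarrow> \<bar>rip v w\<bar> \<le> vec_l2_norm v * vec_l2_norm w"
  by (rule order.trans[OF bilin_bound[OF bilin_on_rip, of d 1]]) auto

lemma vec_l2_norm_nonneg [simp]: "0 \<le> vec_l2_norm v"
  by (simp add: vec_l2_norm_def L2_set_nonneg)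

lemma vec_l2_norm_eq: "vec_l2_norm v = sqrt (rip v v)"
  by (metis vec_l2_norm_sq vec_l2_norm_nonneg real_sqrt_unique)

lemma abs_rform_le:
  assumes "orth_proj d P" "v \<in> carrier_vec d" "w \<in> carrier_vec d"
  shows "\<bar>rform P v w\<bar> \<le> vec_l2_norm v * vec_l2_norm w"
proof -
  have P: "P \<in> carrier_mat d d" using assms by (auto simp: orth_proj_def)
  have "\<bar>rform P v w\<bar> \<le> vec_l2_norm (of_real 2 \<cdot>\<^sub>v (P *\<^sub>v v) - v) * vec_l2_norm w"
    unfolding rform_eq_rip[OF assms] using assms P by (intro abs_rip_le[of _ d]) (auto simp: minus_carrier_vec)
  also have "vec_l2_norm (of_real 2 \<cdot>\<^sub>v (P *\<^sub>v v) - v) = vec_l2_norm v"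
    using refl_isometry[OF assms(1,2)] by (simp only: vec_l2_norm_eq)
  finally show ?thesis .
qed

lemma abs_rquad_le:
  assumes "orth_proj d P" "v \<in> carrier_vec d"
  shows "\<bar>rquad P v\<bar> \<le> rip v v"
  using abs_rform_le[OF assms assms(2)] by (simp add: vec_l2_norm_eq)

lemma rip_unit_right: "v \<in> carrier_vec d \<Longrightarrow> i < d \<Longrightarrow> rip v (c \<cdot>\<^sub>v unit_vec d i) = inner (v $ i) (c :: 'a::real_or_complex)"
  by (simp add: rip_eq_sum[of _ d] unit_vec_def if_distrib[of "\<lambda>x. c * x"] if_distrib[of "inner _"] cong: if_cong)

text \<open>The real coordinates of \<open>T v\<close> are the values of the form on the vectors \<open>b * e_i\<close>, where \<open>b\<close> runs
  over the real basis of the scalars, and \<open>T\<close> is an isometry.\<close>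

lemma sum_rform_sq:
  assumes "orth_proj d P" "v \<in> carrier_vec d"
  shows "(\<Sum>i<d. \<Sum>b\<in>Basis. (rform P v (b \<cdot>\<^sub>v unit_vec d i))\<^sup>2) = rip v (v :: 'a::real_or_complex vec)"
proof -
  let ?w = "of_real 2 \<cdot>\<^sub>v (P *\<^sub>v v) - v"
  have w: "?w \<in> carrier_vec d" using assms by (auto simp: orth_proj_def)
  have "(\<Sum>i<d. \<Sum>b\<in>Basis. (rform P v (b \<cdot>\<^sub>v unit_vec d i))\<^sup>2) = (\<Sum>i<d. \<Sum>b\<in>Basis. (inner (?w $ i) b)\<^sup>2)"
  proof (intro sum.cong refl)
    fix i :: nat and b :: 'a assume i: "i \<in> {..<d}"
    have "rform P v (b \<cdot>\<^sub>v unit_vec d i) = rip ?w (b \<cdot>\<^sub>v unit_vec d i)"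
      by (rule rform_eq_rip) (use assms in auto)
    also have "\<dots> = inner (?w $ i) b" using i w by (intro rip_unit_right) auto
    finally show "(rform P v (b \<cdot>\<^sub>v unit_vec d i))\<^sup>2 = (inner (?w $ i) b)\<^sup>2" by simp
  qed
  also have "\<dots> = (\<Sum>i<d. (norm (?w $ i))\<^sup>2)"
    by (intro sum.cong refl) (subst power2_norm_eq_inner, subst euclidean_inner, simp only: power2_eq_square)
  also have "\<dots> = rip v v"
    using rip_self[OF w] refl_isometry[OF assms] by simp
  finally show ?thesis .
qed

lemma sum_rform_real_sq_le:
  assumes "orth_proj d P" "v \<in> carrier_vec d"
  shows "(\<Sum>i<d. (rform P v (unit_vec d i))\<^sup>2) \<le> rip v (v :: 'a::real_or_complex vec)"
proof -
  let ?w = "of_real 2 \<cdot>\<^sub>v (P *\<^sub>v v) - v"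
  have w: "?w \<in> carrier_vec d" using assms by (auto simp: orth_proj_def)
  have "(\<Sum>i<d. (rform P v (unit_vec d i))\<^sup>2) \<le> (\<Sum>i<d. (norm (?w $ i))\<^sup>2)"
  proof (intro sum_mono)
    fix i assume i: "i \<in> {..<d}"
    have "rform P v (unit_vec d i) = rip ?w (1 \<cdot>\<^sub>v unit_vec d i)"
      using rform_eq_rip[OF assms, of "unit_vec d i"] by simp
    also have "\<dots> = inner (?w $ i) 1" using i w by (intro rip_unit_right) auto
    finally have "\<bar>rform P v (unit_vec d i)\<bar> \<le> norm (?w $ i)"
      using Cauchy_Schwarz_ineq2[of "?w $ i" 1] by simp
    then show "(rform P v (unit_vec d i))\<^sup>2 \<le> (norm (?w $ i))\<^sup>2"
      by (metis abs_ge_zero power2_abs power_mono)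
  qed
  also have "\<dots> = rip v v"
    using rip_self[OF w] refl_isometry[OF assms] by simp
  finally show ?thesis .
qed

lemma sum_rquad_unit:
  fixes P :: "'a::real_or_complex mat"
  assumes "P \<in> Proj n (2 * n)"
  shows "(\<Sum>i<2 * n. rquad P (unit_vec (2 * n) i)) = 0"
proof -
  have P: "orth_proj (2 * n) P" "mat_trace P = of_nat n" "P \<in> carrier_mat (2 * n) (2 * n)"
    using assms by (auto simp: Proj_iff orth_proj_def)
  have "rquad P (unit_vec (2 * n) i) = 2 * inner (P $$ (i, i)) 1 - 1" if "i < 2 * n" for i
    using that P(3) rip_unit_right[of "P *\<^sub>v unit_vec (2 * n) i" "2 * n" i 1] by (simp add: rform_def)
  then have "(\<Sum>i<2 * n. rquad P (unit_vec (2 * n) i)) = 2 * inner (mat_trace P) 1 - 2 * real n"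
    using P(3) by (simp add: mat_trace_def sum_subtractf inner_sum_left sum_distrib_left)
  then show ?thesis using P(2) by (metis inner_of_real_1 of_real_of_nat_eq diff_self)
qed

section \<open>Householder reflections\<close>

text \<open>These reflections are the only unitary matrices that the argument applies to the distribution: they
  act transitively on lines, and in a given plane they move a vector by any angle.\<close>

definition householder :: "'a::real_or_complex vec \<Rightarrow> 'a mat" where
  "householder u = 1\<^sub>m (dim_vec u) - 2 \<cdot>\<^sub>m outer u"

context
  fixes d :: nat and u :: "'a::real_or_complex vec"
  assumes u: "u \<in> carrier_vec d" "rip u u = 1"
begin

lemma householder_carrier: "householder u \<in> carrier_mat d d"
  using u by (auto simp: householder_def)

lemma householder_mult_vec:
  assumes "v \<in> carrier_vec d"
  shows "householder u *\<^sub>v v = v - (2 * (v \<bullet>c u)) \<cdot>\<^sub>v u"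
proof -
  have "householder u *\<^sub>v v = v - (2 \<cdot>\<^sub>m outer u) *\<^sub>v v"
    using u assms by (simp add: householder_def minus_mult_distrib_mat_vec[of _ d d])
  also have "(2 \<cdot>\<^sub>m outer u) *\<^sub>v v = 2 \<cdot>\<^sub>v (outer u *\<^sub>v v)"
    using u assms by (intro eq_vecI) auto
  also have "\<dots> = (2 * (v \<bullet>c u)) \<cdot>\<^sub>v u"
    using u assms by (simp add: outer_mult_vec[of _ d] smult_smult_assoc)
  finally show ?thesis .
qed

lemma householder_adjoint: "mat_adjoint (householder u) = householder u"
  using u by (intro eq_matI) (auto simp: householder_def conjugate_diff conjugate_dist_mul
      conjugate_of_real[of 2, simplified] mult_ac)

lemma householder_involution: "householder u * householder u = 1\<^sub>m d"
proof (rule mat_eqI_action[where n = d and d = d])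
  fix v :: "'a vec" assume v: "v \<in> carrier_vec d"
  let ?w = "v - (2 * (v \<bullet>c u)) \<cdot>\<^sub>v u"
  have w: "?w \<in> carrier_vec d" using u v by auto
  have "?w \<bullet>c u = - (v \<bullet>c u)"
    using u v by (simp add: minus_scalar_prod_distrib[of _ d] cscalar_prod_self)
  then have "householder u *\<^sub>v ?w = v"
    using u v w by (simp only: householder_mult_vec[OF w]) (intro eq_vecI, auto)
  then show "householder u * householder u *\<^sub>v v = 1\<^sub>m d *\<^sub>v v"
    using v householder_carrier by (simp add: assoc_mult_mat_vec[of _ d d _ d] householder_mult_vec)
qed (use householder_carrier in auto)

lemma householder_unitary: "householder u \<in> unitary_mats d"
  by (simp add: unitary_mats_def householder_carrier householder_adjoint householder_involution)

lemma householder_rip: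
  assumes "v \<in> carrier_vec d" "w \<in> carrier_vec d"
  shows "rip (householder u *\<^sub>v v) (householder u *\<^sub>v w) = rip v w"
proof -
  have "rip (householder u *\<^sub>v v) (householder u *\<^sub>v w) = rip v (householder u *\<^sub>v (householder u *\<^sub>v w))"
    using rip_adjoint[OF householder_carrier assms(1), of "householder u *\<^sub>v w"] householder_carrier assms
    by (simp add: householder_adjoint)
  then show ?thesis
    using assms householder_carrier
    by (simp add: householder_involution flip: assoc_mult_mat_vec[of _ d d _ d])
qed

lemma householder_rform:
  assumes "P \<in> carrier_mat d d" "v \<in> carrier_vec d" "w \<in> carrier_vec d"
  shows "rform (householder u * P * mat_adjoint (householder u)) v w
       = rform P (householder u *\<^sub>v v) (householder u *\<^sub>v w)"
proof -
  note c = householder_carrier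
  have "(householder u * P * householder u) *\<^sub>v v = householder u *\<^sub>v (P *\<^sub>v (householder u *\<^sub>v v))"
    using assms c by (simp add: assoc_mult_mat_vec[of _ d d _ d] mult_carrier_mat[of _ d d])
  moreover have "rip (householder u *\<^sub>v (P *\<^sub>v (householder u *\<^sub>v v))) w
      = rip (P *\<^sub>v (householder u *\<^sub>v v)) (householder u *\<^sub>v w)"
    using assms c rip_adjoint[OF c, of "P *\<^sub>v (householder u *\<^sub>v v)" w] by (simp add: householder_adjoint)
  ultimately show ?thesis
    using assms by (simp add: rform_def householder_adjoint householder_rip)
qed

end


lemma householder_fix:
  assumes "u \<in> carrier_vec d" "rip u u = 1" "z \<in> carrier_vec d" "z \<bullet>c u = 0"
  shows "householder u *\<^sub>v z = (z :: 'a::real_or_complex vec)"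
  using assms by (simp add: householder_mult_vec[of _ d]) (intro eq_vecI, auto)

lemma householder_self:
  assumes "u \<in> carrier_vec d" "rip u u = 1"
  shows "householder u *\<^sub>v u = (-1) \<cdot>\<^sub>v (u :: 'a::real_or_complex vec)"
  using assms by (simp add: householder_mult_vec[of _ d] cscalar_prod_self) (intro eq_vecI, auto)

text \<open>Reflecting in the hyperplane orthogonal to \<open>v - c w\<close> maps \<open>v\<close> to \<open>c w\<close> as soon as the product of
  \<open>c w\<close> and \<open>v\<close> is real; the phase \<open>c\<close> achieves this. Vectors orthogonal to both \<open>v\<close> and \<open>w\<close> are not
  moved, which is what gives transitivity of the stabilizer of a third vector.\<close>

lemma exists_householder_mapping:
  fixes v w :: "'a::real_or_complex vec"
  assumes v: "v \<in> carrier_vec d" and w: "w \<in> carrier_vec d" and vw: "rip v v = rip w w"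
  obtains c where "norm c = 1" "v = c \<cdot>\<^sub>v w"
  | c u where "norm c = 1" "u \<in> carrier_vec d" "rip u u = 1" "householder u *\<^sub>v v = c \<cdot>\<^sub>v w"
      "\<And>z. z \<in> carrier_vec d \<Longrightarrow> z \<bullet>c v = 0 \<Longrightarrow> z \<bullet>c w = 0 \<Longrightarrow> householder u *\<^sub>v z = z"
proof -
  obtain c where c: "norm c = 1" "c * (w \<bullet>c v) = of_real (norm (w \<bullet>c v))"
    using ex_phase by blast
  define g where "g = norm (w \<bullet>c v)"
  define y where "y = v - c \<cdot>\<^sub>v w"
  have y: "y \<in> carrier_vec d" using v w by (simp add: y_def)
  have cw: "c \<cdot>\<^sub>v w \<in> carrier_vec d" using w by simp
  have g1: "(c \<cdot>\<^sub>v w) \<bullet>c v = of_real g" using c v w by (simp add: g_def)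
  have g2: "v \<bullet>c (c \<cdot>\<^sub>v w) = of_real g"
    using conjugate_cscalar_prod[OF cw v] g1 by simp
  have ww: "rip (c \<cdot>\<^sub>v w) (c \<cdot>\<^sub>v w) = rip v v" using c vw w by (simp add: rip_smult_smult[of _ d])
  have ry: "rip y y = 2 * (rip v v - g)"
    using v cw g1 g2 ww by (simp add: y_def rip_diff_left[of _ d] rip_diff_right[of _ d])
      (simp add: rip_def)
  have vy: "v \<bullet>c y = of_real (rip v v - g)"
  proof -
    have "v \<bullet>c y = conjugate (y \<bullet>c v)" using conjugate_cscalar_prod[OF y v] by simp
    also have "y \<bullet>c v = of_real (rip v v - g)"
      using v cw g1 by (simp add: y_def minus_scalar_prod_distrib[of _ d] cscalar_prod_self)
    finally show ?thesis by (simp del: of_real_diff)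
  qed
  show ?thesis
  proof (cases "y = 0\<^sub>v d")
    case True
    have "v = (v - c \<cdot>\<^sub>v w) + c \<cdot>\<^sub>v w" using v w by (intro eq_vecI) auto
    also have "\<dots> = c \<cdot>\<^sub>v w" using True w by (simp add: y_def)
    finally show ?thesis using that(1) c(1) by blast
  next
    case False
    define r where "r = sqrt (rip y y)"
    have "rip y y > 0" using rip_self_eq_0[OF y] False rip_self_nonneg[of y] by linarith
    then have r: "r > 0" "r * r = rip y y" by (auto simp: r_def)
    define u where "u = of_real (1 / r) \<cdot>\<^sub>v y"
    have u: "u \<in> carrier_vec d" using y by (simp add: u_def)
    have u1: "rip u u = 1"
      using y r unfolding u_def
      by (simp add: rip_of_real_left[of _ d] rip_of_real_right[of _ d] flip: r(2) del: of_real_divide)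
    have cu: "z \<bullet>c u = (z \<bullet>c y) * of_real (1 / r)" if "z \<in> carrier_vec d" for z
      using that y by (simp add: u_def cscalar_prod_sum[of _ d] sum_distrib_left conjugate_dist_mul
          mult_ac del: of_real_divide)
    have "2 * (v \<bullet>c u) = of_real r"
    proof -
      have "2 * (v \<bullet>c u) = of_real (2 * (rip v v - g) / r)"
        using cu[OF v] vy by simp
      also have "2 * (rip v v - g) / r = r" using r ry by (simp add: field_simps)
      finally show ?thesis .
    qed
    then have "householder u *\<^sub>v v = v - of_real r \<cdot>\<^sub>v u"
      using householder_mult_vec[OF u u1 v] by simp
    also have "of_real r \<cdot>\<^sub>v u = y" using r y by (auto simp: u_def smult_smult_assoc simp flip: of_real_mult)
    also have "v - y = c \<cdot>\<^sub>v w" using v w by (intro eq_vecI) (auto simp: y_def)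
    finally have 1: "householder u *\<^sub>v v = c \<cdot>\<^sub>v w" .
    show ?thesis
    proof (rule that(2)[OF c(1) u u1 1])
      fix z :: "'a vec" assume z: "z \<in> carrier_vec d" "z \<bullet>c v = 0" "z \<bullet>c w = 0"
      have "z \<bullet>c y = conjugate (y \<bullet>c z)" using conjugate_cscalar_prod[OF y z(1)] by simp
      also have "y \<bullet>c z = v \<bullet>c z - c * (w \<bullet>c z)"
        using v w z(1) by (simp add: y_def minus_scalar_prod_distrib[of _ d])
      also have "\<dots> = 0"
        using conjugate_cscalar_prod[OF z(1) v] conjugate_cscalar_prod[OF z(1) w] z(2,3) by simp
      finally have "z \<bullet>c u = 0" using cu[OF z(1)] by simp
      then show "householder u *\<^sub>v z = z" by (rule householder_fix[OF u u1 z(1)])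
    qed
  qed
qed

section \<open>Uniformly distributed projections\<close>

lemma mat_trace_mult_commute:
  assumes "A \<in> carrier_mat d d" "B \<in> carrier_mat d d"
  shows "mat_trace (A * B) = mat_trace (B * A :: 'a::comm_ring mat)"
proof -
  have "mat_trace (A * B) = (\<Sum>i<d. \<Sum>j<d. A $$ (i, j) * B $$ (j, i))"
    using assms by (simp add: mat_trace_def scalar_prod_def atLeast0LessThan)
  also have "\<dots> = (\<Sum>j<d. \<Sum>i<d. B $$ (j, i) * A $$ (i, j))"
    by (subst sum.swap) (simp add: mult.commute)
  also have "\<dots> = mat_trace (B * A)"
    using assms by (simp add: mat_trace_def scalar_prod_def atLeast0LessThan)
  finally show ?thesis .
qed

lemma householder_conj_Proj:
  fixes P :: "'a::real_or_complex mat"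
  assumes u: "u \<in> carrier_vec d" "rip u u = 1" and P: "P \<in> Proj k d"
  shows "householder u * P * mat_adjoint (householder u) \<in> Proj k d"
proof -
  let ?H = "householder u"
  note H = householder_carrier[OF u] householder_involution[OF u] householder_adjoint[OF u]
  have P': "P \<in> carrier_mat d d" "P * P = P" "mat_adjoint P = P" "mat_trace P = of_nat k"
    using P by (auto simp: Proj_iff orth_proj_def)
  have c: "?H * P * ?H \<in> carrier_mat d d" "?H * P \<in> carrier_mat d d" "P * ?H \<in> carrier_mat d d"
    using H P' by auto
  have act: "(?H * P * ?H) *\<^sub>v v = ?H *\<^sub>v (P *\<^sub>v (?H *\<^sub>v v))" if "v \<in> carrier_vec d" for v
    using that H P' c by (simp add: assoc_mult_mat_vec[of _ d d _ d])
  have HH: "?H *\<^sub>v (?H *\<^sub>v v) = v" if "v \<in> carrier_vec d" for v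
    using that H by (simp flip: assoc_mult_mat_vec[of _ d d _ d])
  have PP: "P *\<^sub>v (P *\<^sub>v v) = P *\<^sub>v v" if "v \<in> carrier_vec d" for v
    using that P' by (simp flip: assoc_mult_mat_vec[of _ d d _ d])
  have "(?H * P * ?H) * (?H * P * ?H) = ?H * P * ?H"
  proof (rule mat_eqI_action[where n = d and d = d])
    fix v :: "'a vec" assume v: "v \<in> carrier_vec d"
    have "(?H * P * ?H) * (?H * P * ?H) *\<^sub>v v = (?H * P * ?H) *\<^sub>v ((?H * P * ?H) *\<^sub>v v)"
      using v c by (simp add: assoc_mult_mat_vec[of _ d d _ d])
    also have "\<dots> = ?H *\<^sub>v (P *\<^sub>v (?H *\<^sub>v ((?H * P * ?H) *\<^sub>v v)))"
      using v c by (intro act) auto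
    also have "\<dots> = ?H * P * ?H *\<^sub>v v"
      using v H P' unfolding act[OF v] by (simp only: HH PP mult_mat_vec_carrier[of _ d d])
    finally show "(?H * P * ?H) * (?H * P * ?H) *\<^sub>v v = ?H * P * ?H *\<^sub>v v" .
  qed (use c in auto)
  moreover have "mat_adjoint (?H * P * ?H) = ?H * P * ?H"
  proof -
    have madj: "mat_adjoint (A * B) = mat_adjoint B * mat_adjoint A"
      if "A \<in> carrier_mat d d" "B \<in> carrier_mat d d" for A B :: "'a mat"
      using that by (intro eq_matI) (auto simp: scalar_prod_def conjugate_sum conjugate_dist_mul mult.commute)
    show ?thesis
      using c H P' by (simp add: madj assoc_mult_mat[of _ d d _ d _ d])
  qed
  moreover have "mat_trace (?H * P * ?H) = mat_trace P"
  proof -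
    have "mat_trace (?H * P * ?H) = mat_trace (?H * (?H * P))"
      using c H by (simp add: mat_trace_mult_commute[of _ d])
    also have "?H * (?H * P) = P"
      using H P' by (simp flip: assoc_mult_mat[of _ d d _ d _ d])
    finally show ?thesis .
  qed
  ultimately show ?thesis
    using c P' H by (simp add: Proj_iff orth_proj_def)
qed

locale uniform_projection =
  fixes n d :: nat and \<mu> :: "'a::real_or_complex mat measure"
  assumes n: "n \<ge> 1" and d_def: "d = 2 * n" and uniform: "uniform_on_Proj n d \<mu>"
begin

sublocale prob_space \<mu>
  using uniform by (simp add: uniform_on_Proj_def)

lemma space_mu: "space \<mu> = Proj n d"
proof -
  have "space \<mu> = space (proj_borel n d :: 'a mat measure)"
    using uniform by (intro sets_eq_imp_space_eq) (simp add: uniform_on_Proj_def)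
  then show ?thesis by (simp add: proj_borel_def)
qed

lemma orth: "P \<in> space \<mu> \<Longrightarrow> orth_proj d P"
  by (simp add: space_mu Proj_iff)

lemma carr: "P \<in> space \<mu> \<Longrightarrow> P \<in> carrier_mat d d"
  using orth by (auto simp: orth_proj_def)

lemma measurable_mu_iff: "measurable N \<mu> = measurable N (proj_borel n d)" "measurable \<mu> N = measurable (proj_borel n d) N"
  using uniform by (auto simp: uniform_on_Proj_def intro!: measurable_cong_sets)

lemma entry_measurable [measurable (raw)]:
  assumes "i < d" "j < d"
  shows "(\<lambda>P. P $$ (i, j)) \<in> borel_measurable \<mu>"
proof -
  let ?f = "\<lambda>P. \<lambda>ij\<in>{..<d} \<times> {..<d}. P $$ ij :: 'a"
  have "?f \<in> measurable \<mu> (Pi\<^sub>M ({..<d} \<times> {..<d}) (\<lambda>_. borel))"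
    unfolding measurable_mu_iff proj_borel_def
    by (intro measurable_vimage_algebra1) (auto simp: space_PiM)
  from measurable_compose[OF this measurable_component_singleton[of "(i, j)"]] assms
  show ?thesis by simp
qed

lemma measurable_into_mu:
  assumes "\<And>x. x \<in> space N \<Longrightarrow> f x \<in> Proj n d"
    and "\<And>i j. i < d \<Longrightarrow> j < d \<Longrightarrow> (\<lambda>x. f x $$ (i, j)) \<in> borel_measurable N"
  shows "f \<in> measurable N \<mu>"
  unfolding measurable_mu_iff proj_borel_def
proof (rule measurable_vimage_algebra2)
  show "(\<lambda>x. \<lambda>ij\<in>{..<d} \<times> {..<d}. f x $$ ij) \<in> measurable N (Pi\<^sub>M ({..<d} \<times> {..<d}) (\<lambda>_. borel))"
    using assms(2) by (intro measurable_restrict) auto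
qed (use assms in auto)

lemma rform_measurable [measurable]:
  assumes "v \<in> carrier_vec d" "w \<in> carrier_vec d"
  shows "(\<lambda>P. rform P v w) \<in> borel_measurable \<mu>"
proof -
  have "rform P v w = 2 * (\<Sum>i<d. inner (\<Sum>j<d. P $$ (i, j) * v $ j) (w $ i)) - rip v w"
    if "P \<in> space \<mu>" for P
    using assms carr[OF that] mult_mat_vec_sum[OF carr[OF that] assms(1)]
    by (simp add: rform_def rip_eq_sum[of "P *\<^sub>v v" d] del: index_mult_mat_vec)
  then have "(\<lambda>P. rform P v w) \<in> borel_measurable \<mu> \<longleftrightarrow>
    (\<lambda>P. 2 * (\<Sum>i<d. inner (\<Sum>j<d. P $$ (i, j) * v $ j) (w $ i)) - rip v w) \<in> borel_measurable \<mu>"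
    by (intro measurable_cong)
  also have \<dots> by measurable
  finally show ?thesis .
qed

lemma householder_conj_measurable:
  assumes u: "u \<in> carrier_vec d" "rip u u = 1"
  shows "(\<lambda>P. householder u * P * mat_adjoint (householder u)) \<in> measurable \<mu> \<mu>"
proof (rule measurable_into_mu)
  let ?H = "householder u" and ?A = "mat_adjoint (householder u)"
  have H: "?H \<in> carrier_mat d d" "?A \<in> carrier_mat d d"
    using householder_carrier[OF u] by auto
  fix i j assume ij: "i < d" "j < d"
  have "(?H * P * ?A) $$ (i, j) = (\<Sum>k<d. (\<Sum>l<d. ?H $$ (i, l) * P $$ (l, k)) * ?A $$ (k, j))"
    if "P \<in> space \<mu>" for P
    using H carr[OF that] ij by (auto simp: scalar_prod_def atLeast0LessThan intro!: sum.cong)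
  then have "(\<lambda>P. (?H * P * ?A) $$ (i, j)) \<in> borel_measurable \<mu> \<longleftrightarrow>
    (\<lambda>P. \<Sum>k<d. (\<Sum>l<d. ?H $$ (i, l) * P $$ (l, k)) * ?A $$ (k, j)) \<in> borel_measurable \<mu>"
    by (intro measurable_cong)
  also have \<dots> using ij by measurable
  finally show "(\<lambda>P. (?H * P * ?A) $$ (i, j)) \<in> borel_measurable \<mu>" .
qed (use householder_conj_Proj[OF u] in \<open>auto simp: space_mu\<close>)

lemma householder_invariant:
  assumes u: "u \<in> carrier_vec d" "rip u u = 1" and f: "f \<in> borel_measurable \<mu>"
  shows "(\<integral>P. f (householder u * P * mat_adjoint (householder u)) \<partial>\<mu>) = (\<integral>P. f P \<partial>\<mu> :: real)"
proof -
  let ?T = "\<lambda>P. householder u * P * mat_adjoint (householder u)"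
  have "distr \<mu> \<mu> ?T = \<mu>"
    using uniform householder_unitary[OF u] by (simp add: uniform_on_Proj_def)
  moreover have "(\<integral>P. f P \<partial>distr \<mu> \<mu> ?T) = (\<integral>P. f (?T P) \<partial>\<mu>)"
    by (rule integral_distr[OF householder_conj_measurable[OF u] f])
  ultimately show ?thesis by simp
qed

lemma integrable_bounded:
  fixes f :: "'a mat \<Rightarrow> real"
  assumes "f \<in> borel_measurable \<mu>" "\<And>P. P \<in> space \<mu> \<Longrightarrow> \<bar>f P\<bar> \<le> B"
  shows "integrable \<mu> f"
  using assms by (intro integrable_const_bound[where B = B]) auto

text \<open>Conditioning on the measurement of \<open>x\<close> leaves only the symmetries that fix \<open>x\<close>. They still identify
  all vectors of the same length orthogonal to \<open>x\<close>. Taking \<open>x = 0\<close> gives transitivity on the whole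
  sphere.\<close>


lemma law_transitive:
  fixes h :: "real \<Rightarrow> real \<Rightarrow> real"
  assumes x: "x \<in> carrier_vec d" and v: "v \<in> carrier_vec d" "x \<bullet>c v = 0"
    and w: "w \<in> carrier_vec d" "x \<bullet>c w = 0" and vw: "rip v v = rip w w"
    and h: "\<And>y. y \<in> carrier_vec d \<Longrightarrow> (\<lambda>P. h (rquad P x) (rquad P y)) \<in> borel_measurable \<mu>"
  shows "(\<integral>P. h (rquad P x) (rquad P v) \<partial>\<mu>) = (\<integral>P. h (rquad P x) (rquad P w) \<partial>\<mu>)"
proof -
  have phase: "rquad P (c \<cdot>\<^sub>v y) = rquad P y" if "norm c = 1" "P \<in> space \<mu>" "y \<in> carrier_vec d" for c P y
    using bilin_smult[OF rform_bilin[OF orth[OF that(2)]] that(3,3)] that(1) by simp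
  show ?thesis
  proof (rule exists_householder_mapping[OF w(1) v(1) vw[symmetric]])
    fix c assume c: "norm c = 1" "w = c \<cdot>\<^sub>v v"
    then show ?thesis using v by (intro Bochner_Integration.integral_cong refl) (simp add: phase)
  next
    fix c u assume c: "norm c = 1" and u: "u \<in> carrier_vec d" "rip u u = 1"
      and m: "householder u *\<^sub>v w = c \<cdot>\<^sub>v v"
      and fix1: "\<And>z. z \<in> carrier_vec d \<Longrightarrow> z \<bullet>c w = 0 \<Longrightarrow> z \<bullet>c v = 0 \<Longrightarrow> householder u *\<^sub>v z = z"
    have hx: "householder u *\<^sub>v x = x" using fix1 x v w by blast
    let ?T = "\<lambda>P. householder u * P * mat_adjoint (householder u)"
    have "(\<integral>P. h (rquad P x) (rquad P w) \<partial>\<mu>) = (\<integral>P. h (rquad (?T P) x) (rquad (?T P) w) \<partial>\<mu>)"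
      by (rule householder_invariant[OF u h[OF w(1)], symmetric])
    also have "\<dots> = (\<integral>P. h (rquad P x) (rquad P v) \<partial>\<mu>)"
      using carr x v w c by (intro Bochner_Integration.integral_cong refl) (simp add: householder_rform[OF u] hx phase m)
    finally show ?thesis ..
  qed
qed

end

section \<open>Moments of the reflection form\<close>

text \<open>Rotating an orthonormal pair by the angle \<open>t\<close> turns the form with entries \<open>Z\<close>, \<open>B\<close>, \<open>T\<close> into one with
  diagonal entries \<open>zf\<close>, \<open>zp\<close> and off-diagonal entry \<open>bf\<close>. The derivatives of these entries are
  again linear combinations of them, so the derivative of \<open>zf ^ p * bf\<close> is bounded independently of \<open>t\<close>.\<close>

lemma rotated_product_derivative:
  fixes Z B T :: real and p :: nat
  defines "zf \<equiv> \<lambda>t. (cos t)\<^sup>2 * Z + 2 * (cos t * sin t) * B + (sin t)\<^sup>2 * T"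
    and "bf \<equiv> \<lambda>t. cos t * sin t * (Z - T) + ((sin t)\<^sup>2 - (cos t)\<^sup>2) * B"
    and "zp \<equiv> \<lambda>t. (sin t)\<^sup>2 * Z - 2 * (cos t * sin t) * B + (cos t)\<^sup>2 * T"
  shows "((\<lambda>t. zf t ^ p * bf t) has_real_derivative
      zf t ^ p * (zf t - zp t) - 2 * real p * zf t ^ (p - 1) * (bf t)\<^sup>2) (at t)"
proof -
  have z: "(zf has_real_derivative - 2 * bf t) (at t)"
    unfolding zf_def bf_def
    by (auto intro!: derivative_eq_intros simp: algebra_simps power2_eq_square)
  have b: "(bf has_real_derivative zf t - zp t) (at t)"
    unfolding zf_def bf_def zp_def
    by (auto intro!: derivative_eq_intros simp: algebra_simps power2_eq_square)
  show ?thesis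
    by (rule DERIV_cong[OF DERIV_mult[OF DERIV_power[OF z] b]])
      (simp add: algebra_simps power2_eq_square)
qed

lemma abs_le_mult_1: "\<bar>a\<bar> \<le> 1 \<Longrightarrow> \<bar>b\<bar> \<le> c \<Longrightarrow> \<bar>a * b\<bar> \<le> (c::real)"
  using mult_mono[of "\<bar>a\<bar>" 1 "\<bar>b\<bar>" c] by (auto simp: abs_mult)

lemma rotated_derivative_bound:
  fixes z b y :: real
  assumes "\<bar>z\<bar> \<le> 1" "\<bar>b\<bar> \<le> 1" "\<bar>y\<bar> \<le> 1"
  shows "\<bar>z ^ p * (z - y) - 2 * real p * z ^ (p - 1) * b\<^sup>2\<bar> \<le> 2 + 2 * real p"
proof -
  have pw: "\<bar>z ^ k\<bar> \<le> 1" for k using assms(1) by (simp add: power_abs power_le_one)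
  have "\<bar>z - y\<bar> \<le> 2" using assms by linarith
  with pw[of p] have 1: "\<bar>z ^ p * (z - y)\<bar> \<le> 2" by (rule abs_le_mult_1)
  have "\<bar>b\<^sup>2\<bar> \<le> 1" using assms(2) by (simp add: power_abs[symmetric] power_le_one abs_square_le_1)
  with pw[of "p - 1"] have "\<bar>z ^ (p - 1) * b\<^sup>2\<bar> \<le> 1" by (rule abs_le_mult_1)
  then have "2 * real p * \<bar>z ^ (p - 1) * b\<^sup>2\<bar> \<le> 2 * real p * 1" by (intro mult_left_mono) auto
  then have 2: "\<bar>2 * real p * z ^ (p - 1) * b\<^sup>2\<bar> \<le> 2 * real p" by (simp add: abs_mult mult.assoc)
  show ?thesis using 1 2 by linarith
qed

lemma bilin_lincomb:
  assumes "bilin_on d B" and uv: "u \<in> carrier_vec d" "v \<in> carrier_vec d"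
  shows "B (of_real a \<cdot>\<^sub>v u + of_real b \<cdot>\<^sub>v v) (of_real a' \<cdot>\<^sub>v u + of_real b' \<cdot>\<^sub>v v)
    = a * a' * B u u + (a * b' + b * a') * B u v + b * b' * B v v"
  using uv bilin_commute[OF assms]
  by (simp add: bilin_add_left[OF assms(1)] bilin_add_right[OF assms(1)]
      bilin_real_left[OF assms(1)] bilin_real_right[OF assms(1)] algebra_simps)

lemma unit_direction:
  fixes v :: "'a::real_or_complex vec"
  assumes d: "0 < d" and v: "v \<in> carrier_vec d"
  obtains w where "w \<in> carrier_vec d" "rip w w = 1" "v = of_real (sqrt (rip v v)) \<cdot>\<^sub>v w"
proof (cases "v = 0\<^sub>v d")
  case True
  then have "v = of_real (sqrt (rip v v)) \<cdot>\<^sub>v unit_vec d 0" using rip_self_eq_0[OF v] by (intro eq_vecI) auto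
  then show ?thesis using that[of "unit_vec d 0"] d by simp
next
  case False
  then have r: "rip v v > 0" using rip_self_eq_0[OF v] rip_self_nonneg[of v] by linarith
  let ?w = "of_real (1 / sqrt (rip v v)) \<cdot>\<^sub>v v"
  show ?thesis
  proof (rule that[of ?w])
    show "rip ?w ?w = 1"
      using v r by (simp add: rip_of_real_left[of _ d] rip_of_real_right[of _ d] del: of_real_divide)
    show "v = of_real (sqrt (rip v v)) \<cdot>\<^sub>v ?w"
      using r by (simp add: smult_smult_assoc flip: of_real_mult)
  qed (use v in simp)
qed

context uniform_projection
begin

lemma d2: "d \<ge> 2" and d0: "0 < d" using n d_def by auto

definition unit_moment :: "nat \<Rightarrow> real" where
  "unit_moment k = (\<integral>P. rquad P (unit_vec d 0) ^ (2 * k) \<partial>\<mu>)"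

lemma unit_bounds:
  assumes "P \<in> space \<mu>" "v \<in> carrier_vec d" "w \<in> carrier_vec d" "rip v v = 1" "rip w w = 1"
  shows "\<bar>rform P v w\<bar> \<le> 1"
  using abs_rform_le[OF orth[OF assms(1)] assms(2,3)] assms by (simp add: vec_l2_norm_eq)

lemma bounded_power: "\<bar>z\<bar> \<le> 1 \<Longrightarrow> \<bar>z ^ k\<bar> \<le> (1::real)"
  by (simp add: power_abs power_le_one)

text \<open>By invariance the expectation of \<open>zf ^ p * bf\<close> does not depend on the angle, so its derivative at
  angle zero has expectation zero. This is an integration by parts on the unitary group.\<close>

lemma rotation_identity:
  assumes j: "0 < j" "j < d"
  defines "e \<equiv> unit_vec d 0 :: 'a vec" and "f \<equiv> unit_vec d j :: 'a vec"
  shows "(\<integral>P. rquad P e ^ p * (rquad P e - rquad P f) - 2 * real p * rquad P e ^ (p - 1) * (rform P e f)\<^sup>2 \<partial>\<mu>) = 0"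
proof -
  have ef: "e \<in> carrier_vec d" "f \<in> carrier_vec d" by (auto simp: e_def f_def)
  have ef1: "rip e e = 1" "rip f f = 1" "rip e f = 0" using j by (auto simp: e_def f_def)
  have cef: "e \<bullet>c f = 0" "f \<bullet>c e = 0" "e \<bullet>c e = 1" "f \<bullet>c f = 1"
  proof -
    show "e \<bullet>c f = 0" using j by (simp add: e_def f_def cscalar_prod_sum[of _ d] unit_vec_def if_distrib cong: if_cong)
    then show "f \<bullet>c e = 0" using conjugate_cscalar_prod[OF ef] by simp
  qed (use ef1 in \<open>simp_all add: cscalar_prod_self\<close>)
  define zf where "zf P t = (cos t)\<^sup>2 * rquad P e + 2 * (cos t * sin t) * rform P e f + (sin t)\<^sup>2 * rquad P f" for P t
  define bf where "bf P t = cos t * sin t * (rquad P e - rquad P f) + ((sin t)\<^sup>2 - (cos t)\<^sup>2) * rform P e f" for P t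
  define zp where "zp P t = (sin t)\<^sup>2 * rquad P e - 2 * (cos t * sin t) * rform P e f + (cos t)\<^sup>2 * rquad P f" for P t
  define a where "a t = of_real (cos t) \<cdot>\<^sub>v e + of_real (sin t) \<cdot>\<^sub>v f" for t
  define b where "b t = of_real (sin t) \<cdot>\<^sub>v e + of_real (- cos t) \<cdot>\<^sub>v f" for t
  have ab: "a t \<in> carrier_vec d" "b t \<in> carrier_vec d" for t using ef by (auto simp: a_def b_def)
  have ab1: "rip (a t) (a t) = 1" "rip (b t) (b t) = 1" for t
    unfolding a_def b_def bilin_lincomb[OF bilin_on_rip ef] using ef1
    by (simp_all flip: power2_eq_square)
  have zf: "zf P t = rquad P (a t)" and bf: "bf P t = rform P (a t) (b t)" and zp: "zp P t = rquad P (b t)"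
    if "P \<in> space \<mu>" for P t
    unfolding a_def b_def zf_def bf_def zp_def bilin_lincomb[OF rform_bilin[OF orth[OF that]] ef]
    by (simp_all add: power2_eq_square algebra_simps)
  define F where "F P t = zf P t ^ p * bf P t" for P t
  define F' where "F' P t = zf P t ^ p * (zf P t - zp P t) - 2 * real p * zf P t ^ (p - 1) * (bf P t)\<^sup>2" for P t
  have der: "(F P has_real_derivative F' P t) (at t)" for P t
    using rotated_product_derivative[of "rquad P e" "rform P e f" "rquad P f" p t]
    by (simp add: F_def[abs_def] F'_def zf_def bf_def zp_def)
  have F'_bd: "\<bar>F' P t\<bar> \<le> 2 + 2 * real p" if P: "P \<in> space \<mu>" for P t
    unfolding F'_def using unit_bounds[OF P] ab ab1
    by (intro rotated_derivative_bound) (auto simp: zf[OF P] bf[OF P] zp[OF P])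
  have [measurable]: "(\<lambda>P. zf P t) \<in> borel_measurable \<mu>" "(\<lambda>P. bf P t) \<in> borel_measurable \<mu>" for t
    using ef unfolding zf_def bf_def by measurable
  have F_meas [measurable]: "(\<lambda>P. F P t) \<in> borel_measurable \<mu>" for t
    unfolding F_def by measurable
  have F_bd: "\<bar>F P t\<bar> \<le> 1" if P: "P \<in> space \<mu>" for P t
    unfolding F_def using unit_bounds[OF P] ab ab1
    by (intro abs_le_mult_1 bounded_power) (auto simp: zf[OF P] bf[OF P])
  have F_int: "integrable \<mu> (\<lambda>P. F P t)" for t
    by (rule integrable_bounded[OF F_meas F_bd])
  \<comment> \<open>the reflection in the line at half the angle sends the pair to the rotated pair, up to the sign
    of the second vector\<close>
  have inv: "(\<integral>P. F P t \<partial>\<mu>) = (\<integral>P. rquad P e ^ p * rform P e f \<partial>\<mu>)" for t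
  proof -
    define u where "u = of_real (- sin (t / 2)) \<cdot>\<^sub>v e + of_real (cos (t / 2)) \<cdot>\<^sub>v f"
    have u: "u \<in> carrier_vec d" using ef by (simp add: u_def)
    have u1: "rip u u = 1"
      unfolding u_def bilin_lincomb[OF bilin_on_rip ef] using ef1 by (simp flip: power2_eq_square)
    have cs: "cos t = 1 - 2 * (sin (t / 2))\<^sup>2" "sin t = 2 * sin (t / 2) * cos (t / 2)" "cos t = 2 * (cos (t / 2))\<^sup>2 - 1"
      using cos_double_sin[of "t / 2"] sin_double[of "t / 2"] cos_double_cos[of "t / 2"] by simp_all
    have eu: "e \<bullet>c u = of_real (- sin (t / 2))" "f \<bullet>c u = of_real (cos (t / 2))"
      using ef cef conjugate_cscalar_prod[OF u ef(1)] conjugate_cscalar_prod[OF u ef(2)]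
      by (simp_all add: u_def add_scalar_prod_distrib[of _ d] del: of_real_minus) 
    have "householder u *\<^sub>v e = a t"
      unfolding householder_mult_vec[OF u u1 ef(1)] eu a_def cs(1) cs(2) using ef
      by (intro eq_vecI) (auto simp: u_def algebra_simps power2_eq_square)
    moreover have "householder u *\<^sub>v f = b t"
      unfolding householder_mult_vec[OF u u1 ef(2)] eu b_def cs(3) cs(2) using ef
      by (intro eq_vecI) (auto simp: u_def algebra_simps power2_eq_square)
    ultimately have "F P t = rquad (householder u * P * mat_adjoint (householder u)) e ^ p *
        rform (householder u * P * mat_adjoint (householder u)) e f" if "P \<in> space \<mu>" for P
      using carr[OF that] ef by (simp add: F_def zf[OF that] bf[OF that] householder_rform[OF u u1])
    then have "(\<integral>P. F P t \<partial>\<mu>) = (\<integral>P. rquad (householder u * P * mat_adjoint (householder u)) e ^ p *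
        rform (householder u * P * mat_adjoint (householder u)) e f \<partial>\<mu>)"
      by (intro Bochner_Integration.integral_cong refl)
    also have "\<dots> = (\<integral>P. rquad P e ^ p * rform P e f \<partial>\<mu>)"
      using ef by (intro householder_invariant[OF u u1, where f = "\<lambda>P. rquad P e ^ p * rform P e f"]) measurable
    finally show ?thesis .
  qed
  \<comment> \<open>differentiation under the integral by dominated convergence of difference quotients\<close>
  define s where "s k P = (F P (inverse (real (Suc k))) - F P 0) / inverse (real (Suc k))" for k P
  have lim: "(\<lambda>k. s k P) \<longlonglongrightarrow> F' P 0" for P
  proof -
    have "((\<lambda>h. (F P (0 + h) - F P 0) / h) \<longlongrightarrow> F' P 0) (at 0)"
      using der[of P 0] by (simp add: DERIV_def)
    moreover have "filterlim (\<lambda>k. inverse (real (Suc k))) (at 0) sequentially"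
      using LIMSEQ_inverse_real_of_nat by (auto simp: filterlim_at)
    ultimately have "(\<lambda>k. (F P (0 + inverse (real (Suc k))) - F P 0) / inverse (real (Suc k))) \<longlonglongrightarrow> F' P 0"
      by (rule filterlim_compose)
    then show ?thesis by (simp add: s_def)
  qed
  have s_bd: "norm (s k P) \<le> 2 + 2 * real p" if P: "P \<in> space \<mu>" for k P
  proof -
    have "\<exists>z. 0 < z \<and> z < inverse (real (Suc k)) \<and>
        F P (inverse (real (Suc k))) - F P 0 = (inverse (real (Suc k)) - 0) * F' P z"
      by (rule MVT2) (auto intro: der)
    then obtain z where "F P (inverse (real (Suc k))) - F P 0 = inverse (real (Suc k)) * F' P z" by auto
    then have "s k P = F' P z" by (simp add: s_def)
    then show ?thesis using F'_bd[OF P] by simp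
  qed
  have s0: "(\<integral>P. s k P \<partial>\<mu>) = 0" for k
    unfolding s_def using F_int inv by simp
  have s_meas: "s k \<in> borel_measurable \<mu>" for k unfolding s_def[abs_def] by measurable
  have [measurable]: "(\<lambda>P. F' P 0) \<in> borel_measurable \<mu>"
    by (rule borel_measurable_LIMSEQ_real[where u = s, OF lim s_meas])
  have "(\<lambda>k. \<integral>P. s k P \<partial>\<mu>) \<longlonglongrightarrow> (\<integral>P. F' P 0 \<partial>\<mu>)"
    by (rule integral_dominated_convergence[where w = "\<lambda>_. 2 + 2 * real p"])
      (use lim s_bd s_meas in auto)
  then have "(\<integral>P. F' P 0 \<partial>\<mu>) = 0" using s0 by (simp add: LIMSEQ_const_iff)
  then show ?thesis by (simp add: F'_def zf_def bf_def zp_def)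
qed

lemma moment_integrable:
  assumes "v \<in> carrier_vec d" "rip v v \<le> 1"
  shows "integrable \<mu> (\<lambda>P. rquad P v ^ k)"
proof (rule integrable_bounded)
  show "\<bar>rquad P v ^ k\<bar> \<le> 1" if "P \<in> space \<mu>" for P
    using abs_rquad_le[OF orth[OF that] assms(1)] assms(2) by (intro bounded_power) simp
qed (use assms in measurable)

lemma e0: "unit_vec d 0 \<in> carrier_vec d" "rip (unit_vec d 0) (unit_vec d 0 :: 'a vec) = 1"
  using d0 by auto

lemma unit_moment_nonneg: "0 \<le> unit_moment k"
  unfolding unit_moment_def by (intro Bochner_Integration.integral_nonneg) (simp add: power_mult)

lemma unit_moment_0: "unit_moment 0 = 1"
  by (simp add: unit_moment_def prob_space)

text \<open>Sum the rotation identity with \<open>p = 2 k + 1\<close> over all coordinate directions other than the first.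
  On the left the vanishing trace turns the sum of the other diagonal entries into \<open>- Z\<close>; on the
  right the squared off-diagonal entries of the first column sum to at most one. Iterating the
  recursion shows that the form is subgaussian with variance of order \<open>1 / d\<close>.\<close>

lemma unit_moment_Suc_le: "real d * unit_moment (Suc k) \<le> 2 * real (2 * k + 1) * unit_moment k"
proof -
  define e :: "'a vec" where "e = unit_vec d 0"
  define f :: "nat \<Rightarrow> 'a vec" where "f j = unit_vec d j" for j
  define p where "p = 2 * k + 1"
  have ef: "e \<in> carrier_vec d" "f j \<in> carrier_vec d" for j by (auto simp: e_def f_def)
  have e1: "rip e e = 1" using d0 by (simp add: e_def)
  have f1: "rip (f j) (f j) = 1" if "j < d" for j using that by (simp add: f_def)
  note bd = unit_bounds
  have id: "(\<integral>P. rquad P e ^ p * (rquad P e - rquad P (f j)) \<partial>\<mu>) = 2 * real p * (\<integral>P. rquad P e ^ (p - 1) * (rform P e (f j))\<^sup>2 \<partial>\<mu>)"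
    and int1: "integrable \<mu> (\<lambda>P. rquad P e ^ p * (rquad P e - rquad P (f j)))"
    and int2: "integrable \<mu> (\<lambda>P. rquad P e ^ (p - 1) * (rform P e (f j))\<^sup>2)"
    if j: "j \<in> {1..<d}" for j
  proof -
    show i1: "integrable \<mu> (\<lambda>P. rquad P e ^ p * (rquad P e - rquad P (f j)))"
    proof (rule integrable_bounded)
      show "\<bar>rquad P e ^ p * (rquad P e - rquad P (f j))\<bar> \<le> 2" if P: "P \<in> space \<mu>" for P
        using bd[OF P ef(1) ef(1) e1 e1] bd[OF P ef(2)[of j] ef(2)[of j] f1 f1] j
        by (intro abs_le_mult_1 bounded_power) auto
    qed (use ef in measurable)
    show i2: "integrable \<mu> (\<lambda>P. rquad P e ^ (p - 1) * (rform P e (f j))\<^sup>2)"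
    proof (rule integrable_bounded)
      show "\<bar>rquad P e ^ (p - 1) * (rform P e (f j))\<^sup>2\<bar> \<le> 1" if P: "P \<in> space \<mu>" for P
        using bd[OF P ef(1) ef(1) e1 e1] bd[OF P ef(1) ef(2)[of j] e1 f1] j
        by (intro abs_le_mult_1 bounded_power) auto
    qed (use ef in measurable)
    have "(\<integral>P. rquad P e ^ p * (rquad P e - rquad P (f j)) - 2 * real p * (rquad P e ^ (p - 1) * (rform P e (f j))\<^sup>2) \<partial>\<mu>) = 0"
      using rotation_identity[of j p] j by (simp add: e_def f_def mult.assoc)
    then show "(\<integral>P. rquad P e ^ p * (rquad P e - rquad P (f j)) \<partial>\<mu>) = 2 * real p * (\<integral>P. rquad P e ^ (p - 1) * (rform P e (f j))\<^sup>2 \<partial>\<mu>)"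
      using i1 i2 by simp
  qed
  have split: "{..<d} = insert 0 {1..<d}" using d0 by auto
  have "real d * unit_moment (Suc k) = (\<integral>P. (\<Sum>j\<in>{1..<d}. rquad P e ^ p * (rquad P e - rquad P (f j))) \<partial>\<mu>)"
  proof -
    have "(\<Sum>j\<in>{1..<d}. rquad P e ^ p * (rquad P e - rquad P (f j))) = real d * rquad P e ^ (2 * Suc k)"
      if P: "P \<in> space \<mu>" for P
    proof -
      have "(\<Sum>j<d. rquad P (f j)) = 0"
        using P sum_rquad_unit[of P n] by (simp add: space_mu d_def f_def)
      then have s: "(\<Sum>j\<in>{1..<d}. rquad P (f j)) = - rquad P e"
        unfolding split by (simp add: e_def f_def)
      have "(\<Sum>j\<in>{1..<d}. rquad P e ^ p * (rquad P e - rquad P (f j)))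
          = rquad P e ^ p * (real (d - 1) * rquad P e - (\<Sum>j\<in>{1..<d}. rquad P (f j)))"
        by (simp add: sum_subtractf flip: sum_distrib_left)
      also have "\<dots> = rquad P e ^ p * (real d * rquad P e)"
        unfolding s using d0 by (simp add: of_nat_diff algebra_simps)
      finally show ?thesis by (simp add: p_def)
    qed
    then have "(\<integral>P. (\<Sum>j\<in>{1..<d}. rquad P e ^ p * (rquad P e - rquad P (f j))) \<partial>\<mu>) = (\<integral>P. real d * rquad P e ^ (2 * Suc k) \<partial>\<mu>)"
      by (intro Bochner_Integration.integral_cong refl)
    then show ?thesis by (simp add: unit_moment_def e_def)
  qed
  also have "\<dots> = (\<Sum>j\<in>{1..<d}. 2 * real p * (\<integral>P. rquad P e ^ (p - 1) * (rform P e (f j))\<^sup>2 \<partial>\<mu>))"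
    using int1 id by (simp add: Bochner_Integration.integral_sum)
  also have "\<dots> = 2 * real p * (\<integral>P. (\<Sum>j\<in>{1..<d}. rquad P e ^ (p - 1) * (rform P e (f j))\<^sup>2) \<partial>\<mu>)"
    using int2 by (simp add: Bochner_Integration.integral_sum sum_distrib_left)
  also have "\<dots> \<le> 2 * real p * (\<integral>P. rquad P e ^ (2 * k) \<partial>\<mu>)"
  proof (intro mult_left_mono integral_mono)
    show "integrable \<mu> (\<lambda>P. \<Sum>j\<in>{1..<d}. rquad P e ^ (p - 1) * (rform P e (f j))\<^sup>2)"
      using int2 by (intro Bochner_Integration.integrable_sum) auto
    show "integrable \<mu> (\<lambda>P. rquad P e ^ (2 * k))" using ef e1 by (intro moment_integrable) auto
    fix P assume P: "P \<in> space \<mu>"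
    have "(\<Sum>j\<in>{1..<d}. (rform P e (f j))\<^sup>2) \<le> (\<Sum>j<d. (rform P e (f j))\<^sup>2)"
      unfolding split by simp
    also have "\<dots> \<le> 1" using sum_rform_real_sq_le[OF orth[OF P] ef(1)] e1 by (simp add: f_def)
    finally have "rquad P e ^ (2 * k) * (\<Sum>j\<in>{1..<d}. (rform P e (f j))\<^sup>2) \<le> rquad P e ^ (2 * k) * 1"
      by (intro mult_left_mono) (auto simp: power_mult)
    then show "(\<Sum>j\<in>{1..<d}. rquad P e ^ (p - 1) * (rform P e (f j))\<^sup>2) \<le> rquad P e ^ (2 * k)"
      by (simp add: p_def sum_distrib_left)
  qed auto
  finally show ?thesis by (simp add: p_def unit_moment_def e_def)
qed

lemma unit_moment_le: "unit_moment k \<le> (4 / real d) ^ k * fact k"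
proof (induction k)
  case (Suc k)
  have "real d * unit_moment (Suc k) \<le> 2 * real (2 * k + 1) * unit_moment k" by (rule unit_moment_Suc_le)
  also have "\<dots> \<le> (4 * real (Suc k)) * unit_moment k"
    using unit_moment_nonneg by (intro mult_right_mono) auto
  also have "\<dots> \<le> (4 * real (Suc k)) * ((4 / real d) ^ k * fact k)"
    using Suc by (intro mult_left_mono) auto
  finally show ?case using d0 by (simp add: field_simps)
qed (simp add: unit_moment_0)

lemma unit_moment_2_le: "unit_moment 2 \<le> 12 / (real d)\<^sup>2"
proof -
  have "real d * unit_moment 1 \<le> 2" using unit_moment_Suc_le[of 0] by (simp add: unit_moment_0)
  moreover have "real d * unit_moment 2 \<le> 6 * unit_moment 1" using unit_moment_Suc_le[of 1] by (simp add: numeral_2_eq_2)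
  moreover have "real d * (real d * unit_moment 2) \<le> real d * (6 * unit_moment 1)"
    using calculation(2) by (intro mult_left_mono) auto
  ultimately have "(real d)\<^sup>2 * unit_moment 2 \<le> 12"
    by (simp add: power2_eq_square algebra_simps)
  then show ?thesis using d0 by (simp add: pos_le_divide_eq mult.commute)
qed

lemma moment_unit:
  assumes "v \<in> carrier_vec d" "rip v v = 1"
  shows "(\<integral>P. rquad P v ^ (2 * k) \<partial>\<mu>) = unit_moment k"
  unfolding unit_moment_def
  using law_transitive[of "0\<^sub>v d" v "unit_vec d 0" "\<lambda>_ z. z ^ (2 * k)"] assms d0
  by simp

lemma rquad_scale:
  assumes "P \<in> space \<mu>" "v \<in> carrier_vec d"
  shows "rquad P (of_real r \<cdot>\<^sub>v v) = r\<^sup>2 * rquad P v"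
  using bilin_smult[OF rform_bilin[OF orth[OF assms(1)]] assms(2,2), of "of_real r"] by simp

lemma second_moment:
  assumes "v \<in> carrier_vec d"
  shows "(\<integral>P. (rquad P v)\<^sup>2 \<partial>\<mu>) = (rip v v)\<^sup>2 * unit_moment 1"
proof -
  obtain w where w: "w \<in> carrier_vec d" "rip w w = 1" "v = of_real (sqrt (rip v v)) \<cdot>\<^sub>v w"
    using unit_direction[OF d0 assms] .
  have "(\<integral>P. (rquad P v)\<^sup>2 \<partial>\<mu>) = (\<integral>P. (rip v v)\<^sup>2 * (rquad P w) ^ (2 * 1) \<partial>\<mu>)"
    using w(1) by (intro Bochner_Integration.integral_cong refl, subst (1 2) w(3))
      (simp add: rquad_scale power_mult_distrib)
  also have "\<dots> = (rip v v)\<^sup>2 * unit_moment 1"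
    unfolding moment_unit[OF w(1,2), of 1, symmetric] by simp
  finally show ?thesis .
qed

lemma rform_second_moment_le:
  assumes v: "v \<in> carrier_vec d" "rip v v = 1" and w: "w \<in> carrier_vec d" "rip w w = 1"
  shows "(\<integral>P. (rform P v w)\<^sup>2 \<partial>\<mu>) \<le> 2 * unit_moment 1"
    and "integrable \<mu> (\<lambda>P. (rform P v w)\<^sup>2)"
proof -
  have vw: "v + w \<in> carrier_vec d" "v - w \<in> carrier_vec d" using v w by auto
  have sq: "\<bar>z\<bar> \<le> c \<Longrightarrow> \<bar>z\<^sup>2\<bar> \<le> c\<^sup>2" for z c :: real
    by (metis abs_ge_zero power2_abs power_mono abs_power2)
  have int: "integrable \<mu> (\<lambda>P. (rquad P y)\<^sup>2)" if "y \<in> carrier_vec d" for y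
  proof (rule integrable_bounded)
    show "\<bar>(rquad P y)\<^sup>2\<bar> \<le> (rip y y)\<^sup>2" if P: "P \<in> space \<mu>" for P
      by (rule sq[OF abs_rquad_le[OF orth[OF P] \<open>y \<in> carrier_vec d\<close>]])
  qed (use that in measurable)
  show i: "integrable \<mu> (\<lambda>P. (rform P v w)\<^sup>2)"
  proof (rule integrable_bounded)
    show "\<bar>(rform P v w)\<^sup>2\<bar> \<le> 1\<^sup>2" if P: "P \<in> space \<mu>" for P
      by (rule sq[OF unit_bounds[OF P v(1) w(1) v(2) w(2)]])
  qed (use v w in measurable)
  have "(\<integral>P. (rform P v w)\<^sup>2 \<partial>\<mu>) \<le> (\<integral>P. ((rquad P (v + w))\<^sup>2 + (rquad P (v - w))\<^sup>2) / 8 \<partial>\<mu>)"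
  proof (intro integral_mono i)
    show "integrable \<mu> (\<lambda>P. ((rquad P (v + w))\<^sup>2 + (rquad P (v - w))\<^sup>2) / 8)"
      using int vw by auto
    fix P assume P: "P \<in> space \<mu>"
    define a b where "a = rquad P (v + w)" and "b = rquad P (v - w)"
    have "rform P v w = (a - b) / 4"
      unfolding a_def b_def by (rule bilin_polarization[OF rform_bilin[OF orth[OF P]] v(1) w(1)])
    moreover have "((a - b) / 4)\<^sup>2 \<le> (a\<^sup>2 + b\<^sup>2) / 8"
      using sum_squares_ge_zero[of "a + b" 0] by (simp add: power2_eq_square field_simps)
    ultimately show "(rform P v w)\<^sup>2 \<le> ((rquad P (v + w))\<^sup>2 + (rquad P (v - w))\<^sup>2) / 8"
      unfolding a_def[symmetric] b_def[symmetric] by (simp only:)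
  qed
  also have "\<dots> = ((rip (v + w) (v + w))\<^sup>2 + (rip (v - w) (v - w))\<^sup>2) / 8 * unit_moment 1"
    using int[OF vw(1)] int[OF vw(2)] by (simp add: second_moment[OF vw(1)] second_moment[OF vw(2)] algebra_simps)
  also have "\<dots> \<le> 2 * unit_moment 1"
  proof (intro mult_right_mono unit_moment_nonneg)
    have sq4: "a\<^sup>2 + b\<^sup>2 \<le> (a + b)\<^sup>2" if "0 \<le> a" "0 \<le> b" for a b :: real
      using that by (simp add: power2_sum)
    have "rip (v + w) (v + w) + rip (v - w) (v - w) = 4"
      using bilin_parallelogram[OF bilin_on_rip v(1) w(1)] v w by simp
    then have "(rip (v + w) (v + w))\<^sup>2 + (rip (v - w) (v - w))\<^sup>2 \<le> 4\<^sup>2"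
      using sq4[OF rip_self_nonneg[of "v + w"] rip_self_nonneg[of "v - w"]] by simp
    then show "((rip (v + w) (v + w))\<^sup>2 + (rip (v - w) (v - w))\<^sup>2) / 8 \<le> 2" by simp
  qed
  finally show "(\<integral>P. (rform P v w)\<^sup>2 \<partial>\<mu>) \<le> 2 * unit_moment 1" .
qed

text \<open>The first column of \<open>T\<close> is a unit vector. By polarization each of its at most \<open>2 d\<close> real coordinates
  has second moment at most \<open>2\<close> times that of a diagonal entry.\<close>

lemma unit_moment_1_ge: "unit_moment 1 \<ge> 1 / (4 * real d)"
proof -
  define e :: "'a vec" where "e = unit_vec d 0"
  have e: "e \<in> carrier_vec d" "rip e e = 1" using e0 by (auto simp: e_def)
  have f: "b \<cdot>\<^sub>v unit_vec d i \<in> carrier_vec d" "rip (b \<cdot>\<^sub>v unit_vec d i) (b \<cdot>\<^sub>v unit_vec d i) = 1"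
    if "i < d" "b \<in> Basis" for i and b :: 'a
    using that by (auto simp: rip_smult_smult[of _ d])
  have "1 = (\<integral>P. (\<Sum>i<d. \<Sum>b\<in>Basis. (rform P e (b \<cdot>\<^sub>v unit_vec d i))\<^sup>2) \<partial>\<mu>)"
  proof -
    have "(\<integral>P. (\<Sum>i<d. \<Sum>b\<in>Basis. (rform P e (b \<cdot>\<^sub>v unit_vec d i))\<^sup>2) \<partial>\<mu>) = (\<integral>P. 1 \<partial>\<mu>)"
      using sum_rform_sq[OF orth e(1)] e(2) by (intro Bochner_Integration.integral_cong refl) auto
    then show ?thesis by (simp add: prob_space)
  qed
  also have "\<dots> = (\<Sum>i<d. \<Sum>b\<in>Basis. (\<integral>P. (rform P e (b \<cdot>\<^sub>v unit_vec d i))\<^sup>2 \<partial>\<mu>))"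
    using rform_second_moment_le(2)[OF e f] by (simp add: Bochner_Integration.integral_sum)
  also have "\<dots> \<le> (\<Sum>i<d. \<Sum>b\<in>(Basis::'a set). 2 * unit_moment 1)"
    using rform_second_moment_le(1)[OF e f] by (intro sum_mono) auto
  also have "\<dots> = real d * (real (card (Basis::'a set)) * (2 * unit_moment 1))" by simp
  also have "\<dots> \<le> real d * (2 * (2 * unit_moment 1))"
    using card_Basis_le_2[where 'a = 'a] unit_moment_nonneg[of 1] by (intro mult_left_mono mult_right_mono) auto
  finally show ?thesis using d0 by (simp add: field_simps)
qed

text \<open>A lower bound on the second and an upper bound on the fourth moment give a lower bound on the first
  absolute moment. The constant \<open>4 / 27\<close> makes \<open>l z\<^sup>2 - 4/27 l\<^sup>3 z\<^sup>4\<close> touch \<open>|z|\<close>, and \<open>l\<close> is close to the best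
  multiple of \<open>sqrt d\<close> for the moment bounds at hand.\<close>

lemma expectation_abs_rquad_ge:
  assumes x: "x \<in> carrier_vec d" "rip x x = 1"
  shows "(\<integral>P. \<bar>rquad P x\<bar> \<partial>\<mu>) \<ge> 1 / (30 * sqrt (real d))"
proof -
  define s where "s = sqrt (real d)"
  have s: "s > 0" using d0 by (simp add: s_def)
  have ds: "real d = s * s" by (simp add: s_def)
  define l where "l = s / 5"
  have l: "l > 0" using s by (simp add: l_def)
  have point: "l * z ^ (2 * 1) - 4 / 27 * l ^ 3 * z ^ (2 * 2) \<le> \<bar>z\<bar>" for z :: real
  proof -
    define y where "y = l * \<bar>z\<bar>"
    have y: "y \<ge> 0" using l by (simp add: y_def)
    define t where "t = y / 3"
    have yt: "y = 3 * t" "t \<ge> 0" using y by (simp_all add: t_def)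
    then have "0 \<le> (1 - 2 * t)\<^sup>2 * (1 + t)" by simp
    also have "\<dots> = 1 - y + 4 / 27 * y ^ 3"
      unfolding yt(1) by (simp add: power2_eq_square power3_eq_cube algebra_simps)
    finally have "0 \<le> \<bar>z\<bar> * (1 - y + 4 / 27 * y ^ 3)" by (rule mult_nonneg_nonneg[OF abs_ge_zero])
    moreover have "\<bar>z\<bar> * y = l * z ^ (2 * 1)" by (simp add: y_def power2_eq_square)
    moreover have "\<bar>z\<bar> * y ^ 3 = l ^ 3 * z ^ (2 * 2)"
    proof -
      have "\<bar>z\<bar> * y ^ 3 = l ^ 3 * \<bar>z\<bar> ^ 4" by (simp add: y_def power_mult_distrib eval_nat_numeral)
      then show ?thesis by simp
    qed
    ultimately show ?thesis by (simp add: algebra_simps)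
  qed
  have int: "integrable \<mu> (\<lambda>P. rquad P x ^ k)" for k by (rule moment_integrable) (use x in auto)
  have "l * unit_moment 1 - 4 / 27 * l ^ 3 * unit_moment 2 = (\<integral>P. l * rquad P x ^ (2 * 1) - 4 / 27 * l ^ 3 * rquad P x ^ (2 * 2) \<partial>\<mu>)"
    unfolding moment_unit[OF x, symmetric]
    using int by (subst Bochner_Integration.integral_diff) (simp_all del: mult_1_right)
  also have "\<dots> \<le> (\<integral>P. \<bar>rquad P x\<bar> \<partial>\<mu>)"
    using point int int[of 1] by (intro integral_mono Bochner_Integration.integrable_diff integrable_mult_right integrable_abs) (simp_all)
  finally have "l * unit_moment 1 - 4 / 27 * l ^ 3 * unit_moment 2 \<le> (\<integral>P. \<bar>rquad P x\<bar> \<partial>\<mu>)" .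
  moreover have "l * (1 / (4 * real d)) \<le> l * unit_moment 1" using unit_moment_1_ge l by (intro mult_left_mono) auto
  moreover have "4 / 27 * l ^ 3 * unit_moment 2 \<le> 4 / 27 * l ^ 3 * (12 / (real d)\<^sup>2)" using unit_moment_2_le l by (intro mult_left_mono) auto
  moreover have "l * (1 / (4 * real d)) = 1 / 20 / s"
    using s by (simp add: l_def ds)
  moreover have "4 / 27 * l ^ 3 * (12 / (real d)\<^sup>2) = 48 / 3375 / s"
    using s by (simp add: l_def ds power2_eq_square power3_eq_cube)
  moreover have "1 / 20 / s - 48 / 3375 / s \<ge> 1 / (30 * s)"
    using s by (simp add: field_simps)
  ultimately show ?thesis unfolding s_def[symmetric] by linarith
qed

text \<open>The moment bounds \<open>(4 / d) ^ k * k!\<close> cancel the factorials of the exponential series and leave a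
  geometric series.\<close>


lemma exp_square_moment:
  assumes v: "v \<in> carrier_vec d" "rip v v \<le> 1" and lam: "0 \<le> lam" "4 * lam < real d"
  shows "(\<integral>P. exp (lam * (rquad P v)\<^sup>2) \<partial>\<mu>) \<le> 1 / (1 - 4 * lam / real d)"
    and "integrable \<mu> (\<lambda>P. exp (lam * (rquad P v)\<^sup>2))"
proof -
  obtain w where w: "w \<in> carrier_vec d" "rip w w = 1" "v = of_real (sqrt (rip v v)) \<cdot>\<^sub>v w"
    using unit_direction[OF d0 v(1)] .
  have w_bd: "\<bar>rquad P w\<bar> \<le> 1" if "P \<in> space \<mu>" for P
    using unit_bounds[OF that w(1,1,2,2)] .
  have vw: "\<bar>rquad P v\<bar> \<le> \<bar>rquad P w\<bar>" if "P \<in> space \<mu>" for P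
  proof -
    have "rquad P v = (sqrt (rip v v))\<^sup>2 * rquad P w"
      using rquad_scale[OF that w(1)] w(3) by metis
    then have "\<bar>rquad P v\<bar> = rip v v * \<bar>rquad P w\<bar>" by (simp add: abs_mult)
    then show ?thesis using v(2) by (simp add: mult_left_le_one_le)
  qed
  have meas: "(\<lambda>P. exp (lam * (rquad P y)\<^sup>2)) \<in> borel_measurable \<mu>" if "y \<in> carrier_vec d" for y
    using that by measurable
  have le: "exp (lam * (rquad P v)\<^sup>2) \<le> exp (lam * (rquad P w)\<^sup>2)" "exp (lam * (rquad P w)\<^sup>2) \<le> exp lam"
    if "P \<in> space \<mu>" for P
    using vw[OF that] w_bd[OF that] lam
    by (auto intro!: mult_left_mono simp: abs_le_square_iff[symmetric] abs_square_le_1 mult_left_le)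
  show intv: "integrable \<mu> (\<lambda>P. exp (lam * (rquad P v)\<^sup>2))"
    by (rule integrable_bounded[OF meas[OF v(1)], of "exp lam"]) (use le in \<open>force intro: order.trans\<close>)
  have intw: "integrable \<mu> (\<lambda>P. exp (lam * (rquad P w)\<^sup>2))"
    by (rule integrable_bounded[OF meas[OF w(1)], of "exp lam"]) (use le in auto)
  define r where "r = 4 * lam / real d"
  have r: "0 \<le> r" "r < 1" using lam d0 by (auto simp: r_def)
  define f where "f i P = lam ^ i / fact i * rquad P w ^ (2 * i)" for i P
  have f_int: "integrable \<mu> (f i)" for i
    unfolding f_def[abs_def] by (intro integrable_mult_right moment_integrable) (use w in auto)
  have f_nonneg: "0 \<le> f i P" for i P using lam by (simp add: f_def power_mult)
  have f_sums: "(\<lambda>i. f i P) sums exp (lam * (rquad P w)\<^sup>2)" for P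
  proof -
    have "f i P = (lam * (rquad P w)\<^sup>2) ^ i /\<^sub>R fact i" for i
      unfolding f_def power_mult_distrib power_mult[symmetric] by (simp add: divide_inverse)
    then show ?thesis using exp_converges[of "lam * (rquad P w)\<^sup>2"] by simp
  qed
  have Ef: "(\<integral>P. f i P \<partial>\<mu>) \<le> r ^ i" for i
  proof -
    have "(\<integral>P. f i P \<partial>\<mu>) = lam ^ i / fact i * unit_moment i" unfolding f_def by (simp add: moment_unit[OF w(1,2)])
    also have "\<dots> \<le> lam ^ i / fact i * ((4 / real d) ^ i * fact i)" using unit_moment_le lam by (intro mult_left_mono) auto
    also have "\<dots> = r ^ i" by (simp add: r_def power_mult_distrib power_divide)
    finally show ?thesis .
  qed
  have Ef0: "0 \<le> (\<integral>P. f i P \<partial>\<mu>)" for i using f_nonneg by (intro Bochner_Integration.integral_nonneg) auto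
  have sumr: "summable (\<lambda>i. r ^ i)" using r by (intro summable_geometric) auto
  have sumE: "summable (\<lambda>i. \<integral>P. f i P \<partial>\<mu>)"
    by (rule summable_comparison_test'[OF sumr]) (use Ef Ef0 in auto)
  have "(\<integral>P. exp (lam * (rquad P v)\<^sup>2) \<partial>\<mu>) \<le> (\<integral>P. exp (lam * (rquad P w)\<^sup>2) \<partial>\<mu>)"
    by (intro integral_mono intv intw le)
  also have "\<dots> = (\<integral>P. (\<Sum>i. f i P) \<partial>\<mu>)" using f_sums by (simp add: sums_iff)
  also have "\<dots> = (\<Sum>i. \<integral>P. f i P \<partial>\<mu>)"
  proof (rule integral_suminf[OF f_int])
    show "AE P in \<mu>. summable (\<lambda>i. norm (f i P))" using f_sums f_nonneg by (auto simp: sums_iff)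
    show "summable (\<lambda>i. \<integral>P. norm (f i P) \<partial>\<mu>)" using sumE f_nonneg by simp
  qed
  also have "\<dots> \<le> (\<Sum>i. r ^ i)" by (rule suminf_le[OF Ef sumE sumr])
  also have "\<dots> = 1 / (1 - r)" using r by (intro suminf_geometric) auto
  finally show "(\<integral>P. exp (lam * (rquad P v)\<^sup>2) \<partial>\<mu>) \<le> 1 / (1 - 4 * lam / real d)" by (simp add: r_def)
qed

end

section \<open>The mean of the sign-aligned form\<close>

lemma bilin_on_cmult:
  assumes B: "bilin_on d B" shows "bilin_on d (\<lambda>v w. r * B v w)"
  unfolding bilin_on_def
  using bilin_commute[OF B] bilin_add_left[OF B] bilin_smult[OF B] bilin_real_left[OF B]
  by (intro conjI ballI allI) (simp_all only: distrib_left mult.left_commute)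

lemma bilin_on_add:
  assumes B: "bilin_on d B" and B': "bilin_on d B'"
  shows "bilin_on d (\<lambda>v w. B v w + B' v w)"
  unfolding bilin_on_def
proof (intro conjI ballI allI)
  fix u v w :: "'a vec" and c :: 'a and r :: real
  assume uv: "u \<in> carrier_vec d" "v \<in> carrier_vec d"
  show "B u v + B' u v = B v u + B' v u"
    by (simp only: bilin_commute[OF B uv] bilin_commute[OF B' uv])
  show "B (u + v) w + B' (u + v) w = B u w + B' u w + (B v w + B' v w)" if "w \<in> carrier_vec d"
    using bilin_add_left[OF B uv that] bilin_add_left[OF B' uv that] by simp
  show "B (c \<cdot>\<^sub>v u) (c \<cdot>\<^sub>v v) + B' (c \<cdot>\<^sub>v u) (c \<cdot>\<^sub>v v) = (norm c)\<^sup>2 * (B u v + B' u v)"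
    using bilin_smult[OF B uv] bilin_smult[OF B' uv] by (simp add: distrib_left)
  show "B (of_real r \<cdot>\<^sub>v u) v + B' (of_real r \<cdot>\<^sub>v u) v = r * (B u v + B' u v)"
    using bilin_real_left[OF B uv] bilin_real_left[OF B' uv] by (simp add: distrib_left)
qed

lemma bilin_on_sum: "(\<And>j. j \<in> J \<Longrightarrow> bilin_on d (B j)) \<Longrightarrow> bilin_on d (\<lambda>v w. \<Sum>j\<in>J. B j v w)"
proof (induction J rule: infinite_finite_induct)
  case (insert j J)
  then show ?case by (simp add: bilin_on_add)
qed (simp_all add: bilin_on_def)

text \<open>After measuring \<open>x\<close>, the program replaces \<open>P\<close> by \<open>1 - P\<close> when \<open>P\<close> reports the value zero. In terms of the
  reflection \<open>2 P - 1\<close> this is multiplication by a sign, so that \<open>x\<close> always lies on the positive side.\<close>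

definition side :: "'a::real_or_complex vec \<Rightarrow> 'a mat \<Rightarrow> real" where
  "side x P = (if 0 \<le> rquad P x then 1 else - 1)"

lemma side_abs [simp]: "\<bar>side x P\<bar> = 1" "(side x P)\<^sup>2 = 1"
  by (simp_all add: side_def)

lemma side_mult_self: "side x P * rquad P x = \<bar>rquad P x\<bar>"
  by (simp add: side_def)

locale measured_line = uniform_projection +
  fixes x :: "'a vec"
  assumes x: "x \<in> carrier_vec d" "rip x x = 1"
begin

definition mean_form :: "'a vec \<Rightarrow> 'a vec \<Rightarrow> real" where
  "mean_form v w = (\<integral>P. side x P * rform P v w \<partial>\<mu>)"

lemma side_measurable [measurable]: "side x \<in> borel_measurable \<mu>"
  unfolding side_def[abs_def] using x by measurable

lemma side_form_integrable:
  assumes "v \<in> carrier_vec d" "w \<in> carrier_vec d"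
  shows "integrable \<mu> (\<lambda>P. side x P * rform P v w)"
proof (rule integrable_bounded)
  show "\<bar>side x P * rform P v w\<bar> \<le> vec_l2_norm v * vec_l2_norm w" if "P \<in> space \<mu>" for P
    using abs_rform_le[OF orth[OF that] assms] by (simp add: abs_mult)
qed (use assms in measurable)

lemma mean_form_bilin: "bilin_on d mean_form"
  unfolding bilin_on_def
proof (intro conjI ballI allI)
  fix u v w :: "'a vec" and c :: 'a and r :: real
  assume uv: "u \<in> carrier_vec d" "v \<in> carrier_vec d"
  show "mean_form u v = mean_form v u"
    unfolding mean_form_def using bilin_commute[OF rform_bilin[OF orth] uv]
    by (intro Bochner_Integration.integral_cong refl) simp
  have "mean_form (c \<cdot>\<^sub>v u) (c \<cdot>\<^sub>v v) = (\<integral>P. (norm c)\<^sup>2 * (side x P * rform P u v) \<partial>\<mu>)"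
    unfolding mean_form_def using bilin_smult[OF rform_bilin[OF orth] uv]
    by (intro Bochner_Integration.integral_cong refl) simp
  then show "mean_form (c \<cdot>\<^sub>v u) (c \<cdot>\<^sub>v v) = (norm c)\<^sup>2 * mean_form u v"
    by (simp add: mean_form_def)
  have "mean_form (of_real r \<cdot>\<^sub>v u) v = (\<integral>P. r * (side x P * rform P u v) \<partial>\<mu>)"
    unfolding mean_form_def using bilin_real_left[OF rform_bilin[OF orth] uv]
    by (intro Bochner_Integration.integral_cong refl) simp
  then show "mean_form (of_real r \<cdot>\<^sub>v u) v = r * mean_form u v"
    by (simp add: mean_form_def)
  assume w: "w \<in> carrier_vec d"
  have "mean_form (u + v) w = (\<integral>P. side x P * rform P u w + side x P * rform P v w \<partial>\<mu>)"
    unfolding mean_form_def using bilin_add_left[OF rform_bilin[OF orth] uv w]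
    by (intro Bochner_Integration.integral_cong refl) (simp add: distrib_left)
  then show "mean_form (u + v) w = mean_form u w + mean_form v w"
    using side_form_integrable uv w by (simp add: mean_form_def)
qed

text \<open>The reflection in \<open>x\<close> itself sends \<open>x\<close> to \<open>- x\<close>, which does not affect the measurement. It removes the
  mixed terms between \<open>x\<close> and its orthogonal complement from the mean.\<close>

lemma mean_form_reflect:
  assumes v: "v \<in> carrier_vec d"
  shows "mean_form (householder x *\<^sub>v v) (householder x *\<^sub>v v) = mean_form v v"
proof -
  let ?T = "\<lambda>P. householder x * P * mat_adjoint (householder x)"
  have "side x (?T P) * rquad (?T P) v = side x P * rquad P (householder x *\<^sub>v v)" if "P \<in> space \<mu>" for P
    using carr[OF that] x v bilin_smult[OF rform_bilin[OF orth[OF that]] x(1) x(1), of "-1"]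
    by (simp add: householder_rform[OF x] side_def householder_self[OF x])
  then have "mean_form (householder x *\<^sub>v v) (householder x *\<^sub>v v) = (\<integral>P. side x (?T P) * rquad (?T P) v \<partial>\<mu>)"
    unfolding mean_form_def by (intro Bochner_Integration.integral_cong refl) simp
  also have "\<dots> = mean_form v v"
    unfolding mean_form_def using v by (intro householder_invariant[OF x]) measurable
  finally show ?thesis .
qed

lemma mean_form_orth:
  obtains b where "\<And>v. v \<in> carrier_vec d \<Longrightarrow> x \<bullet>c v = 0 \<Longrightarrow> mean_form v v = b * rip v v"
proof (cases "\<exists>w \<in> carrier_vec d. x \<bullet>c w = 0 \<and> rip w w = 1")
  case True
  then obtain w where w: "w \<in> carrier_vec d" "x \<bullet>c w = 0" "rip w w = 1" by blast
  show ?thesis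
  proof (rule that[of "mean_form w w"])
    fix v :: "'a vec" assume v: "v \<in> carrier_vec d" "x \<bullet>c v = 0"
    let ?r = "of_real (sqrt (rip v v)) :: 'a"
    have rw: "?r \<cdot>\<^sub>v w \<in> carrier_vec d" "x \<bullet>c (?r \<cdot>\<^sub>v w) = 0" "rip (?r \<cdot>\<^sub>v w) (?r \<cdot>\<^sub>v w) = rip v v"
      using w x v by (auto simp: rip_smult_smult[of _ d] conjugate_smult_vec)
    have "mean_form v v = mean_form (?r \<cdot>\<^sub>v w) (?r \<cdot>\<^sub>v w)"
      unfolding mean_form_def side_def using x v rw
      by (intro law_transitive[where h = "\<lambda>s t. (if 0 \<le> s then 1 else - 1) * t"]) (auto, measurable)
    also have "\<dots> = rip v v * mean_form w w" by (simp add: bilin_smult[OF mean_form_bilin w(1) w(1)])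
    finally show "mean_form v v = mean_form w w * rip v v" by simp
  qed
next
  case False
  show ?thesis
  proof (rule that[of 0])
    fix v :: "'a vec" assume v: "v \<in> carrier_vec d" "x \<bullet>c v = 0"
    obtain w where w: "w \<in> carrier_vec d" "rip w w = 1" "v = of_real (sqrt (rip v v)) \<cdot>\<^sub>v w"
      using unit_direction[OF d0 v(1)] .
    have "x \<bullet>c (r \<cdot>\<^sub>v w) = conjugate r * (x \<bullet>c w)" for r
      using x(1) w(1) by (simp add: conjugate_smult_vec)
    then have "x \<bullet>c v = conjugate (of_real (sqrt (rip v v))) * (x \<bullet>c w)"
      using w(3) by metis
    then have "rip v v = 0" using v False w by auto
    then show "mean_form v v = 0 * rip v v"
      using bilin_smult[OF mean_form_bilin w(1) w(1), of 0] w(3) by simp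
  qed
qed

text \<open>By symmetry the mean is \<open>a\<close> on \<open>x\<close> and a constant \<open>b\<close> on the orthogonal complement, and the trace gives
  \<open>a + (d - 1) b = 0\<close>. Since \<open>a\<close> is the expectation of \<open>|rquad P x|\<close>, it is at least of order \<open>1 / sqrt d\<close>, and \<open>b \<le> 0\<close>.
  So \<open>x\<close> spans the top eigenspace of the mean, with a spectral gap of at least the order \<open>1 / sqrt d\<close>.\<close>

lemma mean_form_gap:
  obtains g where "g \<ge> 1 / (30 * sqrt (real d))"
    "\<And>v. v \<in> carrier_vec d \<Longrightarrow> rip v v = 1 \<Longrightarrow> mean_form x x - mean_form v v = g * (1 - (norm (v \<bullet>c x))\<^sup>2)"
proof -
  obtain b where b: "\<And>v. v \<in> carrier_vec d \<Longrightarrow> x \<bullet>c v = 0 \<Longrightarrow> mean_form v v = b * rip v v"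
    using mean_form_orth by blast
  define a where "a = mean_form x x"
  have a: "a \<ge> 1 / (30 * sqrt (real d))"
    using expectation_abs_rquad_ge[OF x] by (simp add: a_def mean_form_def side_mult_self)
  have decomp: "mean_form v v = a * (norm (v \<bullet>c x))\<^sup>2 + b * (rip v v - (norm (v \<bullet>c x))\<^sup>2)"
    if v: "v \<in> carrier_vec d" for v
  proof -
    define c where "c = v \<bullet>c x"
    define w where "w = v - c \<cdot>\<^sub>v x"
    have w: "w \<in> carrier_vec d" and cx: "c \<cdot>\<^sub>v x \<in> carrier_vec d" using v x by (auto simp: w_def)
    have wx: "w \<bullet>c x = 0"
      using v x by (simp add: w_def minus_scalar_prod_distrib[of _ d] cscalar_prod_self c_def)
    have xw: "x \<bullet>c w = 0" using conjugate_cscalar_prod[OF w x(1)] wx by simp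
    have vw: "v = w + c \<cdot>\<^sub>v x" using v x by (intro eq_vecI) (auto simp: w_def)
    have "householder x *\<^sub>v v = w - c \<cdot>\<^sub>v x"
      unfolding householder_mult_vec[OF x v] c_def[symmetric] w_def using v x
      by (intro eq_vecI) (auto simp: algebra_simps)
    then have eq: "mean_form (w - c \<cdot>\<^sub>v x) (w - c \<cdot>\<^sub>v x) = mean_form (w + c \<cdot>\<^sub>v x) (w + c \<cdot>\<^sub>v x)"
      using mean_form_reflect[OF v] vw by simp
    have "mean_form v v = mean_form w w + mean_form (c \<cdot>\<^sub>v x) (c \<cdot>\<^sub>v x)"
      using bilin_parallelogram[OF mean_form_bilin w cx] eq unfolding vw[symmetric] by simp
    also have "mean_form (c \<cdot>\<^sub>v x) (c \<cdot>\<^sub>v x) = a * (norm c)\<^sup>2"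
      by (simp add: a_def bilin_smult[OF mean_form_bilin x(1) x(1)])
    also have "mean_form w w = b * rip w w" by (rule b[OF w xw])
    also have "rip w w = rip v v - (norm c)\<^sup>2"
    proof -
      have cc: "(c \<cdot>\<^sub>v x) \<bullet>c w = 0" using x w xw by simp
      have "rip (c \<cdot>\<^sub>v x) w = 0" unfolding rip_def cc by simp
      then have "rip v v = rip w w + rip (c \<cdot>\<^sub>v x) (c \<cdot>\<^sub>v x)"
        using w cx rip_commute[OF w cx] by (subst (1 2) vw) (simp add: rip_add_left[of _ d] rip_add_right[of _ d])
      then show ?thesis using x by (simp add: rip_smult_smult[of _ d])
    qed
    finally show ?thesis by (simp add: c_def)
  qed
  have "(\<Sum>i<d. mean_form (unit_vec d i) (unit_vec d i)) = 0"
  proof -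
    have "(\<Sum>i<d. mean_form (unit_vec d i) (unit_vec d i)) = (\<integral>P. (\<Sum>i<d. side x P * rquad P (unit_vec d i)) \<partial>\<mu>)"
      unfolding mean_form_def using side_form_integrable by (subst Bochner_Integration.integral_sum) auto
    also have "\<dots> = (\<integral>P. 0 \<partial>\<mu>)"
    proof (intro Bochner_Integration.integral_cong refl)
      fix P assume "P \<in> space \<mu>"
      then have "(\<Sum>i<d. rquad P (unit_vec d i)) = 0"
        using sum_rquad_unit[of P n] by (simp add: space_mu d_def)
      then show "(\<Sum>i<d. side x P * rquad P (unit_vec d i)) = 0" by (simp flip: sum_distrib_left)
    qed
    finally show ?thesis by simp
  qed
  moreover have "(\<Sum>i<d. mean_form (unit_vec d i) (unit_vec d i)) = a + b * (real d - 1)"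
  proof -
    have "unit_vec d i \<bullet>c x = conjugate (x $ i)" if "i < d" for i
      using x that by (simp add: cscalar_prod_sum[of _ d] unit_vec_def if_distrib[of "\<lambda>z. z * _"] cong: if_cong)
    then have "mean_form (unit_vec d i) (unit_vec d i) = a * (norm (x $ i))\<^sup>2 + b * (1 - (norm (x $ i))\<^sup>2)" if "i < d" for i
      using decomp[of "unit_vec d i"] that by simp
    then have "(\<Sum>i<d. mean_form (unit_vec d i) (unit_vec d i)) = (\<Sum>i<d. a * (norm (x $ i))\<^sup>2 + b * (1 - (norm (x $ i))\<^sup>2))"
      by simp
    also have "\<dots> = a * rip x x + b * (real d - rip x x)"
      unfolding rip_self[OF x(1)] by (simp add: sum.distrib sum_distrib_left sum_subtractf right_diff_distrib)
    finally show ?thesis using x by simp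
  qed
  ultimately have ab: "a + b * (real d - 1) = 0" by simp
  have "b \<le> 0"
  proof (rule ccontr)
    assume "\<not> b \<le> 0"
    then have "b * (real d - 1) > 0" using d2 by (intro mult_pos_pos) auto
    moreover have "a \<ge> 0" using a by (rule order.trans[rotated]) simp
    ultimately show False using ab by linarith
  qed
  show ?thesis
  proof (rule that[of "a - b"])
    show "a - b \<ge> 1 / (30 * sqrt (real d))" using a \<open>b \<le> 0\<close> by linarith
    show "mean_form x x - mean_form v v = (a - b) * (1 - (norm (v \<bullet>c x))\<^sup>2)"
      if "v \<in> carrier_vec d" "rip v v = 1" for v
      using decomp[OF that(1)] that(2) by (simp add: a_def[symmetric] algebra_simps)
  qed
qed

lemma mean_form_sq_le:
  assumes v: "v \<in> carrier_vec d" "rip v v \<le> 1"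
  shows "(mean_form v v)\<^sup>2 \<le> 2 / real d"
proof -
  let ?f = "\<lambda>P. side x P * rquad P v" and ?m = "mean_form v v"
  have i1: "integrable \<mu> ?f" using side_form_integrable v by blast
  have i2: "integrable \<mu> (\<lambda>P. (rquad P v)\<^sup>2)" by (rule moment_integrable[OF v])
  have "0 \<le> (\<integral>P. (?f P - ?m)\<^sup>2 \<partial>\<mu>)" by (intro Bochner_Integration.integral_nonneg) simp
  also have "\<dots> = (\<integral>P. (rquad P v)\<^sup>2 - 2 * ?m * ?f P + ?m\<^sup>2 \<partial>\<mu>)"
    by (intro Bochner_Integration.integral_cong refl) (simp add: power2_diff power_mult_distrib algebra_simps)
  also have "\<dots> = (\<integral>P. (rquad P v)\<^sup>2 \<partial>\<mu>) - 2 * ?m * ?m + ?m\<^sup>2"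
    using i1 i2 by (simp add: prob_space mean_form_def)
  finally have "?m\<^sup>2 \<le> (\<integral>P. (rquad P v)\<^sup>2 \<partial>\<mu>)" by (simp add: power2_eq_square)
  also have "\<dots> = (rip v v)\<^sup>2 * unit_moment 1" by (rule second_moment[OF v(1)])
  also have "\<dots> \<le> 1 * unit_moment 1" using v unit_moment_nonneg by (intro mult_right_mono) (auto simp: power_le_one)
  also have "\<dots> \<le> 2 / real d" using unit_moment_Suc_le[of 0] d0 by (simp add: unit_moment_0 field_simps)
  finally show ?thesis .
qed

end

section \<open>Concentration at a fixed vector\<close>

text \<open>This turns square-exponential moments of a centred variable into a bound on its moment generating
  function: the linear term has expectation zero.\<close>

lemma exp_le_linear_plus_exp_square: "exp z \<le> z + exp (z\<^sup>2)" for z :: real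
proof -
  have "1 + z\<^sup>2 \<le> exp (z\<^sup>2)" by (rule exp_ge_add_one_self)
  moreover have "exp z \<le> 1 + z + z\<^sup>2 \<or> (exp z \<le> exp (z\<^sup>2) \<and> 0 \<le> z)"
  proof (cases "z \<ge> 0")
    case True
    then show ?thesis using exp_bound[of z] by (cases "z \<le> 1") (auto simp: power2_eq_square mult_left_le)
  next
    case False
    have y: "0 < 1 - z" using False by simp
    have "exp z * (1 - z) \<le> exp z * exp (- z)"
      using exp_ge_add_one_self[of "- z"] by (intro mult_left_mono) auto
    also have "\<dots> = 1" by (simp flip: exp_add)
    also have "\<dots> \<le> 1 + (- z) ^ 3" using False by simp
    also have "\<dots> = (1 + z + z\<^sup>2) * (1 - z)" by (simp add: power2_eq_square power3_eq_cube algebra_simps)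
    finally show ?thesis using y by (simp add: mult_le_cancel_right)
  qed
  ultimately show ?thesis by linarith
qed

lemma inverse_one_minus_le_exp: "0 \<le> y \<Longrightarrow> y \<le> 1 / 2 \<Longrightarrow> 1 / (1 - y) \<le> exp (2 * y)" for y :: real
proof -
  assume y: "0 \<le> y" "y \<le> 1 / 2"
  have "1 \<le> (1 + 2 * y) * (1 - y)"
  proof -
    have "0 \<le> y * (1 - 2 * y)" using y by simp
    then show ?thesis by (simp add: algebra_simps)
  qed
  also have "\<dots> \<le> exp (2 * y) * (1 - y)"
    using exp_ge_add_one_self[of "2 * y"] y by (intro mult_right_mono) auto
  finally show ?thesis using y by (simp add: divide_le_eq)
qed

context measured_line
begin

definition deviation :: "'a vec \<Rightarrow> 'a mat \<Rightarrow> real" where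
  "deviation v P = side x P * rquad P v - mean_form v v"

lemma deviation_measurable [measurable]: "v \<in> carrier_vec d \<Longrightarrow> deviation v \<in> borel_measurable \<mu>"
  unfolding deviation_def[abs_def] by measurable

lemma deviation_bound:
  assumes "v \<in> carrier_vec d" "rip v v \<le> 1" "P \<in> space \<mu>"
  shows "\<bar>deviation v P\<bar> \<le> 3"
proof -
  have "\<bar>side x P * rquad P v\<bar> \<le> 1"
    using abs_rquad_le[OF orth[OF assms(3)] assms(1)] assms(2) by (simp add: abs_mult)
  moreover have "2 / real d \<le> 1" using d2 by simp
  then have "(mean_form v v)\<^sup>2 \<le> 1" using mean_form_sq_le[OF assms(1,2)] by linarith
  then have "\<bar>mean_form v v\<bar> \<le> 1" by (simp add: abs_square_le_1)
  ultimately show ?thesis unfolding deviation_def by linarith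
qed

text \<open>The sign does not change the square of the form, so the exponential moment of the square is that of
  the unsigned form, and centring costs only a constant factor in the exponent.\<close>

lemma deviation_mgf:
  assumes v: "v \<in> carrier_vec d" "rip v v \<le> 1" and th: "16 * \<theta>\<^sup>2 \<le> real d"
  shows "(\<integral>P. exp (\<theta> * deviation v P) \<partial>\<mu>) \<le> exp (20 * \<theta>\<^sup>2 / real d)"
    and "integrable \<mu> (\<lambda>P. exp (\<theta> * deviation v P))"
proof -
  show i: "integrable \<mu> (\<lambda>P. exp (\<theta> * deviation v P))"
  proof (rule integrable_bounded)
    show "\<bar>exp (\<theta> * deviation v P)\<bar> \<le> exp (\<bar>\<theta>\<bar> * 3)" if "P \<in> space \<mu>" for P
    proof -
      have "\<theta> * deviation v P \<le> \<bar>\<theta>\<bar> * \<bar>deviation v P\<bar>" by (metis abs_ge_self abs_mult)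
      also have "\<dots> \<le> \<bar>\<theta>\<bar> * 3" using deviation_bound[OF v that] by (intro mult_left_mono) auto
      finally show ?thesis by simp
    qed
  qed (use v in measurable)
  have idev: "integrable \<mu> (deviation v)" unfolding deviation_def[abs_def] using side_form_integrable[OF v(1) v(1)] by simp
  have dev0: "(\<integral>P. deviation v P \<partial>\<mu>) = 0"
    unfolding deviation_def using side_form_integrable[OF v(1) v(1)] by (simp add: prob_space mean_form_def)
  define y where "y = 8 * \<theta>\<^sup>2 / real d"
  have y: "0 \<le> y" "y \<le> 1 / 2" using th d0 by (auto simp: y_def field_simps)
  note em = exp_square_moment[OF v, of "2 * \<theta>\<^sup>2"]
  have lam: "4 * (2 * \<theta>\<^sup>2) < real d" using th d0 by simp
  have point: "exp (\<theta> * deviation v P) \<le> \<theta> * deviation v P + exp (4 * \<theta>\<^sup>2 / real d) * exp (2 * \<theta>\<^sup>2 * (rquad P v)\<^sup>2)" for P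
  proof -
    have "(deviation v P)\<^sup>2 \<le> 2 * (rquad P v)\<^sup>2 + 2 * (mean_form v v)\<^sup>2"
    proof -
      have "(side x P * rquad P v - mean_form v v)\<^sup>2 \<le> 2 * (side x P * rquad P v)\<^sup>2 + 2 * (mean_form v v)\<^sup>2"
        using zero_le_power2[of "side x P * rquad P v + mean_form v v"]
        unfolding power2_diff power2_sum by linarith
      then show ?thesis by (simp add: deviation_def power_mult_distrib)
    qed
    also have "\<dots> \<le> 2 * (rquad P v)\<^sup>2 + 2 * (2 / real d)"
      using mean_form_sq_le[OF v] by simp
    finally have "\<theta>\<^sup>2 * (deviation v P)\<^sup>2 \<le> \<theta>\<^sup>2 * (2 * (rquad P v)\<^sup>2 + 2 * (2 / real d))"
      by (rule mult_left_mono) simp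
    then have "(\<theta> * deviation v P)\<^sup>2 \<le> 4 * \<theta>\<^sup>2 / real d + 2 * \<theta>\<^sup>2 * (rquad P v)\<^sup>2"
      by (simp add: power_mult_distrib algebra_simps)
    then have "exp ((\<theta> * deviation v P)\<^sup>2) \<le> exp (4 * \<theta>\<^sup>2 / real d) * exp (2 * \<theta>\<^sup>2 * (rquad P v)\<^sup>2)"
      by (simp flip: exp_add)
    then show ?thesis using exp_le_linear_plus_exp_square[of "\<theta> * deviation v P"] by linarith
  qed
  have "(\<integral>P. exp (\<theta> * deviation v P) \<partial>\<mu>) \<le> (\<integral>P. \<theta> * deviation v P + exp (4 * \<theta>\<^sup>2 / real d) * exp (2 * \<theta>\<^sup>2 * (rquad P v)\<^sup>2) \<partial>\<mu>)"
    using idev em(2)[OF _ lam] point by (intro integral_mono i) auto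
  also have "\<dots> = exp (4 * \<theta>\<^sup>2 / real d) * (\<integral>P. exp (2 * \<theta>\<^sup>2 * (rquad P v)\<^sup>2) \<partial>\<mu>)"
    using idev em(2)[OF _ lam] dev0 by simp
  also have "\<dots> \<le> exp (4 * \<theta>\<^sup>2 / real d) * (1 / (1 - y))"
    using em(1)[OF _ lam] by (intro mult_left_mono) (auto simp: y_def)
  also have "\<dots> \<le> exp (4 * \<theta>\<^sup>2 / real d) * exp (2 * y)"
    using inverse_one_minus_le_exp[OF y] by (intro mult_left_mono) auto
  also have "\<dots> = exp (20 * \<theta>\<^sup>2 / real d)"
    by (simp add: y_def add_divide_distrib[symmetric] flip: exp_add)
  finally show "(\<integral>P. exp (\<theta> * deviation v P) \<partial>\<mu>) \<le> exp (20 * \<theta>\<^sup>2 / real d)" .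
qed

abbreviation sample :: "nat \<Rightarrow> (nat \<Rightarrow> 'a mat) measure" where
  "sample m \<equiv> Pi\<^sub>M {..<m} (\<lambda>_. \<mu>)"

lemma sample_prob: "prob_space (sample m)"
  by (intro prob_space_PiM prob_space_axioms)

text \<open>The sign \<open>s\<close> selects the tail.\<close>

lemma chernoff_one_sided:
  assumes v: "v \<in> carrier_vec d" "rip v v \<le> 1" and tau: "0 < \<tau>" "real d * \<tau>\<^sup>2 \<le> 100" and s: "\<bar>s\<bar> = 1"
  shows "measure (sample m) {Ps \<in> space (sample m). real m * \<tau> \<le> s * (\<Sum>j<m. deviation v (Ps j))}
      \<le> exp (- (real m * real d * \<tau>\<^sup>2 / 80))"
proof -
  interpret product_sigma_finite "\<lambda>_ :: nat. \<mu>" by standard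
  interpret S: prob_space "sample m" by (rule sample_prob)
  \<comment> \<open>up to the sign, the minimizer of \<open>20 \<theta>\<^sup>2 / d - \<theta> \<tau>\<close>; the bound on \<open>\<tau>\<close> keeps it in the range of the exponential moment\<close>
  define th where "th = s * (real d * \<tau> / 40)"
  have s2: "s\<^sup>2 = 1" using s by (metis power2_abs power_one)
  have th2: "th\<^sup>2 = (real d * \<tau> / 40)\<^sup>2" unfolding th_def power_mult_distrib s2 by simp
  have thd: "16 * th\<^sup>2 \<le> real d"
  proof -
    have "16 * th\<^sup>2 = real d * (real d * \<tau>\<^sup>2) / 100" unfolding th2 by (simp add: power2_eq_square field_simps)
    also have "\<dots> \<le> real d * 100 / 100" using tau by (intro divide_right_mono mult_left_mono) auto
    finally show ?thesis by simp
  qed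
  let ?u = "\<lambda>Ps. \<Prod>j<m. exp (th * deviation v (Ps j))"
  have fin: "finite {..<m}" by simp
  have int: "integrable (sample m) ?u"
    by (rule product_integrable_prod[OF fin]) (rule deviation_mgf(2)[OF v thd])
  have Eu: "(\<integral>Ps. ?u Ps \<partial>sample m) = (\<integral>P. exp (th * deviation v P) \<partial>\<mu>) ^ m"
    by (subst product_integral_prod[OF fin]) (use deviation_mgf(2)[OF v thd] in auto)
  have u_eq: "?u Ps = exp ((real d * \<tau> / 40) * (s * (\<Sum>j<m. deviation v (Ps j))))" for Ps
    unfolding exp_sum[OF fin, symmetric] sum_distrib_left[symmetric] th_def by (simp add: mult_ac)
  have "{Ps \<in> space (sample m). real m * \<tau> \<le> s * (\<Sum>j<m. deviation v (Ps j))}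
      = {Ps \<in> space (sample m). exp ((real d * \<tau> / 40) * (real m * \<tau>)) \<le> ?u Ps}"
    unfolding u_eq exp_le_cancel_iff using tau d0 by (subst mult_le_cancel_left_pos) simp_all
  also have "measure (sample m) \<dots> \<le> (\<integral>Ps. ?u Ps \<partial>sample m) / exp ((real d * \<tau> / 40) * (real m * \<tau>))"
    by (rule integral_Markov_inequality_measure[OF int, where A = "{}"]) (auto intro!: prod_nonneg)
  also have "\<dots> \<le> exp (20 * th\<^sup>2 / real d) ^ m / exp ((real d * \<tau> / 40) * (real m * \<tau>))"
    unfolding Eu using deviation_mgf(1)[OF v thd] by (intro divide_right_mono power_mono Bochner_Integration.integral_nonneg) auto
  also have "\<dots> = exp (real m * (20 * th\<^sup>2 / real d) - (real d * \<tau> / 40) * (real m * \<tau>))"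
    unfolding exp_diff exp_of_nat_mult ..
  also have "real m * (20 * th\<^sup>2 / real d) - (real d * \<tau> / 40) * (real m * \<tau>) = - (real m * real d * \<tau>\<^sup>2 / 80)"
    unfolding th2 using d0 by (simp add: power2_eq_square field_simps)
  finally show ?thesis .
qed

end

section \<open>From a finite net to the whole sphere\<close>

definition trunc :: "real \<Rightarrow> real" where
  "trunc r = (if 0 \<le> r then of_int \<lfloor>r\<rfloor> else - of_int \<lfloor>- r\<rfloor>)"

lemma trunc_props:
  shows "\<bar>trunc r\<bar> \<le> \<bar>r\<bar>" "\<bar>r - trunc r\<bar> \<le> 1" "\<bar>r\<bar> \<le> real N \<Longrightarrow> trunc r \<in> of_int ` {- int N .. int N}"
proof -
  show "\<bar>trunc r\<bar> \<le> \<bar>r\<bar>" "\<bar>r - trunc r\<bar> \<le> 1" unfolding trunc_def by (auto; linarith)+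
  assume "\<bar>r\<bar> \<le> real N"
  then show "trunc r \<in> of_int ` {- int N .. int N}"
  proof (cases "0 \<le> r")
    case True
    then have "\<lfloor>r\<rfloor> \<in> {- int N .. int N}" using \<open>\<bar>r\<bar> \<le> real N\<close> by (simp add: floor_le_iff) linarith
    then show ?thesis using True by (simp add: trunc_def)
  next
    case False
    then have "- \<lfloor>- r\<rfloor> \<in> {- int N .. int N}" using \<open>\<bar>r\<bar> \<le> real N\<close> by simp linarith
    then have "of_int (- \<lfloor>- r\<rfloor>) \<in> real_of_int ` {- int N .. int N}" by (rule imageI)
    then show ?thesis using False by (simp add: trunc_def)
  qed
qed

definition round_scalar :: "nat \<Rightarrow> 'a::real_or_complex \<Rightarrow> 'a" where
  "round_scalar N z = (\<Sum>b\<in>Basis. (trunc (real N * inner z b) / real N) *\<^sub>R b)"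

lemma norm_sq_Basis: "(norm (z :: 'a::euclidean_space))\<^sup>2 = (\<Sum>b\<in>Basis. (inner z b)\<^sup>2)"
  by (subst power2_norm_eq_inner, subst euclidean_inner, simp only: power2_eq_square)

lemma round_scalar_inner: "b \<in> Basis \<Longrightarrow> inner (round_scalar N z) b = trunc (real N * inner z b) / real N"
  by (simp add: round_scalar_def inner_sum_left inner_Basis if_distrib cong: if_cong)

lemma round_scalar_norm_le: "N > 0 \<Longrightarrow> norm (round_scalar N z) \<le> norm z"
proof (rule power2_le_imp_le)
  assume N: "N > 0"
  show "(norm (round_scalar N z))\<^sup>2 \<le> (norm z)\<^sup>2"
    unfolding norm_sq_Basis
  proof (rule sum_mono)
    fix b :: 'a assume b: "b \<in> Basis"
    have "\<bar>trunc (real N * inner z b) / real N\<bar> \<le> \<bar>real N * inner z b\<bar> / real N"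
      using trunc_props(1)[of "real N * inner z b"] by (simp add: divide_right_mono)
    also have "\<dots> = \<bar>inner z b\<bar>" using N by (simp add: abs_mult)
    finally show "(inner (round_scalar N z) b)\<^sup>2 \<le> (inner z b)\<^sup>2"
      unfolding round_scalar_inner[OF b] by (simp only: abs_le_square_iff)
  qed
qed simp

lemma round_scalar_error: "N > 0 \<Longrightarrow> (norm (z - round_scalar N z :: 'a::real_or_complex))\<^sup>2 \<le> 2 / (real N)\<^sup>2"
proof -
  assume N: "N > 0"
  have "(norm (z - round_scalar N z))\<^sup>2 \<le> (\<Sum>b\<in>(Basis::'a set). 1 / (real N)\<^sup>2)"
    unfolding norm_sq_Basis
  proof (rule sum_mono)
    fix b :: 'a assume b: "b \<in> Basis"
    have "inner z b - trunc (real N * inner z b) / real N = (real N * inner z b - trunc (real N * inner z b)) / real N"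
      using N by (simp add: field_simps)
    then have "\<bar>inner (z - round_scalar N z) b\<bar> \<le> \<bar>1 / real N\<bar>"
      using trunc_props(2)[of "real N * inner z b"]
      by (simp add: inner_diff_left round_scalar_inner[OF b] divide_right_mono)
    then have "(inner (z - round_scalar N z) b)\<^sup>2 \<le> (1 / real N)\<^sup>2"
      by (simp only: abs_le_square_iff)
    then show "(inner (z - round_scalar N z) b)\<^sup>2 \<le> 1 / (real N)\<^sup>2" by (simp add: power_divide)
  qed
  also have "\<dots> = real (card (Basis::'a set)) * (1 / (real N)\<^sup>2)" by simp
  also have "\<dots> \<le> 2 * (1 / (real N)\<^sup>2)"
    using card_Basis_le_2[where 'a = 'a] by (intro mult_right_mono) auto
  finally show ?thesis by simp
qed

definition scalar_grid :: "nat \<Rightarrow> 'a::real_or_complex set" where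
  "scalar_grid N = (\<lambda>k. \<Sum>b\<in>Basis. (of_int (k b) / real N) *\<^sub>R b) ` (Basis \<rightarrow>\<^sub>E {- int N .. int N})"

lemma scalar_grid_card: "finite (scalar_grid N :: 'a::real_or_complex set)" "card (scalar_grid N :: 'a set) \<le> (2 * N + 1)\<^sup>2"
proof -
  show "finite (scalar_grid N :: 'a set)" unfolding scalar_grid_def by (intro finite_imageI finite_PiE) auto
  have "card (scalar_grid N :: 'a set) \<le> card ((Basis :: 'a set) \<rightarrow>\<^sub>E {- int N .. int N})"
    unfolding scalar_grid_def by (intro card_image_le finite_PiE) auto
  also have "\<dots> = (2 * N + 1) ^ card (Basis :: 'a set)"
  proof -
    have "card {- int N .. int N} = 2 * N + 1" by (simp add: nat_eq_iff)
    then show ?thesis by (simp add: card_PiE)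
  qed
  also have "\<dots> \<le> (2 * N + 1)\<^sup>2" using card_Basis_le_2[where 'a = 'a] by (intro power_increasing) auto
  finally show "card (scalar_grid N :: 'a set) \<le> (2 * N + 1)\<^sup>2" .
qed

lemma round_scalar_in_grid:
  assumes "norm z \<le> 1" shows "round_scalar N z \<in> scalar_grid N"
proof -
  have "\<exists>k. of_int k = trunc (real N * inner z b) \<and> k \<in> {- int N .. int N}" if "b \<in> Basis" for b
  proof -
    have "\<bar>inner z b\<bar> \<le> 1" using Basis_le_norm[OF that, of z] assms by linarith
    then have "\<bar>real N * inner z b\<bar> \<le> real N" by (simp add: abs_mult mult_left_le)
    from trunc_props(3)[OF this] show ?thesis by force
  qed
  then obtain k where k: "\<And>b. b \<in> Basis \<Longrightarrow> of_int (k b) = trunc (real N * inner z b) \<and> k b \<in> {- int N .. int N}"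
    by metis
  show ?thesis unfolding scalar_grid_def round_scalar_def
    by (rule image_eqI[of _ _ "restrict k Basis"]) (use k in \<open>auto intro!: sum.cong\<close>)
qed

text \<open>Rounding coordinates toward zero to multiples of \<open>1 / (6 d)\<close> never increases the norm and moves a unit
  vector by at most \<open>1 / 4\<close>. A grid has more points than an optimal net, but the logarithm of their number is
  still of order \<open>d log d\<close>, which the number of measurements can afford.\<close>

lemma finite_net:
  assumes d: "0 < d"
  obtains G :: "'a::real_or_complex vec set" where "finite G" "card G \<le> (12 * d + 1) ^ (2 * d)"
    "\<And>g. g \<in> G \<Longrightarrow> g \<in> carrier_vec d \<and> rip g g \<le> 1"
    "\<And>v. v \<in> carrier_vec d \<Longrightarrow> rip v v = 1 \<Longrightarrow> \<exists>g\<in>G. rip (v - g) (v - g) \<le> 1 / 16"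
proof -
  define N where "N = 6 * d"
  have N: "N > 0" using d by (simp add: N_def)
  define E where "E = {..<d} \<rightarrow>\<^sub>E (scalar_grid N :: 'a set)"
  define G where "G = {g \<in> vec d ` E. rip g g \<le> 1}"
  have fE: "finite E" unfolding E_def by (intro finite_PiE) (auto simp: scalar_grid_card)
  have "card G \<le> card (vec d ` E)" unfolding G_def by (intro card_mono) (use fE in auto)
  also have "\<dots> \<le> card E" by (rule card_image_le[OF fE])
  also have "\<dots> = card (scalar_grid N :: 'a set) ^ d" unfolding E_def by (simp add: card_PiE)
  also have "\<dots> \<le> ((2 * N + 1)\<^sup>2) ^ d" by (intro power_mono scalar_grid_card) auto
  also have "\<dots> = (12 * d + 1) ^ (2 * d)" by (simp add: N_def power_mult)
  finally have card: "card G \<le> (12 * d + 1) ^ (2 * d)" .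
  show ?thesis
  proof (rule that[OF _ card])
    show "finite G" using fE by (simp add: G_def)
    show "g \<in> carrier_vec d \<and> rip g g \<le> 1" if "g \<in> G" for g using that by (auto simp: G_def)
    fix v :: "'a vec" assume v: "v \<in> carrier_vec d" "rip v v = 1"
    define g where "g = vec d (restrict (\<lambda>i. round_scalar N (v $ i)) {..<d})"
    have g: "g \<in> carrier_vec d" "\<And>i. i < d \<Longrightarrow> g $ i = round_scalar N (v $ i)" by (auto simp: g_def)
    have le1: "norm (v $ i) \<le> 1" if "i < d" for i
    proof -
      have "(norm (v $ i))\<^sup>2 \<le> (\<Sum>i<d. (norm (v $ i))\<^sup>2)" using that by (intro member_le_sum) auto
      also have "\<dots> = 1" using v rip_self[OF v(1)] by simp
      finally show ?thesis by (simp add: power_le_one_iff abs_square_le_1)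
    qed
    have "rip g g \<le> rip v v"
      unfolding rip_self[OF g(1)] rip_self[OF v(1)] using g(2) round_scalar_norm_le[OF N]
      by (intro sum_mono power_mono) auto
    moreover have "g \<in> vec d ` E"
      unfolding g_def E_def
      by (intro imageI, unfold restrict_PiE_iff) (use le1 in \<open>auto intro!: round_scalar_in_grid\<close>)
    ultimately have "g \<in> G" using v by (simp add: G_def)
    moreover have "rip (v - g) (v - g) \<le> 1 / 16"
    proof -
      have c: "v - g \<in> carrier_vec d" using g v by simp
      have "rip (v - g) (v - g) = (\<Sum>i<d. (norm (v $ i - round_scalar N (v $ i)))\<^sup>2)"
        unfolding rip_self[OF c] using g v by (intro sum.cong refl) auto
      also have "\<dots> \<le> (\<Sum>i<d. 2 / (real N)\<^sup>2)" by (intro sum_mono round_scalar_error[OF N])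
      also have "\<dots> = 1 / (18 * real d)" using d by (simp add: N_def power2_eq_square)
      also have "\<dots> \<le> 1 / 16" using d by (simp add: field_simps)
      finally show ?thesis .
    qed
    ultimately show "\<exists>g\<in>G. rip (v - g) (v - g) \<le> 1 / 16" by blast
  qed
qed

lemma bilin_diff_of_squares:
  assumes "bilin_on d B" "u \<in> carrier_vec d" "v \<in> carrier_vec d"
  shows "B u u - B v v = B (u - v) (u + v)"
  using assms bilin_commute[OF assms]
  by (simp add: bilin_diff_left[of d B] bilin_add_right[of d B])

lemma vec_l2_norm_sum_le2:
  assumes "u \<in> carrier_vec d" "v \<in> carrier_vec d" "rip u u \<le> 1" "rip v v \<le> 1"
  shows "vec_l2_norm (u + v) \<le> 2"
proof -
  have "rip (u + v) (u + v) + rip (u - v) (u - v) \<le> 4"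
    using bilin_parallelogram[OF bilin_on_rip assms(1,2)] assms by simp
  then have "rip (u + v) (u + v) \<le> 4" using rip_self_nonneg[of "u - v"] by linarith
  then have "sqrt (rip (u + v) (u + v)) \<le> sqrt 4" by (rule real_sqrt_le_mono)
  then show ?thesis by (simp add: vec_l2_norm_eq)
qed

text \<open>Let \<open>K\<close> be the supremum of \<open>|B v v|\<close> over the sphere. Moving \<open>v\<close> to the nearest net point changes \<open>B v v\<close> by
  at most \<open>K / 2\<close>, so \<open>K \<le> \<tau> + K / 2\<close>; the hypothesis \<open>M\<close> is there to make \<open>K\<close> finite. Because the error is
  measured against \<open>K\<close>, the fineness of the net does not depend on \<open>\<tau>\<close>.\<close>

lemma bilin_net_bound:
  fixes G :: "'a::real_or_complex vec set"
  assumes d: "0 < d" and B: "bilin_on d B"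
    and bdd: "\<And>v. v \<in> carrier_vec d \<Longrightarrow> rip v v = 1 \<Longrightarrow> \<bar>B v v\<bar> \<le> M"
    and G: "\<And>g. g \<in> G \<Longrightarrow> g \<in> carrier_vec d \<and> rip g g \<le> 1"
      "\<And>v. v \<in> carrier_vec d \<Longrightarrow> rip v v = 1 \<Longrightarrow> \<exists>g\<in>G. rip (v - g) (v - g) \<le> 1 / 16"
    and tau: "\<And>g. g \<in> G \<Longrightarrow> \<bar>B g g\<bar> \<le> \<tau>"
    and z: "z \<in> carrier_vec d"
  shows "\<bar>B z z\<bar> \<le> 2 * \<tau> * rip z z"
proof -
  define S where "S = ({v \<in> carrier_vec d. rip v v = 1} :: 'a vec set)"
  define K where "K = (SUP v\<in>S. \<bar>B v v\<bar>)"
  have "unit_vec d 0 \<in> S" using d by (simp add: S_def)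
  then have S_ne: "S \<noteq> {}" by blast
  have "bdd_above ((\<lambda>v. \<bar>B v v\<bar>) ` S)" by (intro bdd_aboveI[of _ M]) (auto simp: S_def bdd)
  then have K: "\<bar>B v v\<bar> \<le> K" if "v \<in> S" for v unfolding K_def using that by (intro cSUP_upper)
  have scale: "\<bar>B v v\<bar> \<le> c * rip v v" if c: "\<And>w. w \<in> S \<Longrightarrow> \<bar>B w w\<bar> \<le> c" and v: "v \<in> carrier_vec d" for c v
  proof -
    obtain w where w: "w \<in> carrier_vec d" "rip w w = 1" "v = of_real (sqrt (rip v v)) \<cdot>\<^sub>v w"
      using unit_direction[OF d v] .
    have "B v v = (norm (of_real (sqrt (rip v v)) :: 'a))\<^sup>2 * B w w"
      using bilin_smult[OF B w(1) w(1)] w(3) by metis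
    then have "\<bar>B v v\<bar> = rip v v * \<bar>B w w\<bar>" by (simp add: abs_mult)
    also have "\<dots> \<le> rip v v * c" using c[of w] w by (intro mult_left_mono) (auto simp: S_def)
    finally show ?thesis by (simp add: mult.commute)
  qed
  have K0: "0 \<le> K" using K[OF \<open>unit_vec d 0 \<in> S\<close>] by linarith
  have "\<bar>B v v\<bar> \<le> \<tau> + K / 2" if "v \<in> S" for v
  proof -
    have v: "v \<in> carrier_vec d" "rip v v = 1" using that by (auto simp: S_def)
    obtain g where g: "g \<in> G" "rip (v - g) (v - g) \<le> 1 / 16" using G(2)[OF v] by blast
    have gc: "g \<in> carrier_vec d" "rip g g \<le> 1" using G(1)[OF g(1)] by auto
    have "\<bar>B (v - g) (v + g)\<bar> \<le> K * (vec_l2_norm (v - g) * vec_l2_norm (v + g))"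
      using v gc by (intro bilin_bound[OF B] scale K) auto
    also have "\<dots> \<le> K * (1 / 4 * 2)"
    proof (intro mult_left_mono mult_mono K0)
      have "sqrt (rip (v - g) (v - g)) \<le> sqrt ((1 / 4)\<^sup>2)"
        using g(2) by (intro real_sqrt_le_mono) (simp add: power2_eq_square)
      then show "vec_l2_norm (v - g) \<le> 1 / 4" by (simp only: vec_l2_norm_eq real_sqrt_abs)
      show "vec_l2_norm (v + g) \<le> 2" using v gc by (intro vec_l2_norm_sum_le2[of _ d]) auto
    qed auto
    finally have "\<bar>B (v - g) (v + g)\<bar> \<le> K / 2" by simp
    then show ?thesis using tau[OF g(1)] bilin_diff_of_squares[OF B v(1) gc(1)] by linarith
  qed
  then have "K \<le> \<tau> + K / 2" unfolding K_def[symmetric] using S_ne by (subst K_def) (rule cSUP_least)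
  then have "K \<le> 2 * \<tau>" by simp
  then show ?thesis using K by (intro scale z) force
qed

section \<open>Perturbation of the top eigenvector\<close>

text \<open>A form of Davis and Kahan's bound. After rotating the phase of \<open>x\<close> so that its product with \<open>v\<close> is a real
  \<open>t \<ge> 0\<close>, the difference \<open>B v v - B x x\<close> is \<open>B (v - x) (v + x)\<close>, hence at most \<open>2 K sqrt (1 - t\<^sup>2)\<close>, whereas
  the gap makes it at least \<open>g (1 - t\<^sup>2)\<close>.\<close>

lemma top_vector_perturbation:
  fixes x v :: "'a::real_or_complex vec"
  assumes B: "bilin_on d B" and K: "\<And>z. z \<in> carrier_vec d \<Longrightarrow> \<bar>B z z\<bar> \<le> K * rip z z"
    and x: "x \<in> carrier_vec d" "rip x x = 1" and v: "v \<in> carrier_vec d" "rip v v = 1"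
    and g: "g > 0" and gap: "g * (1 - (norm (v \<bullet>c x))\<^sup>2) \<le> B v v - B x x"
  shows "sqrt (1 - (norm (v \<bullet>c x))\<^sup>2) \<le> 2 * K / g"
proof -
  obtain c where c: "norm c = 1" "c * (x \<bullet>c v) = of_real (norm (x \<bullet>c v))" using ex_phase by blast
  define t where "t = norm (v \<bullet>c x)"
  have t: "norm (x \<bullet>c v) = t"
    unfolding t_def by (metis conjugate_cscalar_prod norm_conjugate x(1) v(1))
  define y where "y = c \<cdot>\<^sub>v x"
  have y: "y \<in> carrier_vec d" "rip y y = 1" using x c by (auto simp: y_def rip_smult_smult[of _ d])
  have yv: "rip y v = t" "rip v y = t"
  proof -
    have "y \<bullet>c v = of_real t" using x v c t by (simp add: y_def)
    then show "rip y v = t" by (simp add: rip_def)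
    then show "rip v y = t" using rip_commute[OF y(1) v(1)] by simp
  qed
  have t1: "t\<^sup>2 \<le> 1" using norm_cscalar_prod_le[OF v(1) x(1)] x v by (simp add: t_def)
  have B0: "B y y = B x x" unfolding y_def using bilin_smult[OF B x(1) x(1), of c] c by simp
  have "B v v - B x x = B (v - y) (v + y)" using bilin_diff_of_squares[OF B v(1) y(1)] B0 by simp
  also have "\<dots> \<le> K * (vec_l2_norm (v - y) * vec_l2_norm (v + y))"
    using bilin_bound[OF B K, of "v - y" "v + y"] v y by simp
  also have "vec_l2_norm (v - y) * vec_l2_norm (v + y) = sqrt ((2 - 2 * t) * (2 + 2 * t))"
    using v y yv by (simp add: vec_l2_norm_eq real_sqrt_mult rip_diff_left[of _ d] rip_diff_right[of _ d]
        rip_add_left[of _ d] rip_add_right[of _ d])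
  also have "(2 - 2 * t) * (2 + 2 * t) = 2\<^sup>2 * (1 - t\<^sup>2)" by (simp add: algebra_simps power2_eq_square)
  also have "sqrt \<dots> = 2 * sqrt (1 - t\<^sup>2)" by (simp only: real_sqrt_mult real_sqrt_abs)
  finally have *: "g * (1 - t\<^sup>2) \<le> K * (2 * sqrt (1 - t\<^sup>2))" using gap by (simp add: t_def)
  define s where "s = sqrt (1 - t\<^sup>2)"
  have s: "0 \<le> s" "s * s = 1 - t\<^sup>2" using t1 by (auto simp: s_def)
  have K0: "0 \<le> K" using K[OF x(1)] x by simp
  have "s \<le> 2 * K / g"
  proof (cases "s = 0")
    case True then show ?thesis using K0 g by simp
  next
    case False
    then have "s > 0" using s by simp
    moreover have "g * s * s \<le> 2 * K * s" using * s unfolding s_def[symmetric] by (simp add: mult_ac)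
    ultimately have "g * s \<le> 2 * K" by simp
    then show ?thesis using g by (simp add: field_simps)
  qed
  then show ?thesis by (simp add: s_def t_def)
qed

text \<open>Nonnegativity of the Gram determinant of \<open>u\<close>, \<open>v\<close>, \<open>x\<close>, proved by Cauchy-Schwarz for the components of \<open>u\<close>
  and \<open>x\<close> orthogonal to \<open>v\<close>.\<close>

lemma cscalar_unit_Bessel:
  fixes x v u :: "'a::real_or_complex vec"
  assumes x: "x \<in> carrier_vec d" "rip x x = 1" and v: "v \<in> carrier_vec d" "rip v v = 1"
    and u: "u \<in> carrier_vec d"
  shows "rip ((u \<bullet>c v) \<cdot>\<^sub>v v - (u \<bullet>c x) \<cdot>\<^sub>v x) ((u \<bullet>c v) \<cdot>\<^sub>v v - (u \<bullet>c x) \<cdot>\<^sub>v x)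
    \<le> (1 - (norm (v \<bullet>c x))\<^sup>2) * rip u u"
proof -
  define a where "a = u \<bullet>c v"
  define b where "b = u \<bullet>c x"
  define h where "h = v \<bullet>c x"
  define y where "y = x - (conjugate h) \<cdot>\<^sub>v v"
  define w where "w = u - a \<cdot>\<^sub>v v"
  have c: "y \<in> carrier_vec d" "w \<in> carrier_vec d" using x v u by (auto simp: y_def w_def)
  have xv: "x \<bullet>c v = conjugate h" unfolding h_def using conjugate_cscalar_prod[OF v(1) x(1)] by simp
  have yv: "y \<bullet>c v = 0" using x v xv by (simp add: y_def minus_scalar_prod_distrib[of _ d] cscalar_prod_self)
  have wv: "w \<bullet>c v = 0" using u v by (simp add: w_def minus_scalar_prod_distrib[of _ d] cscalar_prod_self a_def)
  have pyth: "rip (p + k \<cdot>\<^sub>v v) (p + k \<cdot>\<^sub>v v) = rip p p + (norm k)\<^sup>2"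
    if "p \<in> carrier_vec d" "p \<bullet>c v = 0" for p k
  proof -
    have "v \<bullet>c p = 0" using conjugate_cscalar_prod[OF that(1) v(1)] that by simp
    then have "(k \<cdot>\<^sub>v v) \<bullet>c p = 0" using that v by simp
    then have "rip (k \<cdot>\<^sub>v v) p = 0" by (simp add: rip_def)
    then show ?thesis
      using that v rip_commute[of "k \<cdot>\<^sub>v v" d p]
      by (simp add: rip_add_left[of _ d] rip_add_right[of _ d] rip_smult_smult[of _ d])
  qed
  have u_eq: "u = w + a \<cdot>\<^sub>v v" and x_eq: "x = y + conjugate h \<cdot>\<^sub>v v"
    using u v x by (auto simp: w_def y_def intro!: eq_vecI)
  have ru: "rip u u = rip w w + (norm a)\<^sup>2" using pyth[OF c(2) wv, of a] u_eq by simp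
  have ry: "rip y y = 1 - (norm h)\<^sup>2" using pyth[OF c(1) yv, of "conjugate h"] x_eq x by simp
  have wy: "w \<bullet>c y = b - a * h"
  proof -
    have "y \<bullet>c w = x \<bullet>c w - conjugate h * (v \<bullet>c w)"
      using x v c by (subst (1) y_def) (simp add: minus_scalar_prod_distrib[of _ d])
    also have "v \<bullet>c w = 0" using conjugate_cscalar_prod[OF c(2) v(1)] wv by simp
    finally have "w \<bullet>c y = w \<bullet>c x" using conjugate_cscalar_prod[OF c(1) c(2)] conjugate_cscalar_prod[OF x(1) c(2)] by simp
    also have "\<dots> = b - a * h" using u v x by (simp add: w_def minus_scalar_prod_distrib[of _ d] b_def h_def)
    finally show ?thesis .
  qed
  have "a \<cdot>\<^sub>v v - b \<cdot>\<^sub>v x = (- b) \<cdot>\<^sub>v y + (a - b * conjugate h) \<cdot>\<^sub>v v"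
    using x v by (intro eq_vecI) (auto simp: y_def algebra_simps)
  then have "rip (a \<cdot>\<^sub>v v - b \<cdot>\<^sub>v x) (a \<cdot>\<^sub>v v - b \<cdot>\<^sub>v x) = rip ((- b) \<cdot>\<^sub>v y) ((- b) \<cdot>\<^sub>v y) + (norm (a - b * conjugate h))\<^sup>2"
    using pyth[of "(- b) \<cdot>\<^sub>v y" "a - b * conjugate h"] c v yv by simp
  also have "\<dots> = (norm b)\<^sup>2 * (1 - (norm h)\<^sup>2) + (norm (a - b * conjugate h))\<^sup>2"
    unfolding rip_smult_smult[OF c(1) c(1)] ry by simp
  also have "\<dots> = (norm a)\<^sup>2 * (1 - (norm h)\<^sup>2) + (norm (b - a * h))\<^sup>2"
  proof -
    \<comment> \<open>both sides equal |a|^2 + |b|^2 - 2 Re (a h conj b)\<close>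
    have sq: "(norm (p - q))\<^sup>2 = (norm p)\<^sup>2 + (norm q)\<^sup>2 - 2 * inner p q" for p q :: 'a
      by (simp add: power2_norm_eq_inner inner_diff inner_commute)
    have "inner a (b * conjugate h) = inner (a * h) b"
      using inner_mult_left[of h a b] by (simp add: mult.commute)
    then show ?thesis unfolding sq by (simp add: norm_mult power_mult_distrib inner_commute algebra_simps)
  qed
  also have "(norm (b - a * h))\<^sup>2 \<le> rip w w * (1 - (norm h)\<^sup>2)"
    using norm_cscalar_prod_le[OF c(2) c(1)] unfolding wy ry .
  finally show ?thesis unfolding ru by (simp add: a_def b_def h_def algebra_simps)
qed

text \<open>The norm is the sine of the angle between the lines. It is attained at \<open>x\<close>. The exact value, rather
  than an upper bound, shows that the recovery event depends continuously on the candidate line.\<close>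

lemma op_norm_outer_diff:
  fixes x v :: "'a::real_or_complex vec"
  assumes x: "x \<in> carrier_vec d" "rip x x = 1" and v: "v \<in> carrier_vec d" "rip v v = 1"
  shows "op_norm (outer v - outer x) = sqrt (1 - (norm (v \<bullet>c x))\<^sup>2)"
proof -
  let ?A = "outer v - outer x" and ?s = "1 - (norm (v \<bullet>c x))\<^sup>2"
  let ?U = "{u \<in> carrier_vec d. vec_l2_norm u \<le> 1} :: 'a vec set"
  have s0: "0 \<le> ?s" using norm_cscalar_prod_le[OF v(1) x(1)] x v by simp
  have dim: "dim_col ?A = d" using x by simp
  have act: "?A *\<^sub>v u = (u \<bullet>c v) \<cdot>\<^sub>v v - (u \<bullet>c x) \<cdot>\<^sub>v x" if "u \<in> carrier_vec d" for u
    using that x v by (simp add: minus_mult_distrib_mat_vec[of _ d d] outer_mult_vec[of _ d])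
  have le: "vec_l2_norm (?A *\<^sub>v u) \<le> sqrt ?s" if "u \<in> ?U" for u
  proof -
    have u: "u \<in> carrier_vec d" "rip u u \<le> 1" using that by (auto simp: vec_l2_norm_eq)
    have "rip (?A *\<^sub>v u) (?A *\<^sub>v u) \<le> ?s * rip u u"
      unfolding act[OF u(1)] by (rule cscalar_unit_Bessel[OF x v u(1)])
    also have "\<dots> \<le> ?s" using u s0 by (simp add: mult_left_le)
    finally show ?thesis by (simp add: vec_l2_norm_eq)
  qed
  have xU: "x \<in> ?U" using x by (simp add: vec_l2_norm_eq)
  have eq: "vec_l2_norm (?A *\<^sub>v x) = sqrt ?s"
  proof -
    have xx: "x \<bullet>c x = 1" using x by (simp add: cscalar_prod_self)
    have c: "(x \<bullet>c v) \<cdot>\<^sub>v v \<in> carrier_vec d" using v by simp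
    have "rip ((x \<bullet>c v) \<cdot>\<^sub>v v) x = (norm (x \<bullet>c v))\<^sup>2"
    proof -
      have "((x \<bullet>c v) \<cdot>\<^sub>v v) \<bullet>c x = (x \<bullet>c v) * conjugate (x \<bullet>c v)"
        using v x conjugate_cscalar_prod[OF x(1) v(1)] by simp
      then show ?thesis unfolding rip_def by (simp only: mult_conjugate inner_of_real_1)
    qed
    then have "rip (?A *\<^sub>v x) (?A *\<^sub>v x) = ?s"
      using x v c rip_commute[OF c x(1)] unfolding act[OF x(1)] xx
      by (simp add: rip_diff_left[of _ d] rip_diff_right[of _ d] rip_smult_smult[of _ d])
        (metis conjugate_cscalar_prod norm_conjugate)
    then show ?thesis by (simp add: vec_l2_norm_eq)
  qed
  have bdd: "bdd_above ((\<lambda>u. vec_l2_norm (?A *\<^sub>v u)) ` ?U)"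
    using le by (intro bdd_aboveI[of _ "sqrt ?s"]) auto
  show ?thesis
    unfolding op_norm_def dim
  proof (rule antisym)
    show "(SUP u\<in>?U. vec_l2_norm (?A *\<^sub>v u)) \<le> sqrt ?s"
      using xU le by (intro cSUP_least) blast+
    show "sqrt ?s \<le> (SUP u\<in>?U. vec_l2_norm (?A *\<^sub>v u))"
      unfolding eq[symmetric] by (rule cSUP_upper[OF xU bdd])
  qed
qed

section \<open>Solutions of the principal eigenspace program\<close>

definition herm :: "nat \<Rightarrow> 'a::real_or_complex mat \<Rightarrow> bool" where
  "herm d A \<longleftrightarrow> A \<in> carrier_mat d d \<and> mat_adjoint A = A"

lemma herm_rip_symm:
  assumes "herm d A" "v \<in> carrier_vec d" "w \<in> carrier_vec d"
  shows "rip (A *\<^sub>v v) w = rip v (A *\<^sub>v w)"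
  using rip_adjoint[of A d d v w] assms by (simp add: herm_def)

lemma herm_quad_real:
  assumes "herm d A" "v \<in> carrier_vec d"
  shows "(A *\<^sub>v v) \<bullet>c v = of_real (rip (A *\<^sub>v v) v)"
proof -
  have Av: "A *\<^sub>v v \<in> carrier_vec d" using assms by (auto simp: herm_def)
  have "conjugate ((A *\<^sub>v v) \<bullet>c v) = v \<bullet>c (A *\<^sub>v v)" by (rule conjugate_cscalar_prod[OF Av assms(2)])
  also have "\<dots> = (A *\<^sub>v v) \<bullet>c v" using cscalar_prod_adjoint[of A d d v v] assms by (simp add: herm_def)
  finally show ?thesis unfolding rip_def by (rule selfconj_eq_of_real)
qed

lemma psd_mats_iff:
  "A \<in> psd_mats d \<longleftrightarrow> herm d A \<and> (\<forall>v \<in> carrier_vec d. 0 \<le> rip (A *\<^sub>v v) v)"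
proof -
  have "(\<forall>v \<in> carrier_vec d. 0 \<le> (A *\<^sub>v v) \<bullet>c v) \<longleftrightarrow> (\<forall>v \<in> carrier_vec d. 0 \<le> rip (A *\<^sub>v v) v)" if "herm d A"
    using herm_quad_real[OF that] by simp
  then show ?thesis unfolding psd_mats_def herm_def by auto
qed

lemma herm_outer [simp]: "v \<in> carrier_vec d \<Longrightarrow> herm d (outer v)"
  by (simp add: herm_def)

lemma herm_diff: "herm d A \<Longrightarrow> herm d B \<Longrightarrow> herm d (A - B)"
  by (auto simp: herm_def mat_adjoint_diff[of _ d d])

lemma rip_outer_mult:
  assumes "v \<in> carrier_vec d" "w \<in> carrier_vec d"
  shows "rip (outer v *\<^sub>v w) w = (norm (w \<bullet>c v))\<^sup>2"
proof -
  have "(outer v *\<^sub>v w) \<bullet>c w = (w \<bullet>c v) * conjugate (w \<bullet>c v)"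
    using assms conjugate_cscalar_prod[OF assms(2,1)] by (simp add: outer_mult_vec[of _ d])
  then show ?thesis unfolding rip_def by (simp only: mult_conjugate inner_of_real_1)
qed

lemma outer_psd: "v \<in> carrier_vec d \<Longrightarrow> outer v \<in> psd_mats d"
  by (simp add: psd_mats_iff rip_outer_mult)

lemma psd_null:
  assumes A: "A \<in> psd_mats d" and v: "v \<in> carrier_vec d" and z: "rip (A *\<^sub>v v) v = 0"
  shows "A *\<^sub>v v = 0\<^sub>v d"
proof -
  have h: "herm d A" and Ac: "A \<in> carrier_mat d d" and pos: "\<And>u. u \<in> carrier_vec d \<Longrightarrow> 0 \<le> rip (A *\<^sub>v u) u"
    using A by (auto simp: psd_mats_iff herm_def)
  define w where "w = A *\<^sub>v v"
  have w: "w \<in> carrier_vec d" using Ac v by (simp add: w_def)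
  define a where "a = rip (A *\<^sub>v w) w"
  have a: "0 \<le> a" using pos[OF w] by (simp add: a_def)
  have Aw: "A *\<^sub>v w \<in> carrier_vec d" using Ac w by simp
  \<comment> \<open>the form at \<open>v + t w\<close> is a nonnegative polynomial in \<open>t\<close> without constant term, so its linear coefficient vanishes\<close>
  have form: "0 \<le> 2 * t * rip w w + t\<^sup>2 * a" for t
  proof -
    let ?u = "v + of_real t \<cdot>\<^sub>v w"
    have u: "?u \<in> carrier_vec d" using v w by simp
    have "A *\<^sub>v ?u = w + of_real t \<cdot>\<^sub>v (A *\<^sub>v w)"
      using Ac v w by (simp add: mult_add_distrib_mat_vec[of _ d d] mult_mat_vec[of _ d d] w_def)
    moreover have "rip (A *\<^sub>v w) v = rip w w" using herm_rip_symm[OF h w v] by (simp add: w_def)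
    moreover have "rip w v = 0" using z by (simp add: w_def)
    ultimately have "rip (A *\<^sub>v ?u) ?u = 2 * t * rip w w + t\<^sup>2 * a"
      using v w Aw by (simp add: rip_add_left[of _ d] rip_add_right[of _ d] rip_of_real_left[of _ d]
          rip_of_real_right[of _ d] a_def power2_eq_square algebra_simps)
    then show ?thesis using pos[OF u] by simp
  qed
  have "rip w w = 0"
  proof (rule ccontr)
    assume "rip w w \<noteq> 0"
    then have r: "rip w w > 0" using rip_self_nonneg[of w] by linarith
    define b where "b = a + 1"
    have b: "b > 0" "a - 2 * b < 0" using a by (auto simp: b_def)
    have "0 \<le> 2 * (- (rip w w / b)) * rip w w + (- (rip w w / b))\<^sup>2 * a" by (rule form)
    also have "\<dots> = (rip w w)\<^sup>2 * (a - 2 * b) / b\<^sup>2"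
      using b by (simp add: power2_eq_square field_simps)
    also have "\<dots> < 0"
      using b r by (intro divide_neg_pos mult_pos_neg) auto
    finally show False by simp
  qed
  then show ?thesis using rip_self_eq_0[OF w] by (simp add: w_def)
qed

lemma psd_diag:
  assumes "herm d A" "i < d"
  shows "A $$ (i, i) = of_real (rip (A *\<^sub>v unit_vec d i) (unit_vec d i))"
proof -
  have A: "A \<in> carrier_mat d d" using assms by (simp add: herm_def)
  have "(A *\<^sub>v unit_vec d i) \<bullet>c unit_vec d i = A $$ (i, i)"
    using assms A by (simp add: cscalar_prod_sum[of _ d] unit_vec_def if_distrib[of conjugate] if_distrib[of "\<lambda>z. _ * z"] cong: if_cong)
      (simp add: scalar_prod_def if_distrib[of "\<lambda>z. _ * z"] cong: if_cong)
  then show ?thesis using herm_quad_real[OF assms(1), of "unit_vec d i"] by simp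
qed

lemma mat_trace_mult_outer:
  assumes "A \<in> carrier_mat d d" "v \<in> carrier_vec d"
  shows "mat_trace (A * outer v) = (A *\<^sub>v v) \<bullet>c v"
proof -
  have "mat_trace (A * outer v) = (\<Sum>i<d. \<Sum>j<d. A $$ (i, j) * (v $ j * conjugate (v $ i)))"
    using assms by (auto simp: mat_trace_def scalar_prod_def atLeast0LessThan intro!: sum.cong)
  also have "\<dots> = (A *\<^sub>v v) \<bullet>c v"
    using assms by (simp add: cscalar_prod_sum[of _ d] mult_mat_vec_sum[of A d d] sum_distrib_right mult.assoc
        del: index_mult_mat_vec)
  finally show ?thesis .
qed

text \<open>Write \<open>Z\<close> as a sum of matrices \<open>outer y\<close> by Cholesky elimination: subtracting the one that clears a nonzero
  diagonal entry keeps \<open>Z\<close> positive semidefinite and creates no new nonzero diagonal entry. For a single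
  summand the trace is the quadratic form of \<open>A\<close> at \<open>y\<close>.\<close>

lemma psd_trace_mult_nonneg:
  fixes A Z :: "'a::real_or_complex mat"
  assumes A: "A \<in> psd_mats d" and Z: "Z \<in> psd_mats d"
  shows "0 \<le> mat_trace (A * Z)"
  using Z
proof (induction "card {i. i < d \<and> Z $$ (i, i) \<noteq> 0}" arbitrary: Z rule: less_induct)
  case less
  have Ac: "A \<in> carrier_mat d d" using A by (simp add: psd_mats_iff herm_def)
  have Z: "herm d Z" "Z \<in> carrier_mat d d" "\<And>v. v \<in> carrier_vec d \<Longrightarrow> 0 \<le> rip (Z *\<^sub>v v) v"
    using less.prems by (auto simp: psd_mats_iff herm_def)
  show ?case
  proof (cases "\<exists>k<d. Z $$ (k, k) \<noteq> 0")
    case False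
    have "Z = 0\<^sub>m d d"
    proof (rule eq_matI)
      fix i j assume ij: "i < dim_row (0\<^sub>m d d :: 'a mat)" "j < dim_col (0\<^sub>m d d :: 'a mat)"
      then have "rip (Z *\<^sub>v unit_vec d j) (unit_vec d j) = 0"
        using False psd_diag[OF Z(1), of j] by auto
      then have "Z *\<^sub>v unit_vec d j = 0\<^sub>v d" by (intro psd_null[OF less.prems]) auto
      then have "(Z *\<^sub>v unit_vec d j) $ i = 0" using ij by simp
      then show "Z $$ (i, j) = 0\<^sub>m d d $$ (i, j)" using ij Z(2) by simp
    qed (use Z in auto)
    then show ?thesis using Ac by (simp add: mat_trace_def)
  next
    case True
    then obtain k where k: "k < d" "Z $$ (k, k) \<noteq> 0" by blast
    define e :: "'a vec" where "e = unit_vec d k"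
    define q where "q = rip (Z *\<^sub>v e) e"
    have e: "e \<in> carrier_vec d" by (simp add: e_def)
    have Zkk: "Z $$ (k, k) = of_real q" using psd_diag[OF Z(1) k(1)] by (simp add: q_def e_def)
    have q: "q > 0" using Z(3)[OF e] k(2) Zkk by (auto simp: q_def[symmetric] less_le)
    define y where "y = of_real (1 / sqrt q) \<cdot>\<^sub>v (Z *\<^sub>v e)"
    have Ze: "Z *\<^sub>v e \<in> carrier_vec d" using Z(2) e by simp
    have y: "y \<in> carrier_vec d" using Ze by (simp add: y_def)
    define Z' where "Z' = Z - outer y"
    have vy: "(norm (v \<bullet>c y))\<^sup>2 = (norm ((Z *\<^sub>v v) \<bullet>c e))\<^sup>2 / q" if v: "v \<in> carrier_vec d" for v
    proof -
      have "v \<bullet>c y = of_real (1 / sqrt q) * (v \<bullet>c (Z *\<^sub>v e))"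
        using v Ze by (simp add: y_def conjugate_smult_vec del: of_real_divide)
      also have "v \<bullet>c (Z *\<^sub>v e) = (Z *\<^sub>v v) \<bullet>c e"
        using cscalar_prod_adjoint[OF Z(2) v e] Z(1) by (simp add: herm_def)
      finally show ?thesis using q by (simp add: norm_mult norm_divide power_divide)
    qed
    have Z'psd: "Z' \<in> psd_mats d"
      unfolding psd_mats_iff
    proof (intro conjI ballI)
      show "herm d Z'" unfolding Z'_def using Z y by (intro herm_diff) auto
      fix v :: "'a vec" assume v: "v \<in> carrier_vec d"
      \<comment> \<open>the new form at \<open>v\<close> is the old form at \<open>v - t e\<close>, with \<open>t\<close> chosen to minimize the latter\<close>
      define s where "s = (Z *\<^sub>v v) \<bullet>c e"
      define t where "t = s / of_real q"
      define u where "u = v - t \<cdot>\<^sub>v e"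
      have u: "u \<in> carrier_vec d" using v e by (simp add: u_def)
      have te: "t \<cdot>\<^sub>v e \<in> carrier_vec d" using e by simp
      have Zv: "Z *\<^sub>v v \<in> carrier_vec d" "Z *\<^sub>v (t \<cdot>\<^sub>v e) \<in> carrier_vec d" using Z(2) v e by auto
      have c1: "rip (Z *\<^sub>v v) (t \<cdot>\<^sub>v e) = (norm s)\<^sup>2 / q"
      proof -
        have "(Z *\<^sub>v v) \<bullet>c (t \<cdot>\<^sub>v e) = conjugate t * s"
          using Zv e by (simp add: conjugate_smult_vec s_def)
        then have "rip (Z *\<^sub>v v) (t \<cdot>\<^sub>v e) = inner (s * conjugate t) 1"
          by (simp add: rip_def mult.commute)
        also have "\<dots> = inner s t" by (rule inner_eq_re[symmetric])
        also have "inner s t = inner s ((1 / q) *\<^sub>R s)" by (simp add: t_def scaleR_conv_of_real)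
        finally show ?thesis by (simp add: power2_norm_eq_inner)
      qed
      have c2: "rip (Z *\<^sub>v (t \<cdot>\<^sub>v e)) (t \<cdot>\<^sub>v e) = (norm s)\<^sup>2 / q"
      proof -
        have "Z *\<^sub>v (t \<cdot>\<^sub>v e) = t \<cdot>\<^sub>v (Z *\<^sub>v e)" using Z(2) e by (simp add: mult_mat_vec[of _ d d])
        then have "rip (Z *\<^sub>v (t \<cdot>\<^sub>v e)) (t \<cdot>\<^sub>v e) = (norm t)\<^sup>2 * q"
          using rip_smult_smult[OF Ze e] by (simp add: q_def)
        also have "\<dots> = (norm s)\<^sup>2 / q" using q by (simp add: t_def norm_divide power_divide power2_eq_square)
        finally show ?thesis .
      qed
      have "Z *\<^sub>v u = Z *\<^sub>v v - Z *\<^sub>v (t \<cdot>\<^sub>v e)"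
        unfolding u_def using Z(2) v te by (simp add: mult_minus_distrib_mat_vec[of _ d d])
      then have "rip (Z *\<^sub>v u) u = rip (Z *\<^sub>v v) v - (norm s)\<^sup>2 / q"
        using c1 c2 herm_rip_symm[OF Z(1) te v] Zv v te rip_commute[OF te Zv(1)]
        unfolding u_def by (simp add: rip_diff_left[of _ d] rip_diff_right[of _ d])
      moreover have "rip (Z' *\<^sub>v v) v = rip (Z *\<^sub>v v) v - rip (outer y *\<^sub>v v) v"
        unfolding Z'_def using Z(2) y v Zv mult_mat_vec_carrier[of "outer y" d d v]
        by (simp add: minus_mult_distrib_mat_vec[of _ d d] rip_diff_left[of _ d])
      moreover have "rip (outer y *\<^sub>v v) v = (norm s)\<^sup>2 / q"
        using rip_outer_mult[OF y v] vy[OF v] by (simp add: s_def)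
      ultimately show "0 \<le> rip (Z' *\<^sub>v v) v" using Z(3)[OF u] by simp
    qed
    have Z'c: "Z' \<in> carrier_mat d d" using Z'psd by (simp add: psd_mats_iff herm_def)
    have diag: "rip (Z' *\<^sub>v unit_vec d i) (unit_vec d i) = rip (Z *\<^sub>v unit_vec d i) (unit_vec d i) - (norm (y $ i))\<^sup>2" if "i < d" for i
    proof -
      have "Z' $$ (i, i) = Z $$ (i, i) - of_real ((norm (y $ i))\<^sup>2)"
        unfolding Z'_def using y Z(2) that by (simp add: mult_conjugate del: of_real_power)
      then have "(of_real (rip (Z' *\<^sub>v unit_vec d i) (unit_vec d i)) :: 'a)
          = of_real (rip (Z *\<^sub>v unit_vec d i) (unit_vec d i) - (norm (y $ i))\<^sup>2)"
        using psd_diag[of d Z' i] psd_diag[OF Z(1) that] Z'psd that by (simp only: psd_mats_iff of_real_diff simp_thms)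
      then show ?thesis by (simp only: of_real_eq_iff)
    qed
    have sub: "{i. i < d \<and> Z' $$ (i, i) \<noteq> 0} \<subseteq> {i. i < d \<and> Z $$ (i, i) \<noteq> 0} - {k}"
    proof
      fix i assume i: "i \<in> {i. i < d \<and> Z' $$ (i, i) \<noteq> 0}"
      then have id: "i < d" and nz: "rip (Z' *\<^sub>v unit_vec d i) (unit_vec d i) \<noteq> 0"
        using psd_diag[of d Z' i] Z'psd by (auto simp: psd_mats_iff)
      have "0 \<le> rip (Z' *\<^sub>v unit_vec d i) (unit_vec d i)" using Z'psd by (simp add: psd_mats_iff)
      then have "rip (Z *\<^sub>v unit_vec d i) (unit_vec d i) > 0"
        using nz diag[OF id] zero_le_power2[of "norm (y $ i)"] by linarith
      then have "Z $$ (i, i) \<noteq> 0" using psd_diag[OF Z(1) id] by auto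
      moreover have "i \<noteq> k"
      proof
        assume "i = k"
        have "y $ k = of_real (1 / sqrt q) * of_real q" using Z(2) k(1) Zkk by (simp add: y_def e_def)
        also have "\<dots> = of_real (1 / sqrt q * q)" by (simp only: of_real_mult)
        also have "1 / sqrt q * q = sqrt q" using q by (simp add: real_div_sqrt)
        finally have "(norm (y $ k))\<^sup>2 = q" using q by simp
        then show False using diag[OF k(1)] nz \<open>i = k\<close> by (simp add: q_def e_def)
      qed
      ultimately show "i \<in> {i. i < d \<and> Z $$ (i, i) \<noteq> 0} - {k}" using id by blast
    qed
    have "card {i. i < d \<and> Z' $$ (i, i) \<noteq> 0} < card {i. i < d \<and> Z $$ (i, i) \<noteq> 0}"
      using sub k by (intro psubset_card_mono) auto
    from less.hyps[OF this Z'psd] have IH: "0 \<le> mat_trace (A * Z')" .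
    have "Z = Z' + outer y" unfolding Z'_def using Z(2) y by (intro eq_matI) auto
    then have "mat_trace (A * Z) = mat_trace (A * Z') + mat_trace (A * outer y)"
      using Ac Z'c y by (simp add: mult_add_distrib_mat[of _ d d] mat_trace_add[of _ d])
    moreover have "0 \<le> mat_trace (A * outer y)"
      using A y unfolding mat_trace_mult_outer[OF Ac y] psd_mats_def by blast
    ultimately show ?thesis using IH by simp
  qed
qed

definition top_unit :: "nat \<Rightarrow> ('a::real_or_complex vec \<Rightarrow> real) \<Rightarrow> 'a vec \<Rightarrow> bool" where
  "top_unit d F v \<longleftrightarrow> v \<in> carrier_vec d \<and> rip v v = 1 \<and> (\<forall>w \<in> carrier_vec d. rip w w = 1 \<longrightarrow> F w \<le> F v)"

text \<open>The program for an arbitrary matrix in place of the average of the projections.\<close>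

definition principal :: "nat \<Rightarrow> 'a::real_or_complex mat \<Rightarrow> 'a mat \<Rightarrow> bool" where
  "principal d Q Y \<longleftrightarrow>
    Y \<in> pep_feasible d \<and>
        (\<forall>Z \<in> pep_feasible d. mat_trace (Q * Z) \<le> mat_trace (Q * Y)) \<and>
        Y \<in> Proj 1 d \<and>
        (\<exists>l. eigenvalue Q l \<and> (\<forall>k. eigenvalue Q k \<longrightarrow> k \<le> l) \<and>
             (\<forall>v \<in> carrier_vec d. Q *\<^sub>v (Y *\<^sub>v v) = l \<cdot>\<^sub>v (Y *\<^sub>v v)))"

lemma outer_feasible: "v \<in> carrier_vec d \<Longrightarrow> rip v v = 1 \<Longrightarrow> outer v \<in> pep_feasible d"
  by (simp add: pep_feasible_def outer_psd mat_trace_outer)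

text \<open>If \<open>v\<close> maximizes the form of \<open>Q\<close> on the sphere, with value \<open>l\<close>, then \<open>l - Q\<close> is positive semidefinite and its
  form vanishes at \<open>v\<close>, so \<open>v\<close> is an eigenvector. The trace of \<open>l - Q\<close> times a feasible matrix is nonnegative,
  which is optimality. Conversely the rank one matrices of unit vectors are feasible, so a solution can only
  come from a maximizer.\<close>

lemma principal_iff:
  fixes Q :: "'a::real_or_complex mat"
  assumes Q: "Q \<in> psd_mats d"
  shows "principal d Q Y \<longleftrightarrow> (\<exists>v. top_unit d (\<lambda>v. rip (Q *\<^sub>v v) v) v \<and> Y = outer v)"
proof
  have h: "herm d Q" and Qc: "Q \<in> carrier_mat d d" using Q by (auto simp: psd_mats_iff herm_def)
  have tr: "mat_trace (Q * outer w) = of_real (rip (Q *\<^sub>v w) w)" if "w \<in> carrier_vec d" for w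
    using mat_trace_mult_outer[OF Qc that] herm_quad_real[OF h that] by simp
  {
    assume Y: "principal d Q Y"
    then obtain v where v: "v \<in> carrier_vec d" "rip v v = 1" "Y = outer v"
      unfolding principal_def Proj_1_iff by blast
    have "rip (Q *\<^sub>v w) w \<le> rip (Q *\<^sub>v v) v" if w: "w \<in> carrier_vec d" "rip w w = 1" for w
    proof -
      have "mat_trace (Q * outer w) \<le> mat_trace (Q * outer v)"
        using Y outer_feasible[OF w] v(3) unfolding principal_def by blast
      then show ?thesis by (simp add: tr v w)
    qed
    then show "\<exists>v. top_unit d (\<lambda>v. rip (Q *\<^sub>v v) v) v \<and> Y = outer v"
      using v unfolding top_unit_def by blast
  }
  assume "\<exists>v. top_unit d (\<lambda>v. rip (Q *\<^sub>v v) v) v \<and> Y = outer v"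
  then obtain v where v: "v \<in> carrier_vec d" "rip v v = 1" and Y: "Y = outer v"
    and top: "\<And>w. w \<in> carrier_vec d \<Longrightarrow> rip w w = 1 \<Longrightarrow> rip (Q *\<^sub>v w) w \<le> rip (Q *\<^sub>v v) v"
    unfolding top_unit_def by blast
  define l where "l = rip (Q *\<^sub>v v) v"
  have l0: "0 \<le> l" using Q v by (simp add: l_def psd_mats_iff)
  have d: "0 < d"
  proof (rule ccontr)
    assume "\<not> 0 < d"
    then show False using v rip_self[OF v(1)] by simp
  qed
  define M where "M = of_real l \<cdot>\<^sub>m 1\<^sub>m d - Q"
  have Mc: "M \<in> carrier_mat d d" using Qc by (simp add: M_def minus_carrier_mat)
  have Mv: "M *\<^sub>v w = of_real l \<cdot>\<^sub>v w - Q *\<^sub>v w" if "w \<in> carrier_vec d" for w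
  proof -
    have "(of_real l \<cdot>\<^sub>m 1\<^sub>m d) *\<^sub>v w = of_real l \<cdot>\<^sub>v w"
      using that by (intro eq_vecI) (auto simp: mult_mat_vec_def row_smult)
    then show ?thesis unfolding M_def using Qc that by (simp add: minus_mult_distrib_mat_vec[of _ d d])
  qed
  have Mrip: "rip (M *\<^sub>v w) w = l * rip w w - rip (Q *\<^sub>v w) w" if "w \<in> carrier_vec d" for w
    unfolding Mv[OF that] using that Qc mult_mat_vec_carrier[OF Qc that]
    by (simp add: rip_diff_left[of _ d] rip_of_real_left[of _ d])
  have M: "M \<in> psd_mats d"
    unfolding psd_mats_iff
  proof (intro conjI ballI)
    have "herm d (of_real l \<cdot>\<^sub>m 1\<^sub>m d :: 'a mat)"
      by (auto simp: herm_def intro!: eq_matI)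
    then show "herm d M" unfolding M_def using h by (rule herm_diff)
    fix w :: "'a vec" assume w: "w \<in> carrier_vec d"
    obtain z where z: "z \<in> carrier_vec d" "rip z z = 1" "w = of_real (sqrt (rip w w)) \<cdot>\<^sub>v z"
      using unit_direction[OF d w] .
    have "rip (Q *\<^sub>v (c \<cdot>\<^sub>v z)) (c \<cdot>\<^sub>v z) = (norm c)\<^sup>2 * rip (Q *\<^sub>v z) z" for c
      using Qc z mult_mat_vec_carrier[OF Qc z(1)] by (simp add: mult_mat_vec[of _ d d] rip_smult_smult[of _ d])
    then have "rip (Q *\<^sub>v w) w = (norm (of_real (sqrt (rip w w)) :: 'a))\<^sup>2 * rip (Q *\<^sub>v z) z"
      using z(3) by metis
    also have "\<dots> = rip w w * rip (Q *\<^sub>v z) z" by simp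
    also have "\<dots> \<le> rip w w * l" using top[OF z(1,2)] by (intro mult_left_mono) (auto simp: l_def)
    finally show "0 \<le> rip (M *\<^sub>v w) w" unfolding Mrip[OF w] by (simp add: mult.commute)
  qed
  have "M *\<^sub>v v = 0\<^sub>v d" by (rule psd_null[OF M v(1)]) (simp add: Mrip[OF v(1)] v l_def)
  have Qv: "Q *\<^sub>v v = of_real l \<cdot>\<^sub>v v"
  proof -
    have "Q *\<^sub>v v = of_real l \<cdot>\<^sub>v v - (of_real l \<cdot>\<^sub>v v - Q *\<^sub>v v)"
      using v mult_mat_vec_carrier[OF Qc v(1)] by (intro eq_vecI) auto
    also have "\<dots> = of_real l \<cdot>\<^sub>v v" using \<open>M *\<^sub>v v = 0\<^sub>v d\<close> v by (simp add: Mv[OF v(1), symmetric])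
    finally show ?thesis .
  qed
  have v0: "v \<noteq> 0\<^sub>v d" using rip_self_eq_0[OF v(1)] v(2) by auto
  show "principal d Q Y"
    unfolding principal_def
  proof (intro conjI ballI)
    show "Y \<in> pep_feasible d" using outer_feasible v Y by blast
    show "Y \<in> Proj 1 d" using v Y Proj_1_iff by blast
    fix Z :: "'a mat" assume "Z \<in> pep_feasible d"
    then have Z: "Z \<in> psd_mats d" "mat_trace Z \<le> 1" "Z \<in> carrier_mat d d" "herm d Z"
      by (auto simp: pep_feasible_def psd_mats_iff herm_def)
    obtain t where t: "mat_trace Z = of_real t"
    proof -
      have "mat_trace Z = of_real (\<Sum>i<d. rip (Z *\<^sub>v unit_vec d i) (unit_vec d i))"
        using Z psd_diag[OF Z(4)] by (simp add: mat_trace_def)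
      then show ?thesis using that by blast
    qed
    have "M * Z = of_real l \<cdot>\<^sub>m Z - Q * Z"
      unfolding M_def using Z(3) Qc by (simp add: minus_mult_distrib_mat[of _ d d] mult_smult_assoc_mat[of _ d d])
    then have "mat_trace (M * Z) = of_real l * mat_trace Z - mat_trace (Q * Z)"
      using Z(3) Qc by (simp add: mat_trace_diff[of _ d]) (simp add: mat_trace_def sum_distrib_left)
    then have "0 \<le> of_real (l * t) - mat_trace (Q * Z)"
      using psd_trace_mult_nonneg[OF M Z(1)] t by simp
    then have "mat_trace (Q * Z) + 0 \<le> mat_trace (Q * Z) + (of_real (l * t) - mat_trace (Q * Z))"
      by (rule add_left_mono)
    then have "mat_trace (Q * Z) \<le> of_real (l * t)" by simp
    also have "(of_real (l * t) :: 'a) \<le> of_real l" unfolding of_real_le_iff_roc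
      using l0 Z(2) t by (simp add: mult_left_le)
    also have "of_real l = mat_trace (Q * Y)" using tr[OF v(1)] Y by (simp add: l_def)
    finally show "mat_trace (Q * Z) \<le> mat_trace (Q * Y)" .
  next
    have "eigenvalue Q (of_real l)"
      unfolding eigenvalue_def eigenvector_def using v v0 Qv Qc by (intro exI[of _ v]) auto
    moreover have "k \<le> of_real l" if ev: "eigenvalue Q k" for k
    proof -
      obtain w where w: "w \<in> carrier_vec d" "w \<noteq> 0\<^sub>v d" "Q *\<^sub>v w = k \<cdot>\<^sub>v w"
        using ev Qc unfolding eigenvalue_def eigenvector_def by auto
      have rw: "rip w w > 0" using rip_self_eq_0[OF w(1)] w(2) rip_self_nonneg[of w] by linarith
      have "of_real (rip (Q *\<^sub>v w) w) = (Q *\<^sub>v w) \<bullet>c w" using herm_quad_real[OF h w(1)] by simp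
      also have "\<dots> = k * of_real (rip w w)" using w by (simp add: cscalar_prod_self)
      finally have "k = of_real (rip (Q *\<^sub>v w) w / rip w w)" using rw by (simp add: field_simps)
      moreover have "0 \<le> rip (M *\<^sub>v w) w" using M w(1) unfolding psd_mats_iff by blast
      then have "rip (Q *\<^sub>v w) w / rip w w \<le> l"
        using Mrip[OF w(1)] rw by (simp add: divide_le_eq)
      ultimately show ?thesis by (simp del: of_real_divide)
    qed
    moreover have "Q *\<^sub>v (Y *\<^sub>v u) = of_real l \<cdot>\<^sub>v (Y *\<^sub>v u)" if "u \<in> carrier_vec d" for u
      using that v Qc by (simp add: Y outer_mult_vec[of _ d] mult_mat_vec[of _ d d] Qv smult_smult_assoc mult.commute)
    ultimately show "\<exists>l. eigenvalue Q l \<and> (\<forall>k. eigenvalue Q k \<longrightarrow> k \<le> l) \<and>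
             (\<forall>v \<in> carrier_vec d. Q *\<^sub>v (Y *\<^sub>v v) = l \<cdot>\<^sub>v (Y *\<^sub>v v))" by blast
  qed
qed


text \<open>On unit vectors this is, up to an affine transformation, the quadratic form of the matrix of the program with input
  \<open>Phi Ps (outer x)\<close>, as shown in \<open>pep_matrix_facts\<close>.\<close>

definition avg_form :: "nat \<Rightarrow> 'a::real_or_complex vec \<Rightarrow> (nat \<Rightarrow> 'a mat) \<Rightarrow> 'a vec \<Rightarrow> 'a vec \<Rightarrow> real" where
  "avg_form m x Ps v w = (1 / real m) * (\<Sum>j<m. side x (Ps j) * rform (Ps j) v w)"

lemma phi_outer:
  assumes "orth_proj d P" "x \<in> carrier_vec d" "rip x x = 1"
  shows "phi P (outer x) = 1 \<longleftrightarrow> 0 \<le> rquad P x"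
proof -
  have P: "herm d P" "P \<in> carrier_mat d d" using assms by (auto simp: orth_proj_def herm_def)
  have "mat_trace (P * outer x) = of_real (rip (P *\<^sub>v x) x)"
    using mat_trace_mult_outer[OF P(2) assms(2)] herm_quad_real[OF P(1) assms(2)] by simp
  moreover have "(1 / 2 :: 'a) = of_real (1 / 2)" by simp
  ultimately have "phi P (outer x) = 1 \<longleftrightarrow> 1 / 2 \<le> rip (P *\<^sub>v x) x"
    by (simp only: phi_def of_real_le_iff_roc) auto
  then show ?thesis using assms by (auto simp: rform_def)
qed

lemma pep_matrix_facts:
  assumes P: "\<And>j. j < m \<Longrightarrow> orth_proj d (Ps j)" and m: "1 \<le> m"
    and x: "x \<in> carrier_vec d" "rip x x = 1"
  defines "Q \<equiv> pep_matrix d m Ps (Phi Ps (outer x))"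
  shows "Q \<in> psd_mats d"
    and "\<And>v. v \<in> carrier_vec d \<Longrightarrow> rip (Q *\<^sub>v v) v = (rip v v + avg_form m x Ps v v) / 2"
proof -
  define R where "R j = (if Phi Ps (outer x) j = 1 then Ps j else 1\<^sub>m d - Ps j)" for j
  have R: "orth_proj d (R j)" if "j < m" for j
    using P[OF that] orth_proj_complement by (auto simp: R_def)
  have Rc: "R j \<in> carrier_mat d d" if "j < m" for j using R[OF that] by (simp add: orth_proj_def)
  have Qc: "Q \<in> carrier_mat d d" by (simp add: Q_def pep_matrix_def)
  have Q_index: "Q $$ (i, k) = 1 / of_nat m * (\<Sum>j<m. R j $$ (i, k))" if "i < d" "k < d" for i k
    using that by (simp add: Q_def pep_matrix_def R_def)
  have h: "herm d Q"
  proof -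
    have "conjugate (Q $$ (k, i)) = Q $$ (i, k)" if "i < d" "k < d" for i k
    proof -
      have "conjugate (R j $$ (k, i)) = R j $$ (i, k)" if "j < m" for j
      proof -
        have "mat_adjoint (R j) $$ (i, k) = conjugate (R j $$ (k, i))"
          using Rc[OF that] \<open>i < d\<close> \<open>k < d\<close> by (intro mat_adjoint_index) auto
        then show ?thesis using R[OF that] by (simp add: orth_proj_def)
      qed
      moreover have "conjugate (1 / of_nat m :: 'a) = 1 / of_nat m"
        using conjugate_of_real[of "1 / real m"] by simp
      ultimately show ?thesis using that by (simp only: Q_index conjugate_dist_mul conjugate_sum) simp
    qed
    then show ?thesis using Qc by (auto simp: herm_def intro!: eq_matI)
  qed
  have Qrip: "rip (Q *\<^sub>v v) v = 1 / real m * (\<Sum>j<m. rip (R j *\<^sub>v v) v)" if v: "v \<in> carrier_vec d" for v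
  proof -
    have "(Q *\<^sub>v v) $ i = (1 / real m) *\<^sub>R (\<Sum>j<m. (R j *\<^sub>v v) $ i)" if i: "i < d" for i
    proof -
      have "(Q *\<^sub>v v) $ i = (\<Sum>k<d. 1 / of_nat m * (\<Sum>j<m. R j $$ (i, k)) * v $ k)"
        using Qc v i by (simp add: mult_mat_vec_sum[of Q d d] Q_index del: index_mult_mat_vec)
      also have "\<dots> = 1 / of_nat m * (\<Sum>k<d. \<Sum>j<m. R j $$ (i, k) * v $ k)"
        by (simp add: sum_distrib_left sum_distrib_right mult.assoc)
      also have "(\<Sum>k<d. \<Sum>j<m. R j $$ (i, k) * v $ k) = (\<Sum>j<m. \<Sum>k<d. R j $$ (i, k) * v $ k)"
        by (rule sum.swap)
      also have "\<dots> = (\<Sum>j<m. (R j *\<^sub>v v) $ i)"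
        using Rc v i by (intro sum.cong refl) (simp add: mult_mat_vec_sum[of _ d d] del: index_mult_mat_vec)
      finally show ?thesis by (simp add: scaleR_conv_of_real)
    qed
    then have "rip (Q *\<^sub>v v) v = (\<Sum>i<d. (1 / real m) * (\<Sum>j<m. inner ((R j *\<^sub>v v) $ i) (v $ i)))"
      using v Qc by (simp add: rip_eq_sum[of "Q *\<^sub>v v" d] inner_sum_left del: index_mult_mat_vec)
    also have "\<dots> = 1 / real m * (\<Sum>j<m. \<Sum>i<d. inner ((R j *\<^sub>v v) $ i) (v $ i))"
      by (subst sum.swap) (simp only: sum_distrib_left)
    also have "(\<Sum>j<m. \<Sum>i<d. inner ((R j *\<^sub>v v) $ i) (v $ i)) = (\<Sum>j<m. rip (R j *\<^sub>v v) v)"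
      using Rc v by (intro sum.cong refl) (simp add: rip_eq_sum[of _ d] mult_mat_vec_carrier[of _ d d] del: index_mult_mat_vec)
    finally show ?thesis .
  qed
  have Rpos: "0 \<le> rip (R j *\<^sub>v v) v" if j: "j < m" and v: "v \<in> carrier_vec d" for j v
    using abs_rquad_le[OF R[OF j] v] by (simp add: rform_def abs_le_iff)
  show "Q \<in> psd_mats d"
    unfolding psd_mats_iff using h Rpos by (auto simp: Qrip intro!: sum_nonneg divide_nonneg_nonneg)
  show "rip (Q *\<^sub>v v) v = (rip v v + avg_form m x Ps v v) / 2" if v: "v \<in> carrier_vec d" for v
  proof -
    have "rip (R j *\<^sub>v v) v = (rip v v + side x (Ps j) * rquad (Ps j) v) / 2" if j: "j < m" for j
    proof (cases "0 \<le> rquad (Ps j) x")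
      case True
      then show ?thesis using phi_outer[OF P[OF j] x] by (simp add: R_def Phi_def side_def rform_def)
    next
      case False
      have c: "Ps j \<in> carrier_mat d d" using P[OF j] by (simp add: orth_proj_def)
      have "(1\<^sub>m d - Ps j) *\<^sub>v v = v - Ps j *\<^sub>v v"
        using c v by (simp add: minus_mult_distrib_mat_vec[of _ d d])
      then show ?thesis using False phi_outer[OF P[OF j] x] v mult_mat_vec_carrier[OF c v]
        by (simp add: R_def Phi_def side_def rform_def rip_diff_left[of _ d])
    qed
    then have "(\<Sum>j<m. rip (R j *\<^sub>v v) v) = (\<Sum>j<m. (rip v v + side x (Ps j) * rquad (Ps j) v) / 2)"
      by (intro sum.cong refl) simp
    also have "\<dots> = (real m * rip v v + (\<Sum>j<m. side x (Ps j) * rquad (Ps j) v)) / 2"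
      by (simp add: sum.distrib flip: sum_divide_distrib)
    finally show ?thesis unfolding Qrip[OF v] avg_form_def using m by (simp add: field_simps)
  qed
qed

lemma pep_solution_iff:
  assumes P: "\<And>j. j < m \<Longrightarrow> orth_proj d (Ps j)" and m: "1 \<le> m"
    and x: "x \<in> carrier_vec d" "rip x x = 1"
  shows "pep_solution d m Ps (Phi Ps (outer x)) Y \<longleftrightarrow>
    (\<exists>v. top_unit d (\<lambda>v. avg_form m x Ps v v) v \<and> Y = outer v)"
proof -
  let ?Q = "pep_matrix d m Ps (Phi Ps (outer x))"
  have Q: "?Q \<in> psd_mats d" "\<And>v. v \<in> carrier_vec d \<Longrightarrow> rip (?Q *\<^sub>v v) v = (rip v v + avg_form m x Ps v v) / 2"
    using pep_matrix_facts[where Ps = Ps, OF P m x] by blast+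
  have "pep_solution d m Ps (Phi Ps (outer x)) Y \<longleftrightarrow> principal d ?Q Y"
    unfolding pep_solution_def principal_def Let_def ..
  also have "\<dots> \<longleftrightarrow> (\<exists>v. top_unit d (\<lambda>v. rip (?Q *\<^sub>v v) v) v \<and> Y = outer v)"
    by (rule principal_iff[OF Q(1)])
  also have "\<dots> \<longleftrightarrow> (\<exists>v. top_unit d (\<lambda>v. avg_form m x Ps v v) v \<and> Y = outer v)"
    by (intro ex_cong1 conj_cong refl) (auto simp: top_unit_def Q(2))
  finally show ?thesis .
qed

section \<open>Measurability of the recovery event\<close>

text \<open>The quantifiers range over uncountable sets. By compactness the condition says that some \<open>w\<close> beats all of
  \<open>K\<close> by a uniform margin, and by continuity both \<open>w\<close> and \<open>v\<close> may then be restricted to countable dense sets.\<close>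

lemma beaten_everywhere_measurable:
  fixes S K :: "'b::{metric_space, second_countable_topology} set" and F :: "'o \<Rightarrow> 'b \<Rightarrow> real"
  assumes S: "K \<subseteq> S" and K: "compact K"
    and cont: "\<And>\<omega>. \<omega> \<in> space M \<Longrightarrow> continuous_on UNIV (F \<omega>)"
    and meas: "\<And>v. v \<in> S \<Longrightarrow> (\<lambda>\<omega>. F \<omega> v) \<in> borel_measurable M"
  shows "{\<omega> \<in> space M. \<forall>v\<in>K. \<exists>w\<in>S. F \<omega> v < F \<omega> w} \<in> sets M"
proof (cases "K = {}")
  case False
  obtain D where D: "countable D" "D \<subseteq> S" "S \<subseteq> closure D" by (rule separable)
  obtain E where E: "countable E" "E \<subseteq> K" "K \<subseteq> closure E" by (rule separable)
  have "(\<forall>v\<in>K. \<exists>w\<in>S. F \<omega> v < F \<omega> w) \<longleftrightarrow> (\<exists>w\<in>D. \<exists>k::nat. \<forall>v\<in>E. F \<omega> v \<le> F \<omega> w - inverse (real (Suc k)))"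
    if om: "\<omega> \<in> space M" for \<omega>
  proof
    note c = cont[OF om]
    assume *: "\<forall>v\<in>K. \<exists>w\<in>S. F \<omega> v < F \<omega> w"
    obtain v where v: "v \<in> K" "\<And>y. y \<in> K \<Longrightarrow> F \<omega> y \<le> F \<omega> v"
      using continuous_attains_sup[OF K False continuous_on_subset[OF c]] by blast
    obtain w where w: "w \<in> S" "F \<omega> v < F \<omega> w" using * v by blast
    have "open {y. F \<omega> v < F \<omega> y}" using c by (intro open_Collect_less continuous_intros)
    then have "({y. F \<omega> v < F \<omega> y} \<inter> closure D = {}) = ({y. F \<omega> v < F \<omega> y} \<inter> D = {})"
      by (rule open_Int_closure_eq_empty)
    moreover have "w \<in> {y. F \<omega> v < F \<omega> y} \<inter> closure D" using w D by blast
    ultimately obtain y where y: "y \<in> D" "F \<omega> v < F \<omega> y" by blast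
    obtain k where "inverse (real (Suc k)) < F \<omega> y - F \<omega> v"
      using reals_Archimedean[of "F \<omega> y - F \<omega> v"] y by auto
    then have k: "F \<omega> v \<le> F \<omega> y - inverse (real (Suc k))" by linarith
    have "F \<omega> u \<le> F \<omega> y - inverse (real (Suc k))" if "u \<in> E" for u
      using v(2)[of u] k that E(2) by (meson order.trans subsetD)
    then show "\<exists>w\<in>D. \<exists>k::nat. \<forall>v\<in>E. F \<omega> v \<le> F \<omega> w - inverse (real (Suc k))"
      using y(1) by blast
  next
    note c = cont[OF om]
    assume "\<exists>w\<in>D. \<exists>k::nat. \<forall>v\<in>E. F \<omega> v \<le> F \<omega> w - inverse (real (Suc k))"
    then obtain w k where w: "w \<in> D" "\<And>v. v \<in> E \<Longrightarrow> F \<omega> v \<le> F \<omega> w - inverse (real (Suc k))" by blast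
    show "\<forall>v\<in>K. \<exists>w\<in>S. F \<omega> v < F \<omega> w"
    proof
      fix v assume "v \<in> K"
      then have "v \<in> closure E" using E(3) by blast
      then have "F \<omega> v \<le> F \<omega> w - inverse (real (Suc k))"
        by (rule continuous_le_on_closure[OF continuous_on_subset[OF c subset_UNIV]]) (rule w(2))
      moreover have "0 < inverse (real (Suc k))" by simp
      ultimately have "F \<omega> v < F \<omega> w" by linarith
      then show "\<exists>w\<in>S. F \<omega> v < F \<omega> w" using w(1) D(2) by blast
    qed
  qed
  then have "{\<omega> \<in> space M. \<forall>v\<in>K. \<exists>w\<in>S. F \<omega> v < F \<omega> w}
    = {\<omega> \<in> space M. \<exists>w\<in>D. \<exists>k::nat. \<forall>v\<in>E. F \<omega> v \<le> F \<omega> w - inverse (real (Suc k))}" by blast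
  also have "\<dots> \<in> sets M"
  proof -
    have "{\<omega> \<in> space M. F \<omega> v \<le> F \<omega> w - inverse (real (Suc k))} \<in> sets M" if "w \<in> D" "v \<in> E" for w v k
    proof -
      have "(\<lambda>\<omega>. F \<omega> v) \<in> borel_measurable M" "(\<lambda>\<omega>. F \<omega> w) \<in> borel_measurable M"
        using that D(2) E(2) S by (auto intro!: meas)
      then show ?thesis by (intro borel_measurable_le borel_measurable_diff borel_measurable_const)
    qed
    then show ?thesis
      using D(1) E(1)
      by (intro sets.sets_Collect_countable_Ex' sets.sets_Collect_countable_Ex sets.sets_Collect_countable_All')
  qed
  finally show ?thesis .
qed simp

text \<open>The unit sphere in terms of coordinate functions, because these carry the product topology. The
  coordinates from \<open>d\<close> on are set to zero to make the set compact.\<close>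

definition coord_sphere :: "nat \<Rightarrow> (nat \<Rightarrow> 'a::real_or_complex) set" where
  "coord_sphere d = {f. (\<forall>i\<ge>d. f i = 0) \<and> (\<Sum>i<d. (norm (f i))\<^sup>2) = 1}"

lemma continuous_on_coord [continuous_intros]: "continuous_on S (\<lambda>f. f i :: 'b::topological_space)"
  by (rule continuous_on_subset[OF continuous_on_product_coordinates]) simp

lemma compact_coord_sphere: "compact (coord_sphere d :: (nat \<Rightarrow> 'a::real_or_complex) set)"
proof -
  define B :: "nat \<Rightarrow> 'a set" where "B i = (if i < d then cball 0 1 else {0})" for i
  have "compactin (product_topology (\<lambda>_. euclidean) UNIV) (PiE UNIV B)"
    unfolding compactin_PiE by (auto simp: B_def)
  then have cB: "compact (PiE UNIV B)" by (simp add: euclidean_product_topology)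
  have "closed (coord_sphere d :: (nat \<Rightarrow> 'a) set)"
  proof -
    have "coord_sphere d = (\<Inter>i\<in>{d..}. {f. f i = 0}) \<inter> {f :: nat \<Rightarrow> 'a. (\<Sum>i<d. (norm (f i))\<^sup>2) = 1}"
      by (auto simp: coord_sphere_def)
    also have "closed \<dots>"
      by (intro closed_Int closed_INT ballI closed_Collect_eq continuous_intros)
    finally show ?thesis .
  qed
  moreover have "coord_sphere d \<subseteq> PiE UNIV B"
  proof
    fix f :: "nat \<Rightarrow> 'a" assume f: "f \<in> coord_sphere d"
    have "norm (f i) \<le> 1" if "i < d" for i
    proof -
      have "(norm (f i))\<^sup>2 \<le> (\<Sum>i<d. (norm (f i))\<^sup>2)" using that by (intro member_le_sum) auto
      also have "\<dots> = 1" using f by (simp add: coord_sphere_def)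
      finally show ?thesis by (simp add: abs_square_le_1)
    qed
    then show "f \<in> PiE UNIV B" using f by (auto simp: B_def coord_sphere_def)
  qed
  ultimately show ?thesis using cB by (metis compact_Int_closed inf.absorb_iff2)
qed

lemma coord_sphere_vec: "f \<in> coord_sphere d \<Longrightarrow> vec d f \<in> carrier_vec d \<and> rip (vec d f) (vec d f :: 'a::real_or_complex vec) = 1"
  by (simp add: coord_sphere_def rip_self[of _ d])

lemma vec_coord_sphere:
  assumes "v \<in> carrier_vec d" "rip v v = 1"
  obtains f where "f \<in> coord_sphere d" "v = vec d (f :: nat \<Rightarrow> 'a::real_or_complex)"
proof (rule that)
  show "(\<lambda>i. if i < d then v $ i else 0) \<in> coord_sphere d"
    using assms by (simp add: coord_sphere_def rip_self[of _ d])
  show "v = vec d (\<lambda>i. if i < d then v $ i else 0)" using assms(1) by (intro eq_vecI) auto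
qed

lemma continuous_rform:
  assumes "P \<in> carrier_mat d d"
  shows "continuous_on UNIV (\<lambda>f. rquad P (vec d f :: 'a::real_or_complex vec))"
proof -
  have "rquad P (vec d f) = 2 * (\<Sum>i<d. inner (\<Sum>j<d. P $$ (i, j) * f j) (f i)) - (\<Sum>i<d. inner (f i) (f i))" for f
    using assms by (simp add: rform_def rip_eq_sum[of _ d] mult_mat_vec_sum[of P d d] mult_mat_vec_carrier[OF assms]
        del: index_mult_mat_vec)
  then show ?thesis by (simp only:) (intro continuous_intros)
qed

context measured_line
begin

lemma sample_space: "Ps \<in> space (sample m) \<Longrightarrow> j < m \<Longrightarrow> Ps j \<in> space \<mu>"
  by (auto simp: space_PiM PiE_iff)

lemma avg_form_bilin:
  assumes "Ps \<in> space (sample m)"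
  shows "bilin_on d (avg_form m x Ps)"
  unfolding avg_form_def[abs_def]
  by (intro bilin_on_cmult bilin_on_sum rform_bilin orth sample_space[OF assms]) auto

lemma avg_form_measurable:
  assumes "v \<in> carrier_vec d"
  shows "(\<lambda>Ps. avg_form m x Ps v v) \<in> borel_measurable (sample m)"
proof -
  have "(\<lambda>P. side x P * rquad P v) \<in> borel_measurable \<mu>" using assms by measurable
  then have "(\<lambda>Ps. side x (Ps j) * rquad (Ps j) v) \<in> borel_measurable (sample m)" if "j < m" for j
    using that by (intro measurable_compose[OF measurable_component_singleton]) auto
  then have "(\<lambda>Ps. \<Sum>j<m. side x (Ps j) * rquad (Ps j) v) \<in> borel_measurable (sample m)"
    by (intro borel_measurable_sum) auto
  then show ?thesis unfolding avg_form_def by (rule borel_measurable_times[OF borel_measurable_const])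
qed

lemma avg_form_continuous:
  assumes "Ps \<in> space (sample m)"
  shows "continuous_on UNIV (\<lambda>f. avg_form m x Ps (vec d f) (vec d f))"
  unfolding avg_form_def
  by (intro continuous_intros continuous_rform carr sample_space[OF assms]) auto

definition recovered :: "nat \<Rightarrow> real \<Rightarrow> (nat \<Rightarrow> 'a mat) set" where
  "recovered m \<delta> = {Ps \<in> space (sample m).
     (\<exists>Y. pep_solution d m Ps (Phi Ps (outer x)) Y) \<and>
     (\<forall>Y. pep_solution d m Ps (Phi Ps (outer x)) Y \<longrightarrow> op_norm (Y - outer x) < \<delta>)}"

lemma recovered_eq:
  assumes m: "1 \<le> m"
  shows "recovered m \<delta> = {Ps \<in> space (sample m). \<forall>v.
      top_unit d (\<lambda>v. avg_form m x Ps v v) v \<longrightarrow> sqrt (1 - (norm (v \<bullet>c x))\<^sup>2) < \<delta>}"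
proof -
  have "(\<exists>Y. pep_solution d m Ps (Phi Ps (outer x)) Y) \<and>
     (\<forall>Y. pep_solution d m Ps (Phi Ps (outer x)) Y \<longrightarrow> op_norm (Y - outer x) < \<delta>) \<longleftrightarrow>
     (\<forall>v. top_unit d (\<lambda>v. avg_form m x Ps v v) v \<longrightarrow> sqrt (1 - (norm (v \<bullet>c x))\<^sup>2) < \<delta>)"
    if Ps: "Ps \<in> space (sample m)" for Ps
  proof -
    let ?T = "top_unit d (\<lambda>v. avg_form m x Ps v v)"
    have sol: "pep_solution d m Ps (Phi Ps (outer x)) Y \<longleftrightarrow> (\<exists>v. ?T v \<and> Y = outer v)" for Y
      by (rule pep_solution_iff[OF _ m x]) (rule orth[OF sample_space[OF Ps]])
    obtain v0 where v0: "?T v0"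
    proof -
      obtain f0 :: "nat \<Rightarrow> 'a" where f0: "f0 \<in> coord_sphere d" "x = vec d f0" by (rule vec_coord_sphere[OF x])
      have ne: "coord_sphere d \<noteq> ({} :: (nat \<Rightarrow> 'a) set)" using f0(1) by blast
      have "\<exists>f\<in>coord_sphere d. \<forall>h\<in>coord_sphere d. avg_form m x Ps (vec d h) (vec d h) \<le> avg_form m x Ps (vec d f) (vec d f)"
        by (rule continuous_attains_sup[OF compact_coord_sphere ne
              continuous_on_subset[OF avg_form_continuous[OF Ps] subset_UNIV]])
      then obtain f where f: "f \<in> coord_sphere d"
        "\<And>h. h \<in> coord_sphere d \<Longrightarrow> avg_form m x Ps (vec d h) (vec d h) \<le> avg_form m x Ps (vec d f) (vec d f)"
        by blast
      have "avg_form m x Ps w w \<le> avg_form m x Ps (vec d f) (vec d f)"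
        if "w \<in> carrier_vec d" "rip w w = 1" for w
        by (rule vec_coord_sphere[OF that]) (simp add: f(2))
      then have "?T (vec d f)" unfolding top_unit_def using coord_sphere_vec[OF f(1)] by blast
      then show ?thesis by (rule that)
    qed
    have on: "op_norm (outer v - outer x) = sqrt (1 - (norm (v \<bullet>c x))\<^sup>2)" if "?T v" for v
      using that x by (intro op_norm_outer_diff[of _ d]) (auto simp: top_unit_def)
    show ?thesis
      unfolding sol
    proof
      assume *: "(\<exists>Y v. ?T v \<and> Y = outer v) \<and> (\<forall>Y. (\<exists>v. ?T v \<and> Y = outer v) \<longrightarrow> op_norm (Y - outer x) < \<delta>)"
      show "\<forall>v. ?T v \<longrightarrow> sqrt (1 - (norm (v \<bullet>c x))\<^sup>2) < \<delta>"
      proof (intro allI impI)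
        fix v assume v: "?T v"
        then have "op_norm (outer v - outer x) < \<delta>" using * by blast
        then show "sqrt (1 - (norm (v \<bullet>c x))\<^sup>2) < \<delta>" by (simp only: on[OF v])
      qed
    next
      assume *: "\<forall>v. ?T v \<longrightarrow> sqrt (1 - (norm (v \<bullet>c x))\<^sup>2) < \<delta>"
      have "op_norm (outer v - outer x) < \<delta>" if v: "?T v" for v
        using * v by (simp only: on[OF v])
      then show "(\<exists>Y v. ?T v \<and> Y = outer v) \<and> (\<forall>Y. (\<exists>v. ?T v \<and> Y = outer v) \<longrightarrow> op_norm (Y - outer x) < \<delta>)"
        using v0 by blast
    qed
  qed
  then show ?thesis unfolding recovered_def by blast
qed

text \<open>Recovery fails when a maximizer lies in the compact set \<open>K\<close> of unit vectors far from \<open>x\<close>, so it holds when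
  every point of \<open>K\<close> is beaten by some point of the sphere.\<close>

lemma recovered_measurable:
  assumes m: "1 \<le> m"
  shows "recovered m \<delta> \<in> sets (sample m)"
proof -
  let ?F = "\<lambda>Ps f. avg_form m x Ps (vec d f) (vec d f)"
  define K where "K = coord_sphere d \<inter> {f. \<delta> \<le> sqrt (1 - (norm (vec d f \<bullet>c x))\<^sup>2)}"
  have "closed {f. \<delta> \<le> sqrt (1 - (norm (vec d f \<bullet>c x))\<^sup>2)}"
  proof -
    have "vec d f \<bullet>c x = (\<Sum>i<d. f i * conjugate (x $ i))" for f
      using x by (simp add: cscalar_prod_sum[of _ d])
    then show ?thesis by (simp only:) (intro closed_Collect_le continuous_intros)
  qed
  then have "compact K" unfolding K_def by (intro compact_Int_closed compact_coord_sphere)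
  then have "{Ps \<in> space (sample m). \<forall>f\<in>K. \<exists>h\<in>coord_sphere d. ?F Ps f < ?F Ps h} \<in> sets (sample m)"
    by (intro beaten_everywhere_measurable avg_form_continuous avg_form_measurable) (auto simp: K_def)
  also have "{Ps \<in> space (sample m). \<forall>f\<in>K. \<exists>h\<in>coord_sphere d. ?F Ps f < ?F Ps h} = recovered m \<delta>"
  proof -
    have "(\<forall>f\<in>K. \<exists>h\<in>coord_sphere d. ?F Ps f < ?F Ps h) \<longleftrightarrow>
      (\<forall>v. top_unit d (\<lambda>v. avg_form m x Ps v v) v \<longrightarrow> sqrt (1 - (norm (v \<bullet>c x))\<^sup>2) < \<delta>)" for Ps
    proof
      assume *: "\<forall>f\<in>K. \<exists>h\<in>coord_sphere d. ?F Ps f < ?F Ps h"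
      show "\<forall>v. top_unit d (\<lambda>v. avg_form m x Ps v v) v \<longrightarrow> sqrt (1 - (norm (v \<bullet>c x))\<^sup>2) < \<delta>"
      proof (intro allI impI, rule ccontr)
        fix v assume v: "top_unit d (\<lambda>v. avg_form m x Ps v v) v" and far: "\<not> sqrt (1 - (norm (v \<bullet>c x))\<^sup>2) < \<delta>"
        have "v \<in> carrier_vec d" "rip v v = 1" using v by (auto simp: top_unit_def)
        then obtain f where f: "f \<in> coord_sphere d" "v = vec d f" by (rule vec_coord_sphere)
        then have "f \<in> K" using far by (simp add: K_def)
        then obtain h where "h \<in> coord_sphere d" "?F Ps f < ?F Ps h" using * by blast
        moreover have "?F Ps h \<le> ?F Ps f"
          using v f(2) coord_sphere_vec[OF calculation(1)] unfolding top_unit_def by blast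
        ultimately show False by simp
      qed
    next
      assume *: "\<forall>v. top_unit d (\<lambda>v. avg_form m x Ps v v) v \<longrightarrow> sqrt (1 - (norm (v \<bullet>c x))\<^sup>2) < \<delta>"
      show "\<forall>f\<in>K. \<exists>h\<in>coord_sphere d. ?F Ps f < ?F Ps h"
      proof (rule ballI, rule ccontr)
        fix f assume f: "f \<in> K" and no: "\<not> (\<exists>h\<in>coord_sphere d. ?F Ps f < ?F Ps h)"
        have "avg_form m x Ps w w \<le> ?F Ps f" if "w \<in> carrier_vec d" "rip w w = 1" for w
        proof (rule vec_coord_sphere[OF that])
          fix h assume "h \<in> coord_sphere d" "w = vec d h"
          then show ?thesis using no by force
        qed
        then have "top_unit d (\<lambda>v. avg_form m x Ps v v) (vec d f)"
          unfolding top_unit_def using coord_sphere_vec[of f d] f by (auto simp: K_def)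
        then show False using * f by (auto simp: K_def)
      qed
    qed
    then show ?thesis unfolding recovered_eq[OF m] by blast
  qed
  finally show ?thesis .
qed

section \<open>Recovery\<close>

text \<open>The sine of an angle never exceeds one.\<close>

lemma recovered_large_delta:
  assumes "1 \<le> m" "1 < \<delta>"
  shows "recovered m \<delta> = space (sample m)"
proof -
  have "sqrt (1 - (norm (v \<bullet>c x))\<^sup>2) < \<delta>" for v
  proof -
    have "sqrt (1 - (norm (v \<bullet>c x))\<^sup>2) \<le> sqrt 1" by (intro real_sqrt_le_mono) simp
    also have "sqrt 1 = 1" by simp
    also have "1 < \<delta>" by (rule assms(2))
    finally show ?thesis .
  qed
  then show ?thesis unfolding recovered_eq[OF assms(1)] by blast
qed

text \<open>The constant \<open>125\<close> leaves a little room: a deviation of \<open>\<tau>\<close> on the net costs \<open>4 \<tau> / g\<close> in the sine of the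
  angle, and the gap \<open>g\<close> is at least \<open>1 / (30 sqrt d)\<close>.\<close>

lemma recovered_if_close_on_net:
  assumes m: "1 \<le> m" and Ps: "Ps \<in> space (sample m)" and \<delta>: "0 < \<delta>"
    and G: "\<And>g. g \<in> G \<Longrightarrow> g \<in> carrier_vec d \<and> rip g g \<le> 1"
      "\<And>v. v \<in> carrier_vec d \<Longrightarrow> rip v v = 1 \<Longrightarrow> \<exists>g\<in>G. rip (v - g) (v - g) \<le> 1 / 16"
    and close: "\<And>g. g \<in> G \<Longrightarrow> \<bar>\<Sum>j<m. deviation g (Ps j)\<bar> \<le> real m * (\<delta> / (125 * sqrt (real d)))"
  shows "Ps \<in> recovered m \<delta>"
proof -
  define \<tau> where "\<tau> = \<delta> / (125 * sqrt (real d))"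
  define B where "B v w = avg_form m x Ps v w + (- 1) * mean_form v w" for v w
  have B: "bilin_on d B"
    unfolding B_def by (intro bilin_on_add bilin_on_cmult avg_form_bilin[OF Ps] mean_form_bilin)
  have Bdev: "B v v = (\<Sum>j<m. deviation v (Ps j)) / real m" for v
    using m by (simp add: B_def avg_form_def deviation_def sum_subtractf field_simps)
  have "\<bar>B v v\<bar> \<le> 3" if v: "v \<in> carrier_vec d" "rip v v = 1" for v
  proof -
    have "\<bar>\<Sum>j<m. deviation v (Ps j)\<bar> \<le> (\<Sum>j<m. 3)"
      using v sample_space[OF Ps] by (intro order.trans[OF sum_abs] sum_mono deviation_bound) auto
    then show ?thesis unfolding Bdev using m by (simp add: field_simps)
  qed
  moreover have "\<bar>B g g\<bar> \<le> \<tau>" if "g \<in> G" for g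
    using close[OF that] m unfolding Bdev \<tau>_def[symmetric] by (simp add: field_simps)
  ultimately have BK: "\<bar>B z z\<bar> \<le> 2 * \<tau> * rip z z" if "z \<in> carrier_vec d" for z
    using bilin_net_bound[OF d0 B _ G _ that] by blast
  obtain g where g: "g \<ge> 1 / (30 * sqrt (real d))"
    "\<And>v. v \<in> carrier_vec d \<Longrightarrow> rip v v = 1 \<Longrightarrow> mean_form x x - mean_form v v = g * (1 - (norm (v \<bullet>c x))\<^sup>2)"
    using mean_form_gap by blast
  have sd: "sqrt (real d) > 0" using d0 by simp
  have g0: "0 < g" using g(1) sd by (smt (verit) divide_pos_pos mult_pos_pos)
  have "sqrt (1 - (norm (v \<bullet>c x))\<^sup>2) < \<delta>" if top: "top_unit d (\<lambda>v. avg_form m x Ps v v) v" for v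
  proof -
    have v: "v \<in> carrier_vec d" "rip v v = 1" and le: "avg_form m x Ps x x \<le> avg_form m x Ps v v"
      using top x by (auto simp: top_unit_def)
    have "g * (1 - (norm (v \<bullet>c x))\<^sup>2) \<le> B v v - B x x"
      using g(2)[OF v] le by (simp add: B_def)
    then have "sqrt (1 - (norm (v \<bullet>c x))\<^sup>2) \<le> 2 * (2 * \<tau>) / g"
      using top_vector_perturbation[OF B BK x v g0] by blast
    also have "\<dots> \<le> 2 * (2 * \<tau>) / (1 / (30 * sqrt (real d)))"
      using g(1) g0 sd \<delta> by (intro divide_left_mono mult_pos_pos) (auto simp: \<tau>_def)
    also have "\<dots> = 120 / 125 * \<delta>" using sd by (simp add: \<tau>_def field_simps)
    also have "\<dots> < \<delta>" using \<delta> by simp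
    finally show ?thesis .
  qed
  then show ?thesis unfolding recovered_eq[OF m] using Ps by blast
qed

text \<open>A union bound over the net and the two tails. The constant \<open>1250000\<close> is \<open>80 * 125\<^sup>2\<close>, from the tail bound at
  the deviation allowed by the perturbation argument; the factors of \<open>d\<close> cancel, since both the variance
  of a measurement and the squared gap are of order \<open>1 / d\<close>.\<close>

lemma recovery_probability_net:
  assumes m: "1 \<le> m" and \<delta>: "0 < \<delta>" "\<delta> \<le> 1"
  shows "measure (sample m) (recovered m \<delta>)
    \<ge> 1 - 2 * real ((12 * d + 1) ^ (2 * d)) * exp (- (real m * \<delta>\<^sup>2 / 1250000))"
proof -
  interpret S: prob_space "sample m" by (rule sample_prob)
  define \<tau> where "\<tau> = \<delta> / (125 * sqrt (real d))"
  have \<tau>: "0 < \<tau>" "real d * \<tau>\<^sup>2 = \<delta>\<^sup>2 / 15625"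
    using \<delta> d0 by (auto simp: \<tau>_def power_divide power_mult_distrib)
  have "\<delta>\<^sup>2 \<le> 1" using \<delta> by (simp add: power_le_one)
  then have \<tau>2: "real d * \<tau>\<^sup>2 \<le> 100" unfolding \<tau>(2) by simp
  obtain G :: "'a vec set" where G: "finite G" "card G \<le> (12 * d + 1) ^ (2 * d)"
    "\<And>g. g \<in> G \<Longrightarrow> g \<in> carrier_vec d \<and> rip g g \<le> 1"
    "\<And>v. v \<in> carrier_vec d \<Longrightarrow> rip v v = 1 \<Longrightarrow> \<exists>g\<in>G. rip (v - g) (v - g) \<le> 1 / 16"
    using finite_net[OF d0] by blast
  define bad where "bad s g = {Ps \<in> space (sample m). real m * \<tau> \<le> s * (\<Sum>j<m. deviation g (Ps j))}" for s :: real and g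
  define E where "E = exp (- (real m * \<delta>\<^sup>2 / 1250000))"
  have bad_sets: "bad s g \<in> sets (sample m)" if "g \<in> G" for s g
  proof -
    have "(\<lambda>Ps. deviation g (Ps j)) \<in> borel_measurable (sample m)" if "j < m" for j
      using that G(3)[OF \<open>g \<in> G\<close>] by (intro measurable_compose[OF measurable_component_singleton] deviation_measurable) auto
    then have [measurable]: "(\<lambda>Ps. \<Sum>j<m. deviation g (Ps j)) \<in> borel_measurable (sample m)"
      by (intro borel_measurable_sum) auto
    show ?thesis unfolding bad_def by measurable
  qed
  have bad_le: "measure (sample m) (bad s g) \<le> E" if "g \<in> G" "\<bar>s\<bar> = 1" for s g
  proof -
    have "measure (sample m) (bad s g) \<le> exp (- (real m * real d * \<tau>\<^sup>2 / 80))"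
      unfolding bad_def using G(3)[OF that(1)] \<tau>(1) \<tau>2 that(2) by (intro chernoff_one_sided) auto
    also have "real m * real d * \<tau>\<^sup>2 / 80 = real m * \<delta>\<^sup>2 / 1250000"
      using \<tau>(2) by (simp add: mult.assoc)
    finally show ?thesis by (simp add: E_def)
  qed
  define Bad where "Bad = (\<Union>g\<in>G. bad 1 g \<union> bad (- 1) g)"
  have Bad_sets: "Bad \<in> sets (sample m)" unfolding Bad_def using G(1) bad_sets by (intro sets.finite_UN) auto
  have "measure (sample m) Bad \<le> (\<Sum>g\<in>G. measure (sample m) (bad 1 g \<union> bad (- 1) g))"
    unfolding Bad_def using G(1) bad_sets by (intro S.finite_measure_subadditive_finite) auto
  also have "\<dots> \<le> (\<Sum>g\<in>G. 2 * E)"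
  proof (rule sum_mono)
    fix g assume g: "g \<in> G"
    have "measure (sample m) (bad 1 g \<union> bad (- 1) g) \<le> measure (sample m) (bad 1 g) + measure (sample m) (bad (- 1) g)"
      using bad_sets[OF g] by (intro measure_Un_le)
    then show "measure (sample m) (bad 1 g \<union> bad (- 1) g) \<le> 2 * E"
      using bad_le[OF g, of 1] bad_le[OF g, of "- 1"] by simp
  qed
  also have "\<dots> = 2 * real (card G) * E" by simp
  also have "\<dots> \<le> 2 * real ((12 * d + 1) ^ (2 * d)) * E"
    using G(2) by (intro mult_right_mono mult_left_mono of_nat_mono) (auto simp: E_def)
  finally have bd: "measure (sample m) Bad \<le> 2 * real ((12 * d + 1) ^ (2 * d)) * E" .
  have "space (sample m) - Bad \<subseteq> recovered m \<delta>"
  proof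
    fix Ps assume Ps: "Ps \<in> space (sample m) - Bad"
    show "Ps \<in> recovered m \<delta>"
    proof (rule recovered_if_close_on_net[OF m _ \<delta>(1) G(3,4)])
      fix g assume g: "g \<in> G"
      have "\<not> real m * \<tau> \<le> 1 * (\<Sum>j<m. deviation g (Ps j))" "\<not> real m * \<tau> \<le> - 1 * (\<Sum>j<m. deviation g (Ps j))"
        using Ps g unfolding Bad_def bad_def by blast+
      then show "\<bar>\<Sum>j<m. deviation g (Ps j)\<bar> \<le> real m * (\<delta> / (125 * sqrt (real d)))"
        unfolding \<tau>_def[symmetric] by linarith
    qed (use Ps in auto)
  qed
  then have "measure (sample m) (space (sample m) - Bad) \<le> measure (sample m) (recovered m \<delta>)"
    by (intro S.finite_measure_mono recovered_measurable[OF m])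
  moreover have "measure (sample m) (space (sample m) - Bad) = 1 - measure (sample m) Bad"
    by (rule S.prob_compl[OF Bad_sets])
  ultimately show ?thesis using bd by (simp add: E_def)
qed

lemma recovery_probability:
  assumes \<alpha>: "0 < \<alpha>" and m: "1 \<le> m" and \<delta>: "0 < \<delta>"
    and large: "real m \<ge> 1250000 * (25 + \<alpha>) / \<delta>\<^sup>2 * real n * ln (real n)"
  shows "measure (sample m) (recovered m \<delta>) \<ge> 1 - real n powr (- \<alpha>)"
proof -
  interpret S: prob_space "sample m" by (rule sample_prob)
  consider "n = 1" | "1 < \<delta>" | "2 \<le> n" "\<delta> \<le> 1" using n by linarith
  then show ?thesis
  proof cases
    case 1 then show ?thesis by simp
  next
    case 2 then show ?thesis using recovered_large_delta[OF m 2] S.prob_space by simp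
  next
    case 3
    define L where "L = ln (real n)"
    have L0: "0 \<le> L" using n by (simp add: L_def)
    have eL: "exp L = real n" using n by (simp add: L_def)
    have "real m * \<delta>\<^sup>2 \<ge> 1250000 * (25 + \<alpha>) * real n * L"
      using large \<delta> by (simp add: L_def field_simps)
    then have 1: "exp (- (real m * \<delta>\<^sup>2 / 1250000)) \<le> exp (- ((25 + \<alpha>) * real n * L))"
      by (simp add: algebra_simps)
    \<comment> \<open>there are at most \<open>n ^ (24 n)\<close> net points, which the exponent \<open>25 n\<close> absorbs together with the factor \<open>2\<close>\<close>
    have "12 * d + 1 \<le> n ^ 6"
    proof -
      have "(2::nat) ^ 5 \<le> n ^ 5" using 3 by (intro power_mono) auto
      then have "32 * n \<le> n ^ 5 * n" by (intro mult_right_mono) auto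
      also have "\<dots> = n ^ 6" by (simp add: eval_nat_numeral)
      finally show ?thesis using d_def 3 by linarith
    qed
    then have "(12 * d + 1) ^ (2 * d) \<le> (n ^ 6) ^ (2 * d)" by (intro power_mono) auto
    also have "\<dots> = n ^ (24 * n)" by (simp add: d_def flip: power_mult)
    finally have "real ((12 * d + 1) ^ (2 * d)) \<le> real (n ^ (24 * n))" by (rule of_nat_mono)
    also have "\<dots> = exp (24 * real n * L)"
      by (simp add: eL[symmetric] exp_of_nat_mult[symmetric])
    finally have 2: "real ((12 * d + 1) ^ (2 * d)) \<le> exp (24 * real n * L)" .
    have 3: "2 \<le> exp L" using 3 by (simp add: eL)
    have "2 * real ((12 * d + 1) ^ (2 * d)) * exp (- (real m * \<delta>\<^sup>2 / 1250000))
        \<le> exp L * exp (24 * real n * L) * exp (- ((25 + \<alpha>) * real n * L))"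
      by (intro mult_mono 1 2 3) auto
    also have "\<dots> = exp (L * (1 - real n - \<alpha> * real n))"
      by (simp add: algebra_simps flip: exp_add)
    also have "\<dots> \<le> exp (L * (- \<alpha>))"
    proof -
      have "\<alpha> * 1 \<le> \<alpha> * real n" using \<alpha> n by (intro mult_left_mono) auto
      then have "1 - real n - \<alpha> * real n \<le> - \<alpha>" using n by simp
      then show ?thesis unfolding exp_le_cancel_iff by (rule mult_left_mono[OF _ L0])
    qed
    also have "\<dots> = real n powr (- \<alpha>)" using n by (simp add: powr_def L_def mult.commute)
    finally show ?thesis using recovery_probability_net[OF m \<delta>] \<open>\<delta> \<le> 1\<close> by linarith
  qed
qed

end

lemma recovery_guarantee:
  fixes X :: "'a::real_or_complex mat"
  assumes \<alpha>: "0 < \<alpha>" and "1 \<le> n" "1 \<le> m" "0 < \<delta>" and X: "X \<in> Proj 1 (2 * n)"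
    and "uniform_on_Proj n (2 * n) \<mu>"
    and "real m \<ge> 1250000 * (25 + \<alpha>) / \<delta>\<^sup>2 * real n * ln (real n)"
  shows "measure (Pi\<^sub>M {..<m} (\<lambda>_. \<mu>))
            {Ps \<in> space (Pi\<^sub>M {..<m} (\<lambda>_. \<mu>)).
               (\<exists>Y. pep_solution (2 * n) m Ps (Phi Ps X) Y) \<and>
               (\<forall>Y. pep_solution (2 * n) m Ps (Phi Ps X) Y \<longrightarrow> op_norm (Y - X) < \<delta>)}
            \<ge> 1 - real n powr (- \<alpha>)"
proof -
  obtain x where x: "x \<in> carrier_vec (2 * n)" "rip x x = 1" and X: "X = outer x"
    using X Proj_1_iff by blast
  interpret measured_line n "2 * n" \<mu> x
    by standard (use assms x in auto)
  show ?thesis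
    using recovery_probability[of \<alpha> m \<delta>] assms unfolding recovered_def X by blast
qed

theorem corollary2p3p4:
  fixes \<alpha> :: real
  assumes "\<alpha> > 0"
  shows "\<exists>C::real. C > 0 \<and>
       (\<forall>(n::nat) (m::nat) (\<delta>::real) (X::real mat) (\<mu>::real mat measure).
          1 \<le> n \<longrightarrow> 1 \<le> m \<longrightarrow> 0 < \<delta> \<longrightarrow> X \<in> Proj 1 (2 * n) \<longrightarrow>
          uniform_on_Proj n (2 * n) \<mu> \<longrightarrow>
          real m \<ge> C / \<delta>\<^sup>2 * real n * ln (real n) \<longrightarrow>
          measure (Pi\<^sub>M {..<m} (\<lambda>_. \<mu>))
            {Ps \<in> space (Pi\<^sub>M {..<m} (\<lambda>_. \<mu>)).
               (\<exists>Y. pep_solution (2 * n) m Ps (Phi Ps X) Y) \<and>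
               (\<forall>Y. pep_solution (2 * n) m Ps (Phi Ps X) Y \<longrightarrow> op_norm (Y - X) < \<delta>)}
            \<ge> 1 - real n powr (- \<alpha>)) \<and>
       (\<forall>(n::nat) (m::nat) (\<delta>::real) (X::complex mat) (\<mu>::complex mat measure).
          1 \<le> n \<longrightarrow> 1 \<le> m \<longrightarrow> 0 < \<delta> \<longrightarrow> X \<in> Proj 1 (2 * n) \<longrightarrow>
          uniform_on_Proj n (2 * n) \<mu> \<longrightarrow>
          real m \<ge> C / \<delta>\<^sup>2 * real n * ln (real n) \<longrightarrow>
          measure (Pi\<^sub>M {..<m} (\<lambda>_. \<mu>))
            {Ps \<in> space (Pi\<^sub>M {..<m} (\<lambda>_. \<mu>)).
               (\<exists>Y. pep_solution (2 * n) m Ps (Phi Ps X) Y) \<and>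
               (\<forall>Y. pep_solution (2 * n) m Ps (Phi Ps X) Y \<longrightarrow> op_norm (Y - X) < \<delta>)}
            \<ge> 1 - real n powr (- \<alpha>))"
  using assms
  by (intro exI[of _ "1250000 * (25 + \<alpha>)"] conjI allI impI recovery_guarantee) auto

end
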